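(* Let $k\ge a\ge 1$ be integers. For $n\ge 0$ let $\overline{E}_{k,a}(n)$ be the number of lattice paths (of the kind described in the context) with major index $n$ that satisfy the special $(k,a)$-conditions, and let $\overline{B}_{k,a}(n)$ be the number of overpartitions of $n$ of the form $\lambda_1+\lambda_2+\cdots+\lambda_s$ such that $1$ occurs as a non-overlined part at most $a-1$ times, and $\lambda_j-\lambda_{j+k-1}\ge 1$ if $\lambda_j$ is overlined and $\lambda_j-\lambda_{j+k-1}\ge 2$ otherwise. Then $\overline{E}_{k,a}(n)=\overline{B}_{k,a}(n)$ for all $n\ge 0$, and \[ \sum_{n\ge0}\overline{E}_{k,a}(n)q^n=\sum_{N_1\geq\cdots\geq N_{k-1}\geq0} \frac{q^{\frac{(N_1+1)N_1}{2}+N_2^2+\cdots+N_{k-1}^2+N_{a+1}+\cdots+N_{k-1}} (-q)_{N_1-1}(1+q^{N_a})}{(q)_{N_1-N_2}\cdots(q)_{N_{k-2}-N_{k-1}}(q)_{N_{k-1}}} =\frac{(-q)_\infty(q^a,q^{2k-a},q^{2k};q^{2k})_\infty}{(q)_\infty}. \]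
   Context: Notation: $(a)_n=(a;q)_n=\prod_{i=0}^{n-1}(1-aq^i)$, $(a)_\infty=\prod_{i\ge0}(1-aq^i)$, $(a_1,\dots,a_j;q)_\infty=\prod_i(a_i;q)_\infty$; for negative $n$, $(a;q)_n=(a;q)_\infty/(aq^n;q)_\infty$ (so $(-q)_{-1}=1/2$). Convention: $N_k=0$; empty sums such as $N_{a+1}+\cdots+N_{k-1}$ (when $a\ge k-1$) are $0$. An overpartition of $n$ is a non-increasing sequence of positive integers summing to $n$ in which the first occurrence of each integer may be overlined. Lattice paths: paths in the first quadrant starting on the $y$-axis and ending on the $x$-axis, using unit steps North-East $(x,y)\to(x+1,y+1)$, South-East $(x,y)\to(x+1,y-1)$, North $(x,y-1)\to(x,y)$, and East $(x,0)\to(x+1,0)$ (East steps occur only at height $0$). The height of a vertex is its $y$-coordinate and its weight is its $x$-coordinate. A peak is a vertex preceded by a North-East step (an NESE peak) or by a North step (an NSE peak) and followed by a South-East step. Paths are either empty or end with a South-East step; as stated in the paper, if the leftmost peak is an NSE peak, the path must start with an NE step, except when it starts at $(0,0)$ with an E step. The major index of a path is the sum of the weights of its peaks. A path satisfies the special $(k,a)$-conditions if it starts at height $k-a$ and all its heights are less than $k$.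
   Formalization: The path rules are corrected: if the leftmost peak is an NSE peak, the path must start with an SE (not NE) step, except when it starts at (0,0) with an E step; and a North step may occur only immediately before a South-East step. As printed the claim fails (k=2, a=1, n=1: E=0, B=1). *)

theory Defs
  imports "HOL-Analysis.Analysis"
begin

subsection \<open>q-shifted factorials\<close>

definition qpoch_inf :: "complex \<Rightarrow> complex \<Rightarrow> complex" where
  "qpoch_inf a q = (\<Prod>i. 1 - a * q ^ i)"

text \<open>The branch for negative \<open>n\<close> needs \<open>q \<noteq> 0\<close>; then \<open>qpoch (- q) q (- 1) = 1 / 2\<close>.\<close>

definition qpoch :: "complex \<Rightarrow> complex \<Rightarrow> int \<Rightarrow> complex" where
  "qpoch a q n =
     (if 0 \<le> n then (\<Prod>i<nat n. 1 - a * q ^ i)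
      else qpoch_inf a q / qpoch_inf (a * q powi n) q)"


subsection \<open>Overpartitions\<close>

text \<open>A part is a pair of its size and a flag that is true iff the part is overlined.\<close>

definition overpartition :: "(nat \<times> bool) list \<Rightarrow> bool" where
  "overpartition ps \<longleftrightarrow>
     (\<forall>p\<in>set ps. 0 < fst p) \<and>
     sorted_wrt (\<ge>) (map fst ps) \<and>
     (\<forall>j<length ps. snd (ps ! j) \<longrightarrow> (\<forall>i<j. fst (ps ! i) \<noteq> fst (ps ! j)))"

text \<open>List positions start at \<open>0\<close>; the difference condition is imposed whenever both parts exist.\<close>

definition B_cond :: "nat \<Rightarrow> nat \<Rightarrow> (nat \<times> bool) list \<Rightarrow> bool" where
  "B_cond k a ps \<longleftrightarrow>
     count_list ps (1, False) \<le> a - 1 \<and>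
     (\<forall>j. j + k - 1 < length ps \<longrightarrow>
        int (fst (ps ! j)) - int (fst (ps ! (j + k - 1))) \<ge> (if snd (ps ! j) then 1 else 2))"

definition B_bar :: "nat \<Rightarrow> nat \<Rightarrow> nat \<Rightarrow> nat" where
  "B_bar k a n = card {ps. overpartition ps \<and> sum_list (map fst ps) = n \<and> B_cond k a ps}"


subsection \<open>Lattice paths\<close>

datatype lstep = NorthEast | SouthEast | North | East

fun move :: "lstep \<Rightarrow> nat \<times> int \<Rightarrow> nat \<times> int" where
  "move NorthEast (x, y) = (x + 1, y + 1)"
| "move SouthEast (x, y) = (x + 1, y - 1)"
| "move North (x, y) = (x, y + 1)"
| "move East (x, y) = (x + 1, y)"

text \<open>A path is given by the height of its starting point on the \<open>y\<close>-axis and its list of steps;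
  its vertices are numbered from \<open>0\<close>, and vertex \<open>i\<close> lies between the steps \<open>i - 1\<close> and \<open>i\<close>.\<close>

type_synonym lpath = "nat \<times> lstep list"

definition vertex :: "lpath \<Rightarrow> nat \<Rightarrow> nat \<times> int" where
  "vertex P i = fold move (take i (snd P)) (0, int (fst P))"

definition weight :: "lpath \<Rightarrow> nat \<Rightarrow> nat" where
  "weight P i = fst (vertex P i)"

definition height :: "lpath \<Rightarrow> nat \<Rightarrow> int" where
  "height P i = snd (vertex P i)"

definition peaks :: "lpath \<Rightarrow> nat set" where
  "peaks P = {i. 0 < i \<and> i < length (snd P) \<and>
     snd P ! (i - 1) \<in> {NorthEast, North} \<and> snd P ! i = SouthEast}"

text \<open>Two points where a looser or more literal reading of the usual description is not the class
  that is actually counted. First, a North step may only occur immediately before a South-East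
  step, i.e. as the ascent of an NSE peak. Second, if the leftmost peak is an NSE peak, then the
  path must start with a South-East step, except when it starts at \<open>(0,0)\<close> with an East step. The
  rule is sometimes printed with ``NE step'' in place of ``SE step'', but that is a misprint: for
  \<open>k = 2\<close>, \<open>a = 1\<close> it would exclude the only path of major index \<open>1\<close> (start at height \<open>1\<close>, steps
  SE, N, SE), although the overpartition consisting of one overlined \<open>1\<close> is counted.\<close>

definition lattice_path :: "lpath \<Rightarrow> bool" where
  "lattice_path P \<longleftrightarrow>
     (let s = snd P in
       (\<forall>i\<le>length s. 0 \<le> height P i) \<and>
       height P (length s) = 0 \<and>
       (\<forall>i<length s. s ! i = East \<longrightarrow> height P i = 0) \<and>
       (\<forall>i<length s. s ! i = North \<longrightarrow> i + 1 < length s \<and> s ! (i + 1) = SouthEast) \<and>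
       (s = [] \<or> last s = SouthEast) \<and>
       (peaks P \<noteq> {} \<and> s ! (Min (peaks P) - 1) = North \<longrightarrow>
          hd s = SouthEast \<or> (fst P = 0 \<and> hd s = East)))"

definition major_index :: "lpath \<Rightarrow> nat" where
  "major_index P = (\<Sum>i\<in>peaks P. weight P i)"

definition special_cond :: "nat \<Rightarrow> nat \<Rightarrow> lpath \<Rightarrow> bool" where
  "special_cond k a P \<longleftrightarrow>
     height P 0 = int k - int a \<and> (\<forall>i\<le>length (snd P). height P i < int k)"

definition E_bar :: "nat \<Rightarrow> nat \<Rightarrow> nat \<Rightarrow> nat" where
  "E_bar k a n = card {P. lattice_path P \<and> major_index P = n \<and> special_cond k a P}"


subsection \<open>The multiple series\<close>

text \<open>An index tuple \<open>N\<^sub>1 \<ge> \<dots> \<ge> N\<^bsub>k-1\<^esub> \<ge> 0\<close> is a function on \<open>nat\<close> that vanishes outside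
  \<open>{1..<k}\<close>, which gives each tuple exactly one representative and builds in \<open>N\<^sub>k = 0\<close>.\<close>

definition index_tuples :: "nat \<Rightarrow> (nat \<Rightarrow> nat) set" where
  "index_tuples k = {N. (\<forall>i. i \<notin> {1..<k} \<longrightarrow> N i = 0) \<and> (\<forall>i\<in>{1..<k}. N (i + 1) \<le> N i)}"

text \<open>With \<open>N\<^sub>k = 0\<close>, the factor of the denominator for \<open>i = k - 1\<close> is \<open>(q)\<close> with index
  \<open>N\<^bsub>k-1\<^esub>\<close>.\<close>

definition series_term :: "nat \<Rightarrow> nat \<Rightarrow> complex \<Rightarrow> (nat \<Rightarrow> nat) \<Rightarrow> complex" where
  "series_term k a q N =
     q ^ ((N 1 + 1) * N 1 div 2 + (\<Sum>i\<in>{2..<k}. (N i)\<^sup>2) + (\<Sum>i\<in>{a+1..<k}. N i))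
       * qpoch (- q) q (int (N 1) - 1) * (1 + q ^ N a)
     / (\<Prod>i\<in>{1..<k}. qpoch q q (int (N i) - int (N (i + 1))))"

definition product_side :: "nat \<Rightarrow> nat \<Rightarrow> complex \<Rightarrow> complex" where
  "product_side k a q =
     qpoch_inf (- q) q
       * (qpoch_inf (q ^ a) (q ^ (2 * k)) * qpoch_inf (q ^ (2 * k - a)) (q ^ (2 * k))
          * qpoch_inf (q ^ (2 * k)) (q ^ (2 * k)))
     / qpoch_inf q q"

end

theory Submission
  imports Defs "HOL-Library.Multiset"
begin

text \<open>Fix \<open>q\<close> with \<open>0 < \<bar>q\<bar> < 1\<close> and let \<open>W k h N\<close> be the sum over \<open>n\<close> of
  $(-1)^n q^{(k-1/2)n^2+(h+1/2)n} / ((q)_{N-n} (q)_{N+n})$. Removing the first step of a lattice path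
  yields a linear system for the generating functions of the paths with \<open>N\<close> peaks that start at
  height \<open>h\<close>. Up to simple factors \<open>W\<close> solves it, because of a three-term relation in \<open>h\<close> and of
  reflections at the two ends of the range of heights. A limiting \<open>q\<close>-Vandermonde sum carries \<open>W k\<close>
  to \<open>W (k + 1)\<close>, so the part of the multiple series with \<open>N\<^sub>1 = N\<close> has the same value. Summing over
  \<open>N\<close> turns \<open>W\<close> into the theta series of $(-1)^n q^{kn^2+(k-a)n}$, which the Jacobi triple product
  evaluates. The overpartitions with all parts greater than \<open>m\<close> obey a recurrence of Andrews type
  in \<open>m\<close>; its only solution with the right limit is an explicit single series, which for \<open>m = 0\<close> is
  the same theta series.\<close>

subsection \<open>Finite sums of Bailey type\<close>

text \<open>The identities are proved for complex q in the punctured unit disc, so convergence is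
  part of the work. For paths and overpartitions it comes from the recurrences themselves, which
  bound truncated sums at |q| before any value is known. Regrouping the multiple series and the path
  series needs absolute convergence; this is obtained by applying the finished results once more
  with |q| in place of q, where all terms are nonnegative and dominate those at q. The equality of
  the two counting functions is then read off from equal values on the punctured disc.

  The rule on the leftmost peak is not inherited when a first step is removed. Hence the linear
  system is solved for paths without this rule, and the paths obeying it are obtained from that
  solution.

  The factor that is left open when summing over N is never computed directly. For k = 1 only the
  empty path and the empty overpartition are admissible, both generating functions are 1, and this
  identifies the factor with the quotient of (-q) and (q) at infinity.\<close>

lemma convergent_prod_qpoch:
  fixes a q :: complex
  assumes "norm q < 1"
  shows "convergent_prod (\<lambda>i. 1 - a * q ^ i)"
proof -
  have "summable (\<lambda>i. norm a * norm q ^ i)"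
    using assms by (intro summable_mult summable_geometric) auto
  then have "abs_convergent_prod (\<lambda>i. 1 - a * q ^ i)"
    by (intro summable_imp_abs_convergent_prod) (simp add: norm_mult norm_power)
  then show ?thesis
    by (rule abs_convergent_prod_imp_convergent_prod)
qed

lemma qpoch_inf_LIMSEQ:
  assumes "norm q < 1"
  shows "(\<lambda>n. \<Prod>i<n. 1 - a * q ^ i) \<longlonglongrightarrow> qpoch_inf a q"
proof -
  have "(\<lambda>n. \<Prod>i\<le>n. 1 - a * q ^ i) \<longlonglongrightarrow> qpoch_inf a q"
    unfolding qpoch_inf_def by (rule convergent_prod_LIMSEQ[OF convergent_prod_qpoch[OF assms]])
  then have "(\<lambda>n. \<Prod>i<Suc n. 1 - a * q ^ i) \<longlonglongrightarrow> qpoch_inf a q"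
    by (simp add: lessThan_Suc_atMost)
  then show ?thesis
    by (rule LIMSEQ_imp_Suc)
qed

lemma qpoch_inf_nonzero:
  assumes "norm q < 1" "\<And>i. a * q ^ i \<noteq> 1"
  shows "qpoch_inf a q \<noteq> 0"
  unfolding qpoch_inf_def
  using assms(2) by (intro prodinf_nonzero convergent_prod_qpoch[OF assms(1)]) auto

lemma two_tri: "2 * (n * (n - 1) div 2) = n * (n - 1)" for n :: int
  by simp

lemma double_eqD: "2 * x = 2 * y \<Longrightarrow> x = y" for x y :: int
  by simp

section \<open>The nome q and its q-factorials\<close>

locale nome =
  fixes q :: complex
  assumes q_nz: "q \<noteq> 0" and q_lt: "norm q < 1"
begin

definition pochq :: "nat \<Rightarrow> complex" where
  "pochq n = (\<Prod>i<n. 1 - q ^ (i + 1))"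

definition pochm :: "nat \<Rightarrow> complex" where
  "pochm n = (\<Prod>i<n. 1 + q ^ (i + 1))"

text \<open>Reading 1/(q)_j as 0 for negative j makes \<open>invq_rec\<close> true for every integer
  j (at j = 0 both sides vanish). Summation ranges can therefore be enlarged at will, and shifts of
  the index produce no boundary terms.\<close>

definition invq :: "int \<Rightarrow> complex" where
  "invq j = (if j < 0 then 0 else 1 / pochq (nat j))"

lemma norm_q_power: "n > 0 \<Longrightarrow> norm (q ^ n) < 1"
  using q_lt by (simp add: norm_power power_less_one_iff)

lemma norm_q_power_le: "norm (q ^ n) \<le> 1"
  using q_lt by (simp add: norm_power power_le_one)

lemma one_minus_q_nz: "n > 0 \<Longrightarrow> 1 - q ^ n \<noteq> 0"
  using norm_q_power[of n] by auto

lemma one_plus_q_nz: "1 + q ^ n \<noteq> 0"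
proof (cases "n = 0")
  case False
  then have "norm (q ^ n) < 1" by (intro norm_q_power) auto
  moreover have "norm (q ^ n) = 1" if "1 + q ^ n = 0"
    using that by (metis add_eq_0_iff norm_minus_cancel norm_one)
  ultimately show ?thesis by force
qed auto

lemma one_plus_q_powi_nz: "1 + q powi n \<noteq> 0"
proof (cases "n \<ge> 0")
  case True
  then show ?thesis using one_plus_q_nz[of "nat n"] by (simp add: power_int_def)
next
  case False
  then have "1 + q powi n = (1 + q ^ nat (- n)) / q ^ nat (- n)"
    using q_nz by (simp add: power_int_def field_simps)
  then show ?thesis using one_plus_q_nz[of "nat (- n)"] q_nz by simp
qed

lemma pochq_0 [simp]: "pochq 0 = 1" and pochq_Suc: "pochq (Suc n) = pochq n * (1 - q ^ Suc n)"
  by (simp_all add: pochq_def)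

lemma pochm_0 [simp]: "pochm 0 = 1" and pochm_Suc: "pochm (Suc n) = pochm n * (1 + q ^ Suc n)"
  by (simp_all add: pochm_def)

lemma pochq_nz [simp]: "pochq n \<noteq> 0"
proof -
  have "1 - q ^ (i + 1) \<noteq> 0" for i using one_minus_q_nz[of "i + 1"] by simp
  then show ?thesis unfolding pochq_def by (subst prod_zero_iff) auto
qed

lemma pochm_nz [simp]: "pochm n \<noteq> 0"
proof -
  have "1 + q ^ (i + 1) \<noteq> 0" for i using one_plus_q_nz[of "i + 1"] by simp
  then show ?thesis unfolding pochm_def by (subst prod_zero_iff) auto
qed

lemma pochq_LIMSEQ: "pochq \<longlonglongrightarrow> qpoch_inf q q"
  using qpoch_inf_LIMSEQ[OF q_lt, of q] unfolding pochq_def by simp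

lemma pochm_LIMSEQ: "pochm \<longlonglongrightarrow> qpoch_inf (- q) q"
  using qpoch_inf_LIMSEQ[OF q_lt, of "- q"] unfolding pochm_def by simp

lemma qpoch_inf_q_nz: "qpoch_inf q q \<noteq> 0"
proof (intro qpoch_inf_nonzero q_lt)
  fix i show "q * q ^ i \<noteq> 1"
    using one_minus_q_nz[of "Suc i"] by auto
qed

lemma qpoch_inf_mq_nz: "qpoch_inf (- q) q \<noteq> 0"
proof (intro qpoch_inf_nonzero q_lt)
  fix i show "- q * q ^ i \<noteq> 1"
    using one_plus_q_nz[of "Suc i"] by (metis add.right_inverse mult_minus_left power_Suc minus_equation_iff)
qed

lemma poch_bounded:
  obtains C where "C \<ge> 1" "\<And>n. norm (pochq n) \<le> C" "\<And>n. norm (inverse (pochq n)) \<le> C"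
    "\<And>n. norm (pochm n) \<le> C" "\<And>n. norm (inverse (pochm n)) \<le> C"
proof -
  have "Bseq pochq" "Bseq (\<lambda>n. inverse (pochq n))" "Bseq pochm" "Bseq (\<lambda>n. inverse (pochm n))"
    using pochq_LIMSEQ pochm_LIMSEQ tendsto_inverse[OF pochq_LIMSEQ qpoch_inf_q_nz]
      tendsto_inverse[OF pochm_LIMSEQ qpoch_inf_mq_nz]
    by (auto intro!: convergent_imp_Bseq simp: convergent_def)
  then obtain C1 C2 C3 C4 where "\<forall>n. norm (pochq n) \<le> C1" "\<forall>n. norm (inverse (pochq n)) \<le> C2"
    "\<forall>n. norm (pochm n) \<le> C3" "\<forall>n. norm (inverse (pochm n)) \<le> C4"
    unfolding Bseq_def by blast
  then show ?thesis
    by (intro that[of "max 1 (max C1 (max C2 (max C3 C4)))"]) (auto simp: le_max_iff_disj)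
qed

lemma invq_of_nat [simp]: "invq (int n) = 1 / pochq n"
  by (simp add: invq_def)

lemma invq_neg [simp]: "j < 0 \<Longrightarrow> invq j = 0"
  by (simp add: invq_def)

lemma invq_0 [simp]: "invq 0 = 1"
  by (simp add: invq_def)

lemma invq_rec: "(1 - q powi j) * invq j = invq (j - 1)"
proof (cases "j > 0")
  case True
  then obtain n where j: "j = int (Suc n)" by (metis gr0_implies_Suc pos_int_cases)
  then have "invq (j - 1) = 1 / pochq n" by simp
  moreover have "invq j = 1 / pochq (Suc n)" unfolding j by (rule invq_of_nat)
  moreover have "q powi j = q ^ Suc n" unfolding j by (rule power_int_of_nat)
  ultimately show ?thesis
    using one_minus_q_nz[of "Suc n"] by (simp add: pochq_Suc)
qed (cases "j = 0"; simp)

lemma invq_bounded: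
  obtains C where "C \<ge> 1" "\<And>j. norm (invq j) \<le> C"
proof -
  obtain C where "C \<ge> 1" "\<And>n. norm (inverse (pochq n)) \<le> C"
    using poch_bounded by metis
  then show ?thesis
    by (intro that[of C]) (auto simp: invq_def inverse_eq_divide)
qed

text \<open>\<open>tau k h n\<close> is $(-1)^n q^{(k-1/2)n^2+(h+1/2)n}$. The half-integers are the reason for the two
  reflections \<open>h \<mapsto> - 1 - h\<close> and, for \<open>h = k - 1\<close>, \<open>n \<mapsto> - 1 - n\<close>.\<close>

definition tau :: "int \<Rightarrow> int \<Rightarrow> int \<Rightarrow> complex" where
  "tau k h n = (- 1) powi n * q powi (k * n\<^sup>2 + h * n - n * (n - 1) div 2)"

definition W :: "int \<Rightarrow> int \<Rightarrow> nat \<Rightarrow> complex" where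
  "W k h N = (\<Sum>n\<in>{- int N..int N}. tau k h n * invq (int N - n) * invq (int N + n))"

lemma W_eq:
  assumes "finite A" "{- int N..int N} \<subseteq> A"
  shows "W k h N = (\<Sum>n\<in>A. tau k h n * invq (int N - n) * invq (int N + n))"
  unfolding W_def using assms by (intro sum.mono_neutral_left) auto

lemma tau_add: "tau k (h + j) n = q powi (j * n) * tau k h n"
proof -
  have "k * n\<^sup>2 + (h + j) * n - n * (n - 1) div 2 = j * n + (k * n\<^sup>2 + h * n - n * (n - 1) div 2)"
    by (simp add: algebra_simps)
  then show ?thesis
    unfolding tau_def by (simp only: power_int_add[OF disjI1[OF q_nz]] mult.left_commute)
qed

lemma tau_reflect: "tau k (- 1 - h) (- n) = tau k h n"
proof -
  have "2 * (k * (- n)\<^sup>2 + (- 1 - h) * (- n) - (- n) * (- n - 1) div 2) =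
        2 * (k * n\<^sup>2 + h * n - n * (n - 1) div 2)"
    unfolding right_diff_distrib two_tri two_tri[of "- n"] by (simp add: algebra_simps)
  then have "k * (- n)\<^sup>2 + (- 1 - h) * (- n) - (- n) * (- n - 1) div 2 =
        k * n\<^sup>2 + h * n - n * (n - 1) div 2" by (rule double_eqD)
  then show ?thesis
    by (simp only: tau_def power_int_minus_one_minus)
qed

text \<open>For h = k - 1 the exponent is (k - 1/2)(n^2 + n), symmetric about n = -1/2, whereas n
  and -1 - n have opposite parity.\<close>

lemma tau_antisym: "tau k (k - 1) (- 1 - n) = - tau k (k - 1) n"
proof -
  have "2 * (k * (- 1 - n)\<^sup>2 + (k - 1) * (- 1 - n) - (- 1 - n) * (- 1 - n - 1) div 2) =
        2 * (k * n\<^sup>2 + (k - 1) * n - n * (n - 1) div 2)"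
    unfolding right_diff_distrib[of 2] two_tri two_tri[of "- 1 - n"]
    by (simp add: algebra_simps power2_eq_square)
  then have "k * (- 1 - n)\<^sup>2 + (k - 1) * (- 1 - n) - (- 1 - n) * (- 1 - n - 1) div 2 =
        k * n\<^sup>2 + (k - 1) * n - n * (n - 1) div 2" by (rule double_eqD)
  moreover have "(- 1) powi (- 1 - n) = - ((- 1) powi n :: complex)"
    using power_int_minus_one_minus[of "1 + n", where 'a = complex] by (simp add: power_int_add)
  ultimately show ?thesis
    by (simp only: tau_def) simp
qed

lemma tau_Suc: "tau (k + 1) h n = q powi (n\<^sup>2) * tau k h n"
proof -
  have "(k + 1) * n\<^sup>2 + h * n - n * (n - 1) div 2 = n\<^sup>2 + (k * n\<^sup>2 + h * n - n * (n - 1) div 2)"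
    by (simp add: algebra_simps)
  then show ?thesis
    unfolding tau_def by (simp only: power_int_add[OF disjI1[OF q_nz]] mult.left_commute)
qed

lemma W_reflect: "W k (- 1 - h) N = W k h N"
  unfolding W_def
proof (rule sum.reindex_bij_witness[of _ uminus uminus])
  fix n :: int
  show "tau k h (- n) * invq (int N - - n) * invq (int N + - n) =
    tau k (- 1 - h) n * invq (int N - n) * invq (int N + n)"
    using tau_reflect[of k h "- n"] by (simp add: mult.commute mult.left_commute)
qed auto

lemma W_minus_1: "W k (- 1) N = W k 0 N"
  using W_reflect[of k 0] by simp

text \<open>Passing from N - 1 to N costs the factor (1 - q^(N-n))(1 - q^(N+n)) = 1 + q^(2N) - q^N
  (q^n + q^(-n)), and multiplying \<open>tau\<close> by q^n or q^(-n) moves h up or down by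
  one.\<close>

lemma W_rec:
  assumes "N \<ge> 1"
  shows "(1 + q ^ (2 * N)) * W k h N - q ^ N * (W k (h - 1) N + W k (h + 1) N) = W k h (N - 1)"
proof -
  let ?A = "{- int N..int N}"
  have "W k h (N - 1) = (\<Sum>n\<in>?A. tau k h n * invq (int (N - 1) - n) * invq (int (N - 1) + n))"
    by (rule W_eq) auto
  also have "\<dots> = (\<Sum>n\<in>?A. (1 + q ^ (2 * N)) * (tau k h n * invq (int N - n) * invq (int N + n))
      - q ^ N * (tau k (h - 1) n * invq (int N - n) * invq (int N + n)
               + tau k (h + 1) n * invq (int N - n) * invq (int N + n)))"
  proof (rule sum.cong[OF refl])
    fix n
    have 1: "invq (int (N - 1) - n) = (1 - q powi (int N - n)) * invq (int N - n)"
      using invq_rec[of "int N - n"] assms by (simp add: of_nat_diff algebra_simps)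
    have 2: "invq (int (N - 1) + n) = (1 - q powi (int N + n)) * invq (int N + n)"
      using invq_rec[of "int N + n"] assms by (simp add: of_nat_diff algebra_simps)
    have 3: "tau k (h - 1) n = q powi (- n) * tau k h n" "tau k (h + 1) n = q powi n * tau k h n"
      using tau_add[of k h "-1" n] tau_add[of k h 1 n] by simp_all
    have 4: "(1 - q powi (int N - n)) * (1 - q powi (int N + n))
        = 1 + q ^ (2 * N) - q ^ N * (q powi (- n) + q powi n)"
    proof -
      have "q ^ (2 * N) = q ^ N * q ^ N" by (simp add: mult_2 power_add)
      then show ?thesis
        using q_nz by (simp add: power_int_add power_int_diff power_int_minus field_simps)
    qed
    have "tau k h n * invq (int (N - 1) - n) * invq (int (N - 1) + n) =
      ((1 - q powi (int N - n)) * (1 - q powi (int N + n))) * (tau k h n * invq (int N - n) * invq (int N + n))"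
      unfolding 1 2 by (simp add: algebra_simps)
    then show "tau k h n * invq (int (N - 1) - n) * invq (int (N - 1) + n) =
      (1 + q ^ (2 * N)) * (tau k h n * invq (int N - n) * invq (int N + n))
      - q ^ N * (tau k (h - 1) n * invq (int N - n) * invq (int N + n)
               + tau k (h + 1) n * invq (int N - n) * invq (int N + n))"
      unfolding 4 3 by (simp add: algebra_simps)
  qed
  also have "\<dots> = (1 + q ^ (2 * N)) * W k h N - q ^ N * (W k (h - 1) N + W k (h + 1) N)"
    unfolding W_def by (simp only: sum_subtractf sum.distrib sum_distrib_left[symmetric])
  finally show ?thesis by simp
qed

text \<open>The difference of the two sides puts a factor 1 - q^(N-n) on the summand, which lowers
  one index of \<open>invq\<close>. What remains changes sign under n -> -1 - n, so the sum is its
  own negative.\<close>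

lemma W_top: "W k (k - 1) N = q ^ N * W k (k - 2) N"
proof -
  \<comment> \<open>The additional point -N - 1 contributes 0 and makes the range invariant under n
    -> -1 - n.\<close>
  let ?A = "{- int N - 1..int N}"
  let ?g = "\<lambda>n. tau k (k - 1) n * invq (int N - n - 1) * invq (int N + n)"
  have W: "W k h N = (\<Sum>n\<in>?A. tau k h n * invq (int N - n) * invq (int N + n))" for h
    by (rule W_eq) auto
  have "W k (k - 1) N - q ^ N * W k (k - 2) N = (\<Sum>n\<in>?A. ?g n)"
    unfolding W sum_distrib_left sum_subtractf[symmetric]
  proof (rule sum.cong[OF refl])
    fix n
    have 1: "invq (int N - n - 1) = (1 - q powi (int N - n)) * invq (int N - n)"
      using invq_rec[of "int N - n"] by simp
    have 2: "tau k (k - 2) n = q powi (- n) * tau k (k - 1) n"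
      using tau_add[of k "k - 1" "-1" n] by simp
    show "tau k (k - 1) n * invq (int N - n) * invq (int N + n)
        - q ^ N * (tau k (k - 2) n * invq (int N - n) * invq (int N + n)) = ?g n"
      unfolding 1 2 using q_nz
      by (simp add: power_int_diff power_int_minus field_simps)
  qed
  moreover have "(\<Sum>n\<in>?A. ?g n) = (\<Sum>n\<in>?A. - ?g n)"
  proof (rule sum.reindex_bij_witness[of _ "\<lambda>n. - 1 - n" "\<lambda>n. - 1 - n"])
    fix n
    show "- ?g (- 1 - n) = ?g n"
      using tau_antisym[of k n] by (simp add: algebra_simps)
  qed auto
  then have "2 * (\<Sum>n\<in>?A. ?g n) = 0"
    unfolding sum_negf by (simp only: mult_2 eq_neg_iff_add_eq_0)
  ultimately show ?thesis by simp
qed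

lemma W_zero: "W k h 0 = 1"
  by (simp add: W_def tau_def)

text \<open>For k = 1 the two ends of the range of heights coincide, and combining both reflections
  gives W = q^N W.\<close>

lemma W_1: "W 1 0 N = (if N = 0 then 1 else 0)"
proof (cases "N = 0")
  case False
  have "W 1 0 N = q ^ N * W 1 0 N"
    using W_top[of 1 N] W_minus_1[of 1 N] by simp
  then have "(1 - q ^ N) * W 1 0 N = 0" by (simp add: algebra_simps)
  then show ?thesis using one_minus_q_nz[of N] False by simp
qed (simp add: W_zero)

text \<open>The weight 1 - q^(m+1) = (1 - q^(m+1-s)) + q^(m+1-s) (1 - q^s) splits the sum for m + 1
  into two sums for m, one of them with s shifted and c replaced by c + 1. This is why c is
  arbitrary in the induction; negative c is covered by the convention for
  \<open>invq\<close>.\<close>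

lemma q_vandermonde:
  "(\<Sum>s\<le>m. q powi ((int s)\<^sup>2 + c * int s) * invq (int m - int s) * invq (int s) * invq (c + int s))
    = invq (int m) * invq (int m + c)"
proof (induction m arbitrary: c)
  case (Suc m)
  define G where "G = (\<lambda>m c. \<Sum>s\<le>m. q powi ((int s)\<^sup>2 + c * int s) * invq (int m - int s) * invq (int s) * invq (c + int s))"
  let ?t = "\<lambda>s. q powi ((int s)\<^sup>2 + c * int s) * invq (int (Suc m) - int s) * invq (int s) * invq (c + int s)"
  let ?u = "\<lambda>s. q powi ((int s)\<^sup>2 + c * int s) * invq (int m - int s) * invq (int s) * invq (c + int s)"
  let ?v = "\<lambda>s. q powi ((int s)\<^sup>2 + c * int s + (int (Suc m) - int s)) * invq (int (Suc m) - int s) * invq (int s - 1) * invq (c + int s)"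
  have "(1 - q ^ Suc m) * ?t s = ?u s + ?v s" for s
  proof -
    have 1: "invq (int m - int s) = (1 - q powi (int (Suc m) - int s)) * invq (int (Suc m) - int s)"
      using invq_rec[of "int (Suc m) - int s"] by (simp add: algebra_simps)
    have 2: "invq (int s - 1) = (1 - q ^ s) * invq (int s)"
      using invq_rec[of "int s"] by simp
    have 3: "1 - q ^ Suc m = (1 - q powi (int (Suc m) - int s)) + q powi (int (Suc m) - int s) * (1 - q ^ s)"
      using q_nz by (simp add: power_int_diff power_int_add field_simps)
    have 4: "q powi ((int s)\<^sup>2 + c * int s + (int (Suc m) - int s)) = q powi ((int s)\<^sup>2 + c * int s) * q powi (int (Suc m) - int s)"
      using q_nz by (rule power_int_add[OF disjI1])
    show ?thesis
      unfolding 1 2 3 4 by (simp only: algebra_simps)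
  qed
  then have "(1 - q ^ Suc m) * (\<Sum>s\<le>Suc m. ?t s) = (\<Sum>s\<le>Suc m. ?u s) + (\<Sum>s\<le>Suc m. ?v s)"
    by (simp only: sum_distrib_left sum.distrib)
  also have "(\<Sum>s\<le>Suc m. ?u s) = G m c"
    by (simp add: G_def)
  also have "(\<Sum>s\<le>Suc m. ?v s) = (\<Sum>s\<le>m. ?v (Suc s))"
    by (subst sum.atMost_Suc_shift) simp
  also have "\<dots> = q powi (int (Suc m) + c) * G m (c + 1)"
    unfolding G_def sum_distrib_left
  proof (rule sum.cong[OF refl])
    fix s
    have "(int (Suc s))\<^sup>2 + c * int (Suc s) + (int (Suc m) - int (Suc s)) =
       (int (Suc m) + c) + ((int s)\<^sup>2 + (c + 1) * int s)"
      by (simp add: power2_eq_square algebra_simps)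
    then have "q powi ((int (Suc s))\<^sup>2 + c * int (Suc s) + (int (Suc m) - int (Suc s))) =
      q powi (int (Suc m) + c) * q powi ((int s)\<^sup>2 + (c + 1) * int s)"
      using q_nz by (metis power_int_add)
    then show "?v (Suc s) = q powi (int (Suc m) + c) * (q powi ((int s)\<^sup>2 + (c + 1) * int s) * invq (int m - int s) *
        invq (int s) * invq (c + 1 + int s))"
      by (simp add: algebra_simps)
  qed
  also have "G m c + q powi (int (Suc m) + c) * G m (c + 1) =
     invq (int m) * (invq (int m + c) + q powi (int (Suc m) + c) * invq (int (Suc m) + c))"
    unfolding G_def Suc by (simp add: algebra_simps)
  also have "invq (int m + c) = (1 - q powi (int (Suc m) + c)) * invq (int (Suc m) + c)"
    using invq_rec[of "int (Suc m) + c"] by (simp add: algebra_simps)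
  also have "invq (int m) * ((1 - q powi (int (Suc m) + c)) * invq (int (Suc m) + c) +
      q powi (int (Suc m) + c) * invq (int (Suc m) + c)) = invq (int m) * invq (int (Suc m) + c)"
    by (simp add: algebra_simps)
  also have "invq (int m) = (1 - q ^ Suc m) * invq (int (Suc m))"
  proof -
    have "int (Suc m) - 1 = int m" by simp
    then show ?thesis using invq_rec[of "int (Suc m)"] by (metis power_int_of_nat)
  qed
  finally have "(1 - q ^ Suc m) * (\<Sum>s\<le>Suc m. ?t s) = (1 - q ^ Suc m) * (invq (int (Suc m)) * invq (int (Suc m) + c))"
    by (simp only: mult.assoc)
  then show ?case
    using one_minus_q_nz[of "Suc m"] by (simp only: mult_cancel_left) auto
qed simp

text \<open>With r = n + s, the square r^2 = n^2 + (s^2 + 2ns) leaves \<open>q_vandermonde\<close>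
  at c = 2n.\<close>

lemma bailey_step_nonneg:
  "(\<Sum>r\<le>N. q ^ (r\<^sup>2) * invq (int N - int r) * invq (int r - int n) * invq (int r + int n))
    = q ^ (n\<^sup>2) * invq (int N - int n) * invq (int N + int n)"
proof (cases "n \<le> N")
  case True
  then obtain m where N: "N = n + m" using le_Suc_ex by blast
  have "(\<Sum>r\<le>N. q ^ (r\<^sup>2) * invq (int N - int r) * invq (int r - int n) * invq (int r + int n))
      = (\<Sum>r\<in>{n..N}. q ^ (r\<^sup>2) * invq (int N - int r) * invq (int r - int n) * invq (int r + int n))"
    by (intro sum.mono_neutral_right) auto
  also have "\<dots> = (\<Sum>s\<le>m. q ^ (n\<^sup>2) * (q powi ((int s)\<^sup>2 + 2 * int n * int s) * invq (int m - int s) * invq (int s) * invq (2 * int n + int s)))"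
  proof (rule sum.reindex_bij_witness[of _ "\<lambda>s. n + s" "\<lambda>r. r - n"])
    fix r assume r: "r \<in> {n..N}"
    then obtain s where r': "r = n + s" using le_Suc_ex by auto
    have "q ^ (r\<^sup>2) = q powi int (r\<^sup>2)" by (rule power_int_of_nat[symmetric])
    also have "int (r\<^sup>2) = int (n\<^sup>2) + ((int s)\<^sup>2 + 2 * int n * int s)"
      by (simp add: r' power2_eq_square algebra_simps)
    also have "q powi \<dots> = q ^ (n\<^sup>2) * q powi ((int s)\<^sup>2 + 2 * int n * int s)"
      using q_nz by (subst power_int_add) (auto simp del: of_nat_power)
    finally show "q ^ (n\<^sup>2) * (q powi ((int (r - n))\<^sup>2 + 2 * int n * int (r - n)) * invq (int m - int (r - n)) * invq (int (r - n)) * invq (2 * int n + int (r - n))) =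
      q ^ (r\<^sup>2) * invq (int N - int r) * invq (int r - int n) * invq (int r + int n)"
      by (simp add: r' N del: invq_of_nat)
  qed (auto simp: N)
  also have "\<dots> = q ^ (n\<^sup>2) * (invq (int m) * invq (int m + 2 * int n))"
    unfolding sum_distrib_left[symmetric] q_vandermonde ..
  finally show ?thesis
    by (simp add: N algebra_simps)
qed (auto intro!: sum.neutral)

text \<open>This is the kernel of Bailey's lemma for a = 1 with both parameters sent to
  infinity.\<close>

lemma bailey_step:
  "(\<Sum>r\<le>N. q ^ (r\<^sup>2) * invq (int N - int r) * (invq (int r - n) * invq (int r + n)))
    = q powi (n\<^sup>2) * (invq (int N - n) * invq (int N + n))"
proof (cases "n \<ge> 0")
  case True
  then show ?thesis
    using bailey_step_nonneg[of N "nat n"] by (simp add: mult.assoc power_int_def nat_power_eq)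
next
  case False
  then obtain m where "n = - int m"
    by (metis le_cases neg_0_le_iff_le nonneg_int_cases minus_minus)
  moreover have "q powi ((int m)\<^sup>2) = q ^ (m\<^sup>2)"
    by (metis of_nat_power power_int_of_nat)
  ultimately show ?thesis
    using bailey_step_nonneg[of N m] by (simp add: mult.assoc mult.commute mult.left_commute)
qed

text \<open>The multiplier q^(n^2) produced by \<open>bailey_step\<close> is exactly the quotient of
  \<open>tau (k + 1) h n\<close> by \<open>tau k h n\<close>, so one step of the Bailey chain raises
  k and keeps h.\<close>

lemma W_Suc: "(\<Sum>r\<le>N. q ^ (r\<^sup>2) * invq (int N - int r) * W k h r) = W (k + 1) h N"
proof -
  let ?A = "{- int N..int N}"
  have "(\<Sum>r\<le>N. q ^ (r\<^sup>2) * invq (int N - int r) * W k h r) =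
    (\<Sum>r\<le>N. \<Sum>n\<in>?A. q ^ (r\<^sup>2) * invq (int N - int r) * (tau k h n * invq (int r - n) * invq (int r + n)))"
    by (intro sum.cong[OF refl]) (subst W_eq[of ?A], auto simp: sum_distrib_left)
  also have "\<dots> = (\<Sum>n\<in>?A. tau k h n * (\<Sum>r\<le>N. q ^ (r\<^sup>2) * invq (int N - int r) * (invq (int r - n) * invq (int r + n))))"
    by (subst sum.swap) (simp add: sum_distrib_left algebra_simps)
  also have "\<dots> = W (k + 1) h N"
    unfolding bailey_step W_def tau_Suc by (simp add: algebra_simps)
  finally show ?thesis .
qed

end

subsection \<open>Lattice paths by number of peaks\<close>

text \<open>On coefficient sequences this is multiplication of the generating function by the d-th
  power of the variable; \<open>shift_set\<close> is the same operation on graded families of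
  sets.\<close>

definition shift :: "nat \<Rightarrow> (nat \<Rightarrow> 'a::zero) \<Rightarrow> nat \<Rightarrow> 'a" where
  "shift d c n = (if d \<le> n then c (n - d) else 0)"

definition shift_set :: "nat \<Rightarrow> (nat \<Rightarrow> 'a set) \<Rightarrow> nat \<Rightarrow> 'a set" where
  "shift_set d F n = (if d \<le> n then F (n - d) else {})"

lemma card_shift_set: "card (shift_set d F n) = shift d (\<lambda>n. card (F n)) n"
  by (simp add: shift_def shift_set_def)

lemma card_image_shift_set:
  assumes "inj f"
  shows "card (f ` shift_set d F n) = shift d (\<lambda>n. card (F n)) n"
  using assms by (simp add: card_image card_shift_set inj_on_subset)

text \<open>The upper bound on the height is tested only at ascents, so that the starting height is
  below k has to be known separately.\<close>

fun admissible :: "nat \<Rightarrow> nat \<Rightarrow> lstep list \<Rightarrow> bool" where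
  "admissible k h [] \<longleftrightarrow> h = 0"
| "admissible k h (SouthEast # s) \<longleftrightarrow> h \<ge> 1 \<and> admissible k (h - 1) s"
| "admissible k h (NorthEast # s) \<longleftrightarrow> h + 1 < k \<and> admissible k (h + 1) s"
| "admissible k h (North # s) \<longleftrightarrow> h + 1 < k \<and> s \<noteq> [] \<and> hd s = SouthEast \<and> admissible k (h + 1) s"
| "admissible k h (East # s) \<longleftrightarrow> h = 0 \<and> s \<noteq> [] \<and> admissible k 0 s"

text \<open>The flag tells whether the step before the list is an ascent; the first argument of
  \<open>major\<close> is the weight of the starting point.\<close>

fun major :: "nat \<Rightarrow> bool \<Rightarrow> lstep list \<Rightarrow> nat" where
  "major x u [] = 0"
| "major x u (a # s) = (if a = SouthEast \<and> u then x else 0) +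
     major (if a = North then x else x + 1) (a = NorthEast \<or> a = North) s"

fun npeaks :: "bool \<Rightarrow> lstep list \<Rightarrow> nat" where
  "npeaks u [] = 0"
| "npeaks u (a # s) = (if a = SouthEast \<and> u then 1 else 0) + npeaks (a = NorthEast \<or> a = North) s"

fun nse_first :: "lstep list \<Rightarrow> bool" where
  "nse_first (a # b # s) = (if b = SouthEast \<and> (a = NorthEast \<or> a = North) then a = North else nse_first (b # s))"
| "nse_first _ = False"

lemma all_le_Suc_shift: "(\<forall>i\<le>Suc n. P i) \<longleftrightarrow> P 0 \<and> (\<forall>i\<le>n. P (Suc i))"
  using All_less_Suc2[of "Suc n" P] by (simp add: less_Suc_eq_le)

text \<open>The starting point p is arbitrary, so that the tail of a path is again of this form. The
  rule on the leftmost peak is left out because tails do not inherit it.\<close>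

definition in_strip :: "nat \<Rightarrow> nat \<times> int \<Rightarrow> lstep list \<Rightarrow> bool" where
  "in_strip k p s \<longleftrightarrow>
     (\<forall>i\<le>length s. 0 \<le> snd (fold move (take i s) p) \<and> snd (fold move (take i s) p) < int k) \<and>
     snd (fold move (take (length s) s) p) = 0 \<and>
     (\<forall>i<length s. s ! i = East \<longrightarrow> snd (fold move (take i s) p) = 0) \<and>
     (\<forall>i<length s. s ! i = North \<longrightarrow> i + 1 < length s \<and> s ! (i + 1) = SouthEast) \<and>
     (s = [] \<or> last s = SouthEast)"

lemma in_strip_Nil: "in_strip k p [] \<longleftrightarrow> snd p = 0 \<and> 0 < k"
  by (auto simp: in_strip_def)

lemma in_strip_Cons:
  "in_strip k p (a # s) \<longleftrightarrow>
     0 \<le> snd p \<and> snd p < int k \<and> (a = East \<longrightarrow> snd p = 0) \<and>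
     (a = North \<longrightarrow> s \<noteq> [] \<and> hd s = SouthEast) \<and> (s = [] \<longrightarrow> a = SouthEast) \<and> in_strip k (move a p) s"
proof -
  let ?H = "\<lambda>p i s. snd (fold move (take i s) p)"
  have 1: "(\<forall>i\<le>length (a # s). 0 \<le> ?H p i (a # s) \<and> ?H p i (a # s) < int k) \<longleftrightarrow>
     (0 \<le> snd p \<and> snd p < int k) \<and> (\<forall>i\<le>length s. 0 \<le> ?H (move a p) i s \<and> ?H (move a p) i s < int k)"
    by (simp add: all_le_Suc_shift del: all_simps)
  have 2: "?H p (length (a # s)) (a # s) = ?H (move a p) (length s) s"
    by simp
  have 3: "(\<forall>i<length (a # s). (a # s) ! i = East \<longrightarrow> ?H p i (a # s) = 0) \<longleftrightarrow>
     (a = East \<longrightarrow> snd p = 0) \<and> (\<forall>i<length s. s ! i = East \<longrightarrow> ?H (move a p) i s = 0)"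
    by (simp add: All_less_Suc2)
  have 4: "(\<forall>i<length (a # s). (a # s) ! i = North \<longrightarrow> i + 1 < length (a # s) \<and> (a # s) ! (i + 1) = SouthEast)
    \<longleftrightarrow> (a = North \<longrightarrow> s \<noteq> [] \<and> hd s = SouthEast) \<and>
       (\<forall>i<length s. s ! i = North \<longrightarrow> i + 1 < length s \<and> s ! (i + 1) = SouthEast)"
    by (cases s) (simp_all add: All_less_Suc2)
  have 5: "(a # s = [] \<or> last (a # s) = SouthEast) \<longleftrightarrow>
     (s = [] \<longrightarrow> a = SouthEast) \<and> (s = [] \<or> last s = SouthEast)"
    by auto
  show ?thesis
    unfolding in_strip_def 1 2 3 4 5 by blast
qed

lemma in_strip_iff_admissible:
  "h < k \<Longrightarrow> in_strip k (x, int h) s \<longleftrightarrow> admissible k h s"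
proof (induction s arbitrary: x h)
  case Nil
  then show ?case by (auto simp: in_strip_Nil)
next
  case (Cons a s)
  show ?case
  proof (cases a)
    case NorthEast
    show ?thesis
    proof (cases "h + 1 < k")
      case True
      have "in_strip k (x + 1, int h + 1) s \<longleftrightarrow> admissible k (h + 1) s"
        using Cons.IH[OF True, of "x + 1"] by (simp add: add.commute)
      with Cons.prems True NorthEast show ?thesis
        by (auto simp: in_strip_Cons)
    next
      case False
      have "\<not> in_strip k (x + 1, int h + 1) s"
      proof
        assume "in_strip k (x + 1, int h + 1) s"
        then have "int h + 1 < int k"
          unfolding in_strip_def by (auto dest!: spec[of _ 0])
        with False show False by simp
      qed
      then show ?thesis using False NorthEast by (simp add: in_strip_Cons)
    qed
  next
    case SouthEast
    show ?thesis
    proof (cases "h \<ge> 1")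
      case True
      have "in_strip k (x + 1, int h - 1) s \<longleftrightarrow> admissible k (h - 1) s"
        using Cons.IH[of "h - 1" "x + 1"] True Cons.prems by (simp add: of_nat_diff)
      with Cons.prems True SouthEast show ?thesis
        by (auto simp: in_strip_Cons)
    next
      case False
      have "\<not> in_strip k (x + 1, int h - 1) s"
      proof
        assume "in_strip k (x + 1, int h - 1) s"
        then have "0 \<le> int h - 1"
          unfolding in_strip_def by (auto dest!: spec[of _ 0])
        with False show False by simp
      qed
      then show ?thesis using False SouthEast by (simp add: in_strip_Cons)
    qed
  next
    case North
    show ?thesis
    proof (cases "h + 1 < k")
      case True
      have "in_strip k (x, int h + 1) s \<longleftrightarrow> admissible k (h + 1) s"
        using Cons.IH[OF True, of x] by (simp add: add.commute)
      with Cons.prems True North show ?thesis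
        by (auto simp: in_strip_Cons)
    next
      case False
      have "\<not> in_strip k (x, int h + 1) s"
      proof
        assume "in_strip k (x, int h + 1) s"
        then have "int h + 1 < int k"
          unfolding in_strip_def by (auto dest!: spec[of _ 0])
        with False show False by simp
      qed
      then show ?thesis using False North by (simp add: in_strip_Cons)
    qed
  next
    case East
    show ?thesis
      using Cons.IH[OF Cons.prems, of "x + 1"] Cons.prems East by (auto simp: in_strip_Cons)
  qed
qed

definition peak_set :: "bool \<Rightarrow> lstep list \<Rightarrow> nat set" where
  "peak_set u s = {i. i < length s \<and> s ! i = SouthEast \<and>
     (if i = 0 then u else s ! (i - 1) = NorthEast \<or> s ! (i - 1) = North)}"

lemma peaks_eq_peak_set: "peaks P = peak_set False (snd P)"
  by (auto simp: peaks_def peak_set_def)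

lemma finite_peak_set [simp]: "finite (peak_set u s)"
  by (simp add: peak_set_def)

lemma peak_set_Nil [simp]: "peak_set u [] = {}"
  by (simp add: peak_set_def)

lemma peak_set_Cons:
  "peak_set u (a # s) = (if a = SouthEast \<and> u then {0} else {}) \<union>
     Suc ` peak_set (a = NorthEast \<or> a = North) s"
proof -
  have "i \<in> peak_set u (a # s) \<longleftrightarrow> i \<in> (if a = SouthEast \<and> u then {0} else {}) \<union>
     Suc ` peak_set (a = NorthEast \<or> a = North) s" for i
  proof (cases i)
    case (Suc j)
    then show ?thesis
      by (cases j) (auto simp: peak_set_def image_iff)
  qed (auto simp: peak_set_def)
  then show ?thesis by blast
qed

lemma sum_peak_set:
  "(\<Sum>i\<in>peak_set u s. fst (fold move (take i s) (x, y))) = major x u s"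
proof (induction s arbitrary: u x y)
  case (Cons a s)
  obtain y' where m: "move a (x, y) = (if a = North then x else x + 1, y')"
    by (cases a) auto
  have "(\<Sum>i\<in>peak_set u (a # s). fst (fold move (take i (a # s)) (x, y))) =
    (if a = SouthEast \<and> u then x else 0) +
    (\<Sum>i\<in>Suc ` peak_set (a = NorthEast \<or> a = North) s. fst (fold move (take i (a # s)) (x, y)))"
    unfolding peak_set_Cons by (subst sum.union_disjoint) auto
  also have "(\<Sum>i\<in>Suc ` peak_set (a = NorthEast \<or> a = North) s. fst (fold move (take i (a # s)) (x, y))) =
     major (if a = North then x else x + 1) (a = NorthEast \<or> a = North) s"
    by (subst sum.reindex) (simp_all add: m Cons.IH)
  finally show ?case by simp
qed simp

lemma major_index_eq: "major_index (h, s) = major 0 False s"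
  using sum_peak_set[where u = False and s = s and x = 0 and y = "int h"]
  by (simp add: major_index_def peaks_eq_peak_set weight_def vertex_def)

lemma nse_first_iff:
  "nse_first s \<longleftrightarrow> peak_set False s \<noteq> {} \<and> s ! (Min (peak_set False s) - 1) = North"
proof (induction s rule: nse_first.induct)
  case (1 a b s)
  show ?case
  proof (cases "b = SouthEast \<and> (a = NorthEast \<or> a = North)")
    case True
    then have "peak_set False (a # b # s) = insert 1 (Suc ` Suc ` peak_set False s)"
      by (auto simp: peak_set_Cons)
    moreover from this have "Min (peak_set False (a # b # s)) = 1"
      by (simp only:) (rule Min_eqI, auto)
    ultimately show ?thesis using True by simp
  next
    case False
    have eq: "peak_set False (a # b # s) = Suc ` peak_set False (b # s)"
      using False by (auto simp: peak_set_Cons)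
    have 0: "0 \<notin> peak_set False (b # s)" by (simp add: peak_set_def)
    show ?thesis
    proof (cases "peak_set False (b # s) = {}")
      case True
      then show ?thesis using False 1 eq by simp
    next
      case ne: False
      have "Min (peak_set False (a # b # s)) = Suc (Min (peak_set False (b # s)))"
        unfolding eq using ne by (simp add: mono_Min_commute[of Suc] mono_def)
      moreover have "Min (peak_set False (b # s)) \<noteq> 0"
        using 0 ne by (metis Min_in finite_peak_set)
      ultimately show ?thesis
        using False 1 eq ne by (auto simp: gr0_conv_Suc)
    qed
  qed
next
  case ("2_2" v)
  have "peak_set False [v] = {}" by (auto simp: peak_set_def)
  then show ?case by simp
qed simp

definition leading_rule :: "nat \<Rightarrow> lstep list \<Rightarrow> bool" where
  "leading_rule h s \<longleftrightarrow> (nse_first s \<longrightarrow> hd s = SouthEast \<or> (h = 0 \<and> hd s = East))"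

lemma path_iff:
  assumes "1 \<le> a" "a \<le> k"
  shows "lattice_path (h, s) \<and> special_cond k a (h, s) \<longleftrightarrow>
    h = k - a \<and> admissible k h s \<and> leading_rule h s"
proof (cases "h = k - a")
  case True
  with assms have "h < k" by simp
  have "lattice_path (h, s) \<and> special_cond k a (h, s) \<longleftrightarrow>
     in_strip k (0, int h) s \<and> leading_rule h s"
    using True assms
    unfolding lattice_path_def special_cond_def in_strip_def leading_rule_def nse_first_iff
      peaks_eq_peak_set Let_def height_def vertex_def
    by (auto simp: of_nat_diff)
  then show ?thesis
    using in_strip_iff_admissible[OF \<open>h < k\<close>] True by simp
next
  case False
  then show ?thesis
    using assms by (auto simp: special_cond_def height_def vertex_def)
qed

text \<open>A translation by d moves every peak by d. All exponents in the path recurrences come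
  from this: a horizontal unit in front of a path costs the number of its peaks.\<close>

lemma major_shift: "major (x + d) u s = major x u s + d * npeaks u s"
proof (induction s arbitrary: x u)
  case (Cons a s)
  show ?case
    using Cons.IH[of x] Cons.IH[of "Suc x"] by (simp add: algebra_simps)
qed simp

lemma major_Suc: "major (Suc x) u s = major x u s + npeaks u s"
  using major_shift[of x 1] by simp

text \<open>A path at positive height must descend eventually. Until then it can only ascend, since
  East steps occur at height 0, so its first South-East step completes a peak.\<close>

lemma npeaks_pos: "admissible k h s \<Longrightarrow> h > 0 \<Longrightarrow> npeaks True s > 0"
proof (induction s arbitrary: h)
  case (Cons a s)
  then show ?case by (cases a) auto
qed auto

text \<open>An ascent would force a peak by \<open>npeaks_pos\<close>. After an East step at height
  0 the remaining path is nonempty, but without peaks it could only be the empty descent.\<close>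

lemma npeaks_0_imp: "admissible k h s \<Longrightarrow> npeaks False s = 0 \<Longrightarrow> s = replicate h SouthEast"
proof (induction s arbitrary: h)
  case (Cons a s)
  show ?case
  proof (cases a)
    case NorthEast
    then show ?thesis using Cons.prems npeaks_pos[of k "h + 1" s] by auto
  next
    case North
    then show ?thesis using Cons.prems npeaks_pos[of k "h + 1" s] by auto
  next
    case SouthEast
    then show ?thesis using Cons by (cases h) auto
  next
    case East
    then show ?thesis using Cons by fastforce
  qed
qed auto

lemma replicate_SE:
  "admissible k h (replicate h SouthEast)" "npeaks False (replicate h SouthEast) = 0"
  "major x False (replicate h SouthEast) = 0"
proof -
  show "admissible k h (replicate h SouthEast)" "npeaks False (replicate h SouthEast) = 0"
    by (induction h) auto
  show "major x False (replicate h SouthEast) = 0"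
    by (induction h arbitrary: x) auto
qed

text \<open>\<open>paths_A\<close> ignores the rule on the leftmost peak; \<open>paths_Y\<close> and \<open>paths_X\<close> collect the
  members of \<open>paths_A\<close> and \<open>paths_E\<close>, respectively, that start with an ascent.\<close>

definition paths_A :: "nat \<Rightarrow> nat \<Rightarrow> nat \<Rightarrow> nat \<Rightarrow> lstep list set" where
  "paths_A k h N n = {s. admissible k h s \<and> npeaks False s = N \<and> major 0 False s = n}"

definition paths_Y :: "nat \<Rightarrow> nat \<Rightarrow> nat \<Rightarrow> nat \<Rightarrow> lstep list set" where
  "paths_Y k h N n = {s \<in> paths_A k h N n. s \<noteq> [] \<and> hd s \<in> {NorthEast, North}}"

definition paths_X :: "nat \<Rightarrow> nat \<Rightarrow> nat \<Rightarrow> nat \<Rightarrow> lstep list set" where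
  "paths_X k h N n = {s \<in> paths_A k h N n. s \<noteq> [] \<and> hd s = NorthEast \<and> \<not> nse_first s}"

definition paths_E :: "nat \<Rightarrow> nat \<Rightarrow> nat \<Rightarrow> nat \<Rightarrow> lstep list set" where
  "paths_E k h N n = {s \<in> paths_A k h N n. leading_rule h s}"

text \<open>Truncated subtraction treats both cases at once: an East step from height 0 stays at
  height 0, which is also h - 1.\<close>

definition level_steps :: "nat \<Rightarrow> nat \<Rightarrow> nat \<Rightarrow> nat \<Rightarrow> lstep list set" where
  "level_steps k h N n =
     (#) (if h = 0 then East else SouthEast) ` shift_set N (paths_A k (h - 1) N) n"

lemma paths_A_0: "paths_A k h 0 n = (if n = 0 then {replicate h SouthEast} else {})"
proof -
  have "s \<in> paths_A k h 0 n \<longleftrightarrow> n = 0 \<and> s = replicate h SouthEast" for s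
    unfolding paths_A_def mem_Collect_eq using npeaks_0_imp replicate_SE by metis
  then show ?thesis by auto
qed

section \<open>Decomposition of paths by their first steps\<close>

lemma Nil_notin_paths_A: "N \<ge> 1 \<Longrightarrow> [] \<notin> paths_A k h N n"
  by (simp add: paths_A_def)

lemma SE_in_paths_A:
  "SouthEast # s \<in> paths_A k h N n \<longleftrightarrow> h \<ge> 1 \<and> s \<in> shift_set N (paths_A k (h - 1) N) n"
  by (auto simp: paths_A_def shift_set_def major_Suc)

lemma East_in_paths_A:
  "N \<ge> 1 \<Longrightarrow> East # s \<in> paths_A k h N n \<longleftrightarrow> h = 0 \<and> s \<in> shift_set N (paths_A k 0 N) n"
  by (auto simp: paths_A_def shift_set_def major_Suc)

text \<open>The peak made by the first two steps has weight 0, and the other N - 1 peaks move by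
  one.\<close>

lemma North_in_paths_A:
  "N \<ge> 1 \<Longrightarrow> North # s \<in> paths_A k h N n \<longleftrightarrow>
     h + 1 < k \<and> (\<exists>t. s = SouthEast # t \<and> t \<in> shift_set (N - 1) (paths_A k h (N - 1)) n)"
  by (cases s) (auto simp: paths_A_def shift_set_def major_Suc)

text \<open>The peak has weight 1 and the other N - 1 peaks move by two: 1 + 2(N - 1) = 2N -
  1.\<close>

lemma NE_SE_in_paths_A:
  "N \<ge> 1 \<Longrightarrow> NorthEast # SouthEast # s \<in> paths_A k h N n \<longleftrightarrow>
     h + 1 < k \<and> s \<in> shift_set (2 * N - 1) (paths_A k h (N - 1)) n"
  by (auto simp: paths_A_def shift_set_def major_Suc)

text \<open>After the North-East step the height is positive, which forbids East; a next step other
  than South-East is therefore an ascent.\<close>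

lemma NE_not_SE_in_paths_A:
  "b \<noteq> SouthEast \<Longrightarrow> NorthEast # b # s \<in> paths_A k h N n \<longleftrightarrow>
     h + 1 < k \<and> b # s \<in> shift_set N (paths_Y k (h + 1) N) n"
  by (cases b) (auto simp: paths_A_def paths_Y_def shift_set_def major_Suc)

lemma NE_in_paths_A: "[NorthEast] \<notin> paths_A k h N n"
  by (simp add: paths_A_def)

lemma paths_A_eq:
  assumes "N \<ge> 1"
  shows "paths_A k h N n = level_steps k h N n \<union> paths_Y k h N n"
proof -
  have "s \<in> paths_A k h N n \<longleftrightarrow> s \<in> level_steps k h N n \<union> paths_Y k h N n" for s
  proof (cases s)
    case Nil
    then show ?thesis using assms Nil_notin_paths_A by (auto simp: paths_Y_def level_steps_def)
  next
    case (Cons a t)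
    then show ?thesis using assms
      by (cases a) (auto simp: paths_Y_def level_steps_def SE_in_paths_A East_in_paths_A)
  qed
  then show ?thesis by blast
qed

text \<open>A first step East or South-East satisfies the rule on the leftmost peak whatever
  follows. A first step North is itself the ascent of the leftmost peak and violates it, so only
  North-East starts with an NESE leftmost peak remain.\<close>

lemma paths_E_eq:
  assumes "N \<ge> 1"
  shows "paths_E k h N n = level_steps k h N n \<union> paths_X k h N n"
proof -
  have "s \<in> paths_E k h N n \<longleftrightarrow> s \<in> level_steps k h N n \<union> paths_X k h N n" for s
  proof (cases s)
    case Nil
    then show ?thesis using assms Nil_notin_paths_A by (auto simp: paths_E_def paths_X_def level_steps_def)
  next
    case (Cons a t)
    then show ?thesis using assms
      by (cases a) (auto simp: paths_E_def paths_X_def level_steps_def SE_in_paths_A East_in_paths_A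
          North_in_paths_A leading_rule_def)
  qed
  then show ?thesis by blast
qed

lemma paths_Y_eq:
  assumes "N \<ge> 1"
  shows "paths_Y k h N n = (if h + 1 < k then
     (\<lambda>s. North # SouthEast # s) ` shift_set (N - 1) (paths_A k h (N - 1)) n \<union>
     (\<lambda>s. NorthEast # SouthEast # s) ` shift_set (2 * N - 1) (paths_A k h (N - 1)) n \<union>
     (#) NorthEast ` shift_set N (paths_Y k (h + 1) N) n else {})" (is "_ = ?R")
proof -
  have U: "[] \<notin> shift_set N (paths_Y k (h + 1) N) n" "SouthEast # t \<notin> shift_set N (paths_Y k (h + 1) N) n" for t
    by (auto simp: shift_set_def paths_Y_def)
  have "s \<in> paths_Y k h N n \<longleftrightarrow> s \<in> ?R" for s
  proof -
    consider "s = [] \<or> hd s = SouthEast \<or> hd s = East" | t where "s = North # t"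
      | "s = [NorthEast]" | t where "s = NorthEast # SouthEast # t"
      | b t where "s = NorthEast # b # t" "b \<noteq> SouthEast"
      by (cases s; cases "hd s"; cases "tl s"; auto)
    then show ?thesis
    proof cases
      case 1
      then show ?thesis by (auto simp: paths_Y_def)
    next
      case 2
      then show ?thesis using assms by (auto simp: paths_Y_def North_in_paths_A)
    next
      case 3
      then show ?thesis using NE_in_paths_A U(1) by (auto simp: paths_Y_def)
    next
      case 4
      then show ?thesis using assms U(2) by (auto simp: paths_Y_def NE_SE_in_paths_A)
    next
      case 5
      then show ?thesis using assms by (auto simp: paths_Y_def NE_not_SE_in_paths_A)
    qed
  qed
  then show ?thesis by blast
qed

lemma paths_X_eq:
  assumes "N \<ge> 1"
  shows "paths_X k h N n = (if h + 1 < k then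
     (\<lambda>s. NorthEast # SouthEast # s) ` shift_set (2 * N - 1) (paths_A k h (N - 1)) n \<union>
     (#) NorthEast ` shift_set N (paths_X k (h + 1) N) n else {})" (is "_ = ?R")
proof -
  have U: "[] \<notin> shift_set N (paths_X k (h + 1) N) n" "SouthEast # t \<notin> shift_set N (paths_X k (h + 1) N) n" for t
    by (auto simp: shift_set_def paths_X_def)
  have V: "NorthEast # b # t \<in> paths_X k h N n \<longleftrightarrow> h + 1 < k \<and> b # t \<in> shift_set N (paths_X k (h + 1) N) n"
    if "b \<noteq> SouthEast" for b t
  \<comment> \<open>Here the leftmost peak is an NSE peak, which excludes the path from
    \<open>paths_X\<close>; the tail is excluded too, since it does not start with
    North-East.\<close>
  proof (cases "b = North \<and> t \<noteq> [] \<and> hd t = SouthEast")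
    case True
    then show ?thesis by (cases t) (auto simp: paths_X_def shift_set_def)
  next
    case False
    have "b # t \<in> shift_set N (paths_Y k (h + 1) N) n \<and> \<not> nse_first (b # t) \<longleftrightarrow>
        b # t \<in> shift_set N (paths_X k (h + 1) N) n"
      using that False by (cases b) (auto simp: shift_set_def paths_X_def paths_Y_def paths_A_def)
    then show ?thesis using that by (auto simp: paths_X_def NE_not_SE_in_paths_A)
  qed
  have "s \<in> paths_X k h N n \<longleftrightarrow> s \<in> ?R" for s
  proof -
    consider "s = [] \<or> hd s \<noteq> NorthEast"
      | "s = [NorthEast]" | t where "s = NorthEast # SouthEast # t"
      | b t where "s = NorthEast # b # t" "b \<noteq> SouthEast"
      by (cases s; cases "tl s"; auto)
    then show ?thesis
    proof cases
      case 1
      then show ?thesis by (auto simp: paths_X_def)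
    next
      case 2
      then show ?thesis using NE_in_paths_A U(1) by (auto simp: paths_X_def)
    next
      case 3
      then show ?thesis using assms U(2) by (auto simp: paths_X_def NE_SE_in_paths_A)
    next
      case 4
      then show ?thesis using assms V by auto
    qed
  qed
  then show ?thesis by blast
qed

text \<open>Pieces with fewer peaks are covered by the induction on N. Pieces with equally many
  peaks have smaller major index, because N >= 1 makes the shift by N positive.\<close>

lemma finite_paths_A: "finite (paths_A k h N n)"
proof (induction N arbitrary: h n)
  case (Suc N)
  have "finite (paths_A k h (Suc N) n) \<and> finite (paths_Y k h (Suc N) n)" for h
  proof (induction n arbitrary: h rule: less_induct)
    case (less n)
    have Y: "finite (paths_Y k h (Suc N) n)"
      using Suc less by (subst paths_Y_eq) (auto simp: shift_set_def)
    then show ?case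
      using less by (subst paths_A_eq) (auto simp: level_steps_def shift_set_def)
  qed
  then show ?case by blast
qed (simp add: paths_A_0)

section \<open>Path counts and their recurrences\<close>

definition num_A :: "nat \<Rightarrow> nat \<Rightarrow> nat \<Rightarrow> nat \<Rightarrow> nat" where
  "num_A k h N n = card (paths_A k h N n)"

definition num_Y :: "nat \<Rightarrow> nat \<Rightarrow> nat \<Rightarrow> nat \<Rightarrow> nat" where
  "num_Y k h N n = card (paths_Y k h N n)"

definition num_X :: "nat \<Rightarrow> nat \<Rightarrow> nat \<Rightarrow> nat \<Rightarrow> nat" where
  "num_X k h N n = card (paths_X k h N n)"

definition num_E :: "nat \<Rightarrow> nat \<Rightarrow> nat \<Rightarrow> nat \<Rightarrow> nat" where
  "num_E k h N n = card (paths_E k h N n)"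

lemma finite_paths [simp]:
  "finite (paths_A k h N n)" "finite (paths_Y k h N n)" "finite (paths_X k h N n)" "finite (paths_E k h N n)"
  "finite (shift_set d (paths_A k h N) n)" "finite (shift_set d (paths_Y k h N) n)"
  "finite (shift_set d (paths_X k h N) n)"
  using finite_paths_A by (auto simp: paths_Y_def paths_X_def paths_E_def shift_set_def)

lemma card_level_steps: "card (level_steps k h N n) = shift N (num_A k (h - 1) N) n"
  unfolding level_steps_def num_A_def by (rule card_image_shift_set) simp

lemma num_A_0: "num_A k h 0 n = (if n = 0 then 1 else 0)"
  by (simp add: num_A_def paths_A_0)

lemma num_E_0: "num_E k h 0 n = (if n = 0 then 1 else 0)"
proof -
  have "paths_E k h 0 n = paths_A k h 0 n"
  proof (cases h)
    case 0
    then show ?thesis by (auto simp: paths_E_def paths_A_0 leading_rule_def)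
  next
    case (Suc h')
    then show ?thesis by (auto simp: paths_E_def paths_A_0 leading_rule_def)
  qed
  then show ?thesis using num_A_0[of k h n] by (simp add: num_E_def num_A_def)
qed

lemma num_A_rec:
  assumes "N \<ge> 1"
  shows "num_A k h N n = shift N (num_A k (h - 1) N) n + num_Y k h N n"
  unfolding num_A_def[of k h N n] paths_A_eq[OF assms] num_Y_def
  by (subst card_Un_disjoint)
     (auto simp: card_level_steps, auto simp: level_steps_def paths_Y_def split: if_splits)

lemma num_E_rec:
  assumes "N \<ge> 1"
  shows "num_E k h N n = shift N (num_A k (h - 1) N) n + num_X k h N n"
  unfolding num_E_def[of k h N n] paths_E_eq[OF assms] num_X_def
  by (subst card_Un_disjoint)
     (auto simp: card_level_steps, auto simp: level_steps_def paths_X_def split: if_splits)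

lemma num_Y_rec:
  assumes "N \<ge> 1"
  shows "num_Y k h N n = (if h + 1 < k then shift (N - 1) (num_A k h (N - 1)) n +
     shift (2 * N - 1) (num_A k h (N - 1)) n + shift N (num_Y k (h + 1) N) n else 0)"
proof (cases "h + 1 < k")
  case True
  let ?f = "\<lambda>s. North # SouthEast # s" and ?g = "\<lambda>s. NorthEast # SouthEast # s"
  let ?S = "shift_set (N - 1) (paths_A k h (N - 1)) n" and ?T = "shift_set (2 * N - 1) (paths_A k h (N - 1)) n"
  let ?U = "shift_set N (paths_Y k (h + 1) N) n"
  have "num_Y k h N n = card (?f ` ?S \<union> ?g ` ?T \<union> (#) NorthEast ` ?U)"
    using True unfolding num_Y_def by (subst paths_Y_eq[OF assms]) simp
  also have "\<dots> = card (?f ` ?S) + card (?g ` ?T) + card ((#) NorthEast ` ?U)"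
    by (subst card_Un_disjoint, simp, simp, (auto simp: shift_set_def paths_Y_def)[1],
        subst card_Un_disjoint) auto
  also have "\<dots> = shift (N - 1) (num_A k h (N - 1)) n + shift (2 * N - 1) (num_A k h (N - 1)) n
      + shift N (num_Y k (h + 1) N) n"
    by (subst (1 2 3) card_image_shift_set) (auto simp: inj_def num_A_def[abs_def] num_Y_def[abs_def])
  finally show ?thesis using True by simp
qed (use assms in \<open>simp add: num_Y_def paths_Y_eq\<close>)

lemma num_X_rec:
  assumes "N \<ge> 1"
  shows "num_X k h N n = (if h + 1 < k then
     shift (2 * N - 1) (num_A k h (N - 1)) n + shift N (num_X k (h + 1) N) n else 0)"
proof (cases "h + 1 < k")
  case True
  let ?g = "\<lambda>s. NorthEast # SouthEast # s"
  let ?T = "shift_set (2 * N - 1) (paths_A k h (N - 1)) n"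
  let ?U = "shift_set N (paths_X k (h + 1) N) n"
  have "num_X k h N n = card (?g ` ?T \<union> (#) NorthEast ` ?U)"
    using True unfolding num_X_def by (subst paths_X_eq[OF assms]) simp
  also have "\<dots> = card (?g ` ?T) + card ((#) NorthEast ` ?U)"
    by (subst card_Un_disjoint) (auto simp: shift_set_def paths_X_def)
  also have "\<dots> = shift (2 * N - 1) (num_A k h (N - 1)) n + shift N (num_X k (h + 1) N) n"
    by (subst (1 2) card_image_shift_set) (auto simp: inj_def num_A_def[abs_def] num_X_def[abs_def])
  finally show ?thesis using True by simp
qed (use assms in \<open>simp add: num_X_def paths_X_eq\<close>)

text \<open>A peak of weight 0 could only come from a first step North, which the rule on the
  leftmost peak forbids; thus every peak adds at least 1. This makes the sum over N finite for each
  n.\<close>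

lemma paths_E_peaks_le:
  assumes "s \<in> paths_E k h N n"
  shows "N \<le> n"
proof (cases "N \<ge> 1")
  case True
  have "N \<le> n" if "s \<in> paths_X k h N n"
    using that paths_X_eq[OF True, of k h n] True by (auto simp: shift_set_def split: if_splits)
  moreover have "N \<le> n" if "s \<in> level_steps k h N n"
    using that by (auto simp: level_steps_def shift_set_def split: if_splits)
  ultimately show ?thesis using assms paths_E_eq[OF True] by blast
qed simp

lemma num_E_eq_0: "n < N \<Longrightarrow> num_E k h N n = 0"
  using paths_E_peaks_le[of _ k h N n] by (force simp: num_E_def)

theorem E_bar_eq_sum:
  assumes "1 \<le> a" "a \<le> k"
  shows "E_bar k a n = (\<Sum>N\<le>n. num_E k (k - a) N n)"
proof -
  have "{P. lattice_path P \<and> major_index P = n \<and> special_cond k a P} =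
    Pair (k - a) ` (\<Union>N\<le>n. paths_E k (k - a) N n)" (is "?L = ?R")
  proof -
    have "(h, s) \<in> ?L \<longleftrightarrow> h = k - a \<and> (\<exists>N. s \<in> paths_E k (k - a) N n)" for h s
      using path_iff[OF assms, of h s] by (auto simp: paths_E_def paths_A_def major_index_eq)
    moreover have "(\<exists>N. s \<in> paths_E k (k - a) N n) \<longleftrightarrow> s \<in> (\<Union>N\<le>n. paths_E k (k - a) N n)" for s
      using paths_E_peaks_le by blast
    ultimately have "P \<in> ?L \<longleftrightarrow> P \<in> ?R" for P
      by (cases P) (simp only: image_iff prod.inject, blast)
    then show ?thesis by blast
  qed
  then have "E_bar k a n = card (\<Union>N\<le>n. paths_E k (k - a) N n)"
    by (simp add: E_bar_def card_image inj_on_def)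
  also have "\<dots> = (\<Sum>N\<le>n. num_E k (k - a) N n)"
    unfolding num_E_def by (rule card_UN_disjoint) (simp, simp, auto simp: paths_E_def paths_A_def)
  finally show ?thesis .
qed

subsection \<open>Overpartitions by multiplicities\<close>

text \<open>Sorting by this key in descending order lists the parts of an overpartition in their only
  admissible order.\<close>

definition part_key :: "nat \<times> bool \<Rightarrow> nat" where
  "part_key p = 2 * fst p + (if snd p then 1 else 0)"

lemma inj_part_key: "inj part_key"
proof (rule injI)
  fix p r assume "part_key p = part_key r"
  then show "p = r"
    unfolding part_key_def prod_eq_iff by (cases "snd p"; cases "snd r"; simp; presburger)
qed

lemma part_key_fst_mono: "part_key r \<le> part_key p \<Longrightarrow> fst r \<le> fst p"
  by (auto simp: part_key_def split: if_splits)

section \<open>Overpartitions as multisets\<close>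

definition overmset :: "(nat \<times> bool) multiset \<Rightarrow> bool" where
  "overmset M \<longleftrightarrow> (\<forall>p\<in>#M. 0 < fst p) \<and> (\<forall>l. count M (l, True) \<le> 1)"

definition parts_ge :: "nat \<Rightarrow> (nat \<times> bool) list \<Rightarrow> nat" where
  "parts_ge t ps = length (filter (\<lambda>p. t \<le> part_key p) ps)"

lemma overpartition_iff:
  "overpartition ps \<longleftrightarrow> overmset (mset ps) \<and> sorted_wrt (\<ge>) (map part_key ps)"
proof (intro iffI conjI)
  assume op: "overpartition ps"
  have ord: "part_key (ps ! j) \<le> part_key (ps ! i) \<and> (snd (ps ! j) \<longrightarrow> ps ! i \<noteq> ps ! j)"
    if "i < j" "j < length ps" for i j
  proof -
    have "fst (ps ! j) \<le> fst (ps ! i)"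
      using op that unfolding overpartition_def sorted_wrt_iff_nth_less by auto
    moreover have "snd (ps ! j) \<Longrightarrow> fst (ps ! i) \<noteq> fst (ps ! j)"
      using op that unfolding overpartition_def by auto
    ultimately show ?thesis by (auto simp: part_key_def)
  qed
  show "sorted_wrt (\<ge>) (map part_key ps)"
    using ord by (auto simp: sorted_wrt_iff_nth_less)
  have "count (mset ps) (l, True) \<le> 1" for l
  proof -
    have "i = j" if "i < length ps" "ps ! i = (l, True)" "j < length ps" "ps ! j = (l, True)" for i j
      using ord[of i j] ord[of j i] that by (cases i j rule: linorder_cases) auto
    then have "card {i. i < length ps \<and> (l, True) = ps ! i} \<le> 1"
      by (auto simp: card_le_Suc0_iff_eq)
    then show ?thesis
      unfolding count_mset count_list_eq_length_filter length_filter_conv_card .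
  qed
  then show "overmset (mset ps)"
    using op by (auto simp: overmset_def overpartition_def)
next
  assume A: "overmset (mset ps) \<and> sorted_wrt (\<ge>) (map part_key ps)"
  then have ord: "part_key (ps ! j) \<le> part_key (ps ! i)" if "i < j" "j < length ps" for i j
    using that by (auto simp: sorted_wrt_iff_nth_less)
  have "fst (ps ! i) \<noteq> fst (ps ! j)" if j: "j < length ps" "snd (ps ! j)" "i < j" for i j
  proof
    assume eq: "fst (ps ! i) = fst (ps ! j)"
    with ord[OF j(3,1)] j(2) have "snd (ps ! i)"
      by (auto simp: part_key_def split: if_splits)
    with eq j have e: "ps ! i = (fst (ps ! j), True)" "ps ! j = (fst (ps ! j), True)"
      by (auto simp: prod_eq_iff)
    have "card {i, j} \<le> card {i. i < length ps \<and> (fst (ps ! j), True) = ps ! i}"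
      using e j by (intro card_mono) auto
    then have "2 \<le> count (mset ps) (fst (ps ! j), True)"
      using j unfolding count_mset count_list_eq_length_filter length_filter_conv_card by simp
    with A show False unfolding overmset_def by (metis Suc_1 not_less_eq_eq)
  qed
  moreover have "sorted_wrt (\<ge>) (map fst ps)"
    using ord part_key_fst_mono by (auto simp: sorted_wrt_iff_nth_less)
  ultimately show "overpartition ps"
    using A by (auto simp: overpartition_def overmset_def)
qed

lemma inj_on_mset_overpartition: "inj_on mset {ps. overpartition ps}"
proof (rule inj_onI)
  fix ps qs assume A: "ps \<in> {ps. overpartition ps}" "qs \<in> {ps. overpartition ps}" "mset ps = mset qs"
  then have "sorted (rev (map part_key ps))" "sorted (rev (map part_key qs))"
    by (auto simp: overpartition_iff sorted_wrt_rev)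
  moreover have "mset (rev (map part_key ps)) = mset (rev (map part_key qs))"
    using A(3) by simp
  ultimately have "rev (map part_key ps) = rev (map part_key qs)"
    by (metis properties_for_sort)
  then show "ps = qs"
    using inj_part_key by (simp add: inj_map_eq_map)
qed

lemma overmset_imp_overpartition:
  assumes "overmset M"
  obtains ps where "overpartition ps" "mset ps = M"
proof -
  obtain xs where xs: "mset xs = M" by (metis ex_mset)
  let ?ps = "rev (sort_key part_key xs)"
  have "sorted_wrt (\<ge>) (map part_key ?ps)"
    using sorted_sort_key[of part_key xs] by (simp add: sorted_wrt_rev flip: rev_map)
  then have "overpartition ?ps"
    using assms xs by (simp add: overpartition_iff)
  then show ?thesis using that xs by simp
qed

lemma part_key_nth_ge:
  assumes "sorted_wrt (\<ge>) (map part_key ps)" "i < length ps"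
  shows "t \<le> part_key (ps ! i) \<longleftrightarrow> i < parts_ge t ps"
  using assms
proof (induction ps arbitrary: i)
  case (Cons p ps)
  show ?case
  proof (cases "t \<le> part_key p")
    case True
    then show ?thesis using Cons by (cases i) (auto simp: parts_ge_def)
  next
    case False
    then have "\<forall>r\<in>set (p # ps). \<not> t \<le> part_key r" using Cons.prems by auto
    then have "parts_ge t (p # ps) = 0" by (simp add: parts_ge_def filter_empty_conv)
    moreover have "\<not> t \<le> part_key ((p # ps) ! i)"
      using \<open>\<forall>r\<in>set (p # ps). \<not> t \<le> part_key r\<close> nth_mem[OF Cons.prems(2)] by blast
    ultimately show ?thesis by simp
  qed
qed simp

lemma parts_ge_antimono: "t \<le> t' \<Longrightarrow> parts_ge t' ps \<le> parts_ge t ps"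
  by (induction ps) (auto simp: parts_ge_def)

lemma parts_ge_Suc: "parts_ge (part_key p) ps = parts_ge (Suc (part_key p)) ps + count (mset ps) p"
proof (induction ps)
  case (Cons r ps)
  have "part_key p \<le> part_key r \<longleftrightarrow> Suc (part_key p) \<le> part_key r \<or> r = p"
    using inj_eq[OF inj_part_key, of p r] by auto
  with Cons show ?case by (auto simp: parts_ge_def)
qed (simp add: parts_ge_def)

lemma parts_ge_False: "parts_ge (2 * s) ps = parts_ge (2 * s + 1) ps + count (mset ps) (s, False)"
  using parts_ge_Suc[of "(s, False)" ps] by (simp add: part_key_def)

lemma parts_ge_True: "parts_ge (2 * s + 1) ps = parts_ge (2 * s + 2) ps + count (mset ps) (s, True)"
  using parts_ge_Suc[of "(s, True)" ps] by (simp add: part_key_def)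

text \<open>The difference condition only bites at the first non-overlined and at the overlined copy of
  each size.\<close>

lemma difference_iff_multiplicity:
  assumes op: "overpartition ps" and k: "1 \<le> k"
  shows "(\<forall>j. j + k - 1 < length ps \<longrightarrow>
        int (fst (ps ! j)) - int (fst (ps ! (j + k - 1))) \<ge> (if snd (ps ! j) then 1 else 2)) \<longleftrightarrow>
     (\<forall>l>0. count (mset ps) (l + 1, False) + count (mset ps) (l, False) + count (mset ps) (l, True) < k)"
    (is "?D \<longleftrightarrow> ?F")
proof -
  \<comment> \<open>G t counts the parts with key at least t. In descending order they fill exactly
    the positions below G t, so statements about parts become inequalities between
    positions.\<close>
  define G where "G = (\<lambda>t. parts_ge t ps)"
  have srt: "sorted_wrt (\<ge>) (map part_key ps)" and pos: "\<forall>p\<in>set ps. 0 < fst p"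
    using op by (auto simp: overpartition_iff overmset_def)
  have nth: "t \<le> part_key (ps ! i) \<longleftrightarrow> i < G t" if "i < length ps" for i t
    unfolding G_def using part_key_nth_ge[OF srt that] .
  have len: "i < G t \<Longrightarrow> i < length ps" for i t
    unfolding G_def parts_ge_def using length_filter_le order.strict_trans2 by blast
  have cF: "G (2 * s) = G (2 * s + 1) + count (mset ps) (s, False)" for s
    unfolding G_def by (rule parts_ge_False)
  have cT: "G (2 * s + 1) = G (2 * s + 2) + count (mset ps) (s, True)" for s
    unfolding G_def by (rule parts_ge_True)
  have fst_ge: "v \<le> fst (ps ! i) \<longleftrightarrow> i < G (2 * v)" if "i < length ps" for i v
    using nth[OF that, of "2 * v"] by (auto simp: part_key_def split: if_splits)
  \<comment> \<open>The keys 2l, 2l + 1, 2l + 2 belong to plain l, overlined l and plain l + 1, so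
    the three multiplicities add up to G (2l) - G (2l + 3).\<close>
  have F: "?F \<longleftrightarrow> (\<forall>l>0. G (2 * l) < G (2 * l + 3) + k)"
  proof -
    have "G (2 * l) = G (2 * l + 3) + (count (mset ps) (l + 1, False) + count (mset ps) (l, False) + count (mset ps) (l, True))" for l
      using cF[of l] cT[of l] cF[of "l + 1"] by (simp add: numeral_3_eq_3)
    then show ?thesis by simp
  qed
  have iF: "ps ! j = (s, False)" if "G (2 * s + 1) \<le> j" "j < G (2 * s)" for j s
  proof -
    have "j < length ps" using len that by blast
    with nth[of j "2 * s + 1"] nth[of j "2 * s"] that have "part_key (ps ! j) = 2 * s" by simp
    then have "part_key (ps ! j) = part_key (s, False)" by (simp add: part_key_def)
    then show ?thesis using inj_part_key by (simp add: inj_eq)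
  qed
  have iT: "ps ! j = (s, True)" if "G (2 * s + 2) \<le> j" "j < G (2 * s + 1)" for j s
  proof -
    have "j < length ps" using len that by blast
    with nth[of j "2 * s + 2"] nth[of j "2 * s + 1"] that have "part_key (ps ! j) = 2 * s + 1" by simp
    then have "part_key (ps ! j) = part_key (s, True)" by (simp add: part_key_def)
    then show ?thesis using inj_part_key by (simp add: inj_eq)
  qed
  have pos': "s > 0" if "j < length ps" "ps ! j = (s, b)" for j s b
    using pos that nth_mem by fastforce
  show ?thesis unfolding F
  proof
    assume D: ?D
    have DF: "G (2 * (s - 1)) < G (2 * s + 1) + k" if s: "G (2 * s + 1) < G (2 * s)" for s
    proof (rule ccontr)
      let ?j = "G (2 * s + 1)"
      assume "\<not> ?thesis"
      then have j: "?j + k - 1 < G (2 * (s - 1))" using k by simp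
      from j have l: "?j + k - 1 < length ps" by (rule len)
      have p: "ps ! ?j = (s, False)" using s by (intro iF) auto
      have "s > 0" using pos'[OF _ p] len s by blast
      have "s - 1 \<le> fst (ps ! (?j + k - 1))" using fst_ge[OF l] j by simp
      with D[rule_format, OF l] p \<open>s > 0\<close> show False by (simp add: of_nat_diff)
    qed
    have DT: "G (2 * s) < G (2 * s + 2) + k" if s: "G (2 * s + 2) < G (2 * s + 1)" for s
    proof (rule ccontr)
      let ?j = "G (2 * s + 2)"
      assume "\<not> ?thesis"
      then have j: "?j + k - 1 < G (2 * s)" using k by simp
      from j have l: "?j + k - 1 < length ps" by (rule len)
      have p: "ps ! ?j = (s, True)" using s by (intro iT) auto
      have "s \<le> fst (ps ! (?j + k - 1))" using fst_ge[OF l] j by simp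
      with D[rule_format, OF l] p show False by simp
    qed
    show "\<forall>l>0. G (2 * l) < G (2 * l + 3) + k"
    proof (intro allI impI)
      fix l :: nat assume "l > 0"
      have a: "G (2 * l + 3) \<le> G (2 * l + 2)" "G (2 * l + 2) \<le> G (2 * l + 1)"
        "G (2 * l + 1) \<le> G (2 * l)" "G (2 * l) \<le> G (2 * (l - 1))"
        unfolding G_def by (intro parts_ge_antimono; simp)+
      \<comment> \<open>The largest key present among 2l + 2, 2l + 1, 2l decides which bound
        applies: \<open>DF\<close> at l + 1, \<open>DT\<close> at l, or \<open>DF\<close> at l. If
        none is present, the two counts agree and k >= 1 suffices.\<close>
      show "G (2 * l) < G (2 * l + 3) + k"
        using DF[of "l + 1"] DT[of l] DF[of l] a k by (simp add: numeral_3_eq_3) linarith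
    qed
  next
    assume H: "\<forall>l>0. G (2 * l) < G (2 * l + 3) + k"
    show ?D
    proof (intro allI impI)
      fix j assume l: "j + k - 1 < length ps"
      then have j: "j < length ps" using k by simp
      obtain s b where p: "ps ! j = (s, b)" by fastforce
      then have "s > 0" using pos' j by blast
      have key: "2 * s + (if b then 1 else 0) = part_key (ps ! j)" by (simp add: p part_key_def)
      show "int (fst (ps ! j)) - int (fst (ps ! (j + k - 1))) \<ge> (if snd (ps ! j) then 1 else 2)"
      proof (cases b)
        case True
        have "G (2 * s + 2) \<le> j" using nth[OF j, of "2 * s + 2"] key True by simp
        moreover have "G (2 * s + 3) \<le> G (2 * s + 2)" unfolding G_def by (rule parts_ge_antimono) simp
        ultimately have "\<not> j + k - 1 < G (2 * s)"
          using H \<open>s > 0\<close> k by (auto dest!: spec[of _ s])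
        then have "fst (ps ! (j + k - 1)) < s" using fst_ge[OF l, of s] by simp
        then show ?thesis using True p by simp
      next
        case False
        have j': "G (2 * s + 1) \<le> j" using nth[OF j, of "2 * s + 1"] key False by simp
        have "\<not> j + k - 1 < G (2 * (s - 1))"
        proof (cases "s = 1")
          case True
          have "G (2 * (s - 1)) = length ps"
            by (simp add: True G_def parts_ge_def)
          moreover have "length ps = G 2"
          proof -
            have "2 \<le> part_key p" if "p \<in> set ps" for p
              using pos that by (force simp: part_key_def)
            then show ?thesis by (simp add: G_def parts_ge_def)
          qed
          moreover have "G 5 \<le> G 3" unfolding G_def by (rule parts_ge_antimono) simp
          ultimately show ?thesis using H[rule_format, of 1] j' True k by (simp add: numeral_eq_Suc)
        next
          case False
          then have "s - 1 > 0" "2 * (s - 1) + 3 = 2 * s + 1" using \<open>s > 0\<close> by auto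
          then have "G (2 * (s - 1)) < G (2 * s + 1) + k" using H by metis
          then show ?thesis using j' k by simp
        qed
        then have "fst (ps ! (j + k - 1)) < s - 1" using fst_ge[OF l, of "s - 1"] by simp
        then show ?thesis using False p by simp
      qed
    qed
  qed
qed

text \<open>Both parameters are forced by removing the copies of the smallest possible part m + 1:
  what remains has parts above m + 1 and a new bound i on the plain copies of m + 2. The original
  problem is m = 0, i = a.\<close>

definition omsets :: "nat \<Rightarrow> nat \<Rightarrow> nat \<Rightarrow> nat \<Rightarrow> (nat \<times> bool) multiset set" where
  "omsets k i m n = {M. (\<forall>p\<in>#M. m < fst p) \<and> (\<forall>l. count M (l, True) \<le> 1) \<and>
     (\<Sum>p\<in>#M. fst p) = n \<and>
     (\<forall>l>m. count M (l + 1, False) + count M (l, False) + count M (l, True) < k) \<and>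
     count M (m + 1, False) < i}"

definition num_B :: "nat \<Rightarrow> nat \<Rightarrow> nat \<Rightarrow> nat \<Rightarrow> nat" where
  "num_B k i m n = card (omsets k i m n)"

theorem B_bar_eq_num_B:
  assumes "1 \<le> a" "a \<le> k"
  shows "B_bar k a n = num_B k a 0 n"
proof -
  let ?S = "{ps. overpartition ps \<and> sum_list (map fst ps) = n \<and> B_cond k a ps}"
  have iff: "ps \<in> ?S \<longleftrightarrow> overpartition ps \<and> mset ps \<in> omsets k a 0 n" for ps
  proof (cases "overpartition ps")
    case True
    have "(\<Sum>p\<in>#mset ps. fst p) = sum_list (map fst ps)"
      by (simp add: sum_mset_sum_list flip: mset_map)
    moreover have "count_list ps (1, False) \<le> a - 1 \<longleftrightarrow> count (mset ps) (1, False) < a"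
      using assms by (auto simp: count_mset)
    ultimately show ?thesis
      using True difference_iff_multiplicity[OF True, of k] assms
      unfolding B_cond_def omsets_def by (auto simp: overpartition_iff overmset_def)
  qed simp
  have "mset ` ?S = omsets k a 0 n"
  proof (intro subset_antisym subsetI)
    fix M assume "M \<in> mset ` ?S"
    then show "M \<in> omsets k a 0 n" using iff by blast
  next
    fix M assume M: "M \<in> omsets k a 0 n"
    then have "overmset M" by (simp add: omsets_def overmset_def)
    then obtain ps where "overpartition ps" "mset ps = M" by (rule overmset_imp_overpartition)
    with M iff show "M \<in> mset ` ?S" by blast
  qed
  moreover have "inj_on mset ?S"
    using inj_on_mset_overpartition by (rule inj_on_subset) auto
  ultimately show ?thesis
    using card_image[of mset ?S] by (simp add: B_bar_def num_B_def)
qed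

lemma omsets_top:
  assumes "n \<le> m" "0 < i" "0 < k"
  shows "omsets k i m n = (if n = 0 then {{#}} else {})"
proof -
  have "M = {#} \<and> n = 0" if "M \<in> omsets k i m n" for M
  proof -
    have "M = {#}"
    proof (rule ccontr)
      assume "M \<noteq> {#}"
      then obtain p where p: "p \<in># M" by auto
      then have "fst p \<le> (\<Sum>p\<in>#M. fst p)" by (metis le_add1 multi_member_split image_mset_add_mset sum_mset.add_mset)
      with p that assms show False by (auto simp: omsets_def)
    qed
    with that show ?thesis by (auto simp: omsets_def)
  qed
  moreover have "{#} \<in> omsets k i m 0" using assms by (simp add: omsets_def)
  ultimately show ?thesis by auto
qed

lemma omsets_0: "omsets k 0 m n = {}"
  by (simp add: omsets_def)

text \<open>With i plain and g overlined copies of m + 1 present, the frequency condition at l = m +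
  1 allows fewer than k - (i + g) = c plain copies of m + 2, which is the bound in the family of
  R.\<close>

lemma omsets_add:
  assumes R: "R \<in> omsets k c (m + 1) n'" and g: "g \<le> 1" and c: "c + (i + g) = k"
  shows "R + replicate_mset i (m + 1, False) + replicate_mset g (m + 1, True)
     \<in> {M \<in> omsets k (i + 1) m (n' + (m + 1) * (i + g)). count M (m + 1, False) = i \<and> count M (m + 1, True) = g}"
proof -
  let ?M = "R + replicate_mset i (m + 1, False) + replicate_mset g (m + 1, True)"
  have z: "count R (l, b) = 0" if "l \<le> m + 1" for l b
    using R that by (force simp: omsets_def not_in_iff)
  have "\<forall>p\<in>#?M. m < fst p"
    using R by (auto simp: omsets_def)
  moreover have "count ?M (l, True) \<le> 1" for l
    using R g z[of l True] by (cases "l = m + 1") (auto simp: omsets_def)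
  moreover have "(\<Sum>p\<in>#?M. fst p) = n' + (m + 1) * (i + g)"
    using R by (simp add: omsets_def algebra_simps)
  moreover have "count ?M (l + 1, False) + count ?M (l, False) + count ?M (l, True) < k" if "l > m" for l
  proof (cases "l = m + 1")
    case True
    then show ?thesis using R z[of "m + 1"] c by (auto simp: omsets_def)
  next
    case False
    with that have "l > m + 1" by simp
    then show ?thesis using R by (auto simp: omsets_def)
  qed
  moreover have "count ?M (m + 1, False) = i" "count ?M (m + 1, True) = g"
    using z[of "m + 1"] by auto
  ultimately show ?thesis by (simp add: omsets_def)
qed

lemma omsets_remove:
  assumes M: "M \<in> omsets k (i + 1) m n" and g: "count M (m + 1, True) = g" "count M (m + 1, False) = i"
    and c: "c + (i + g) = k"
  shows "\<exists>R. M = R + replicate_mset i (m + 1, False) + replicate_mset g (m + 1, True) \<and>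
     R \<in> shift_set ((m + 1) * (i + g)) (omsets k c (m + 1)) n"
proof -
  define R where "R = filter_mset (\<lambda>p. m + 1 < fst p) M"
  have cR: "count R (l, b) = (if m + 1 < l then count M (l, b) else 0)" for l b
    by (simp add: R_def)
  have z: "count M (l, b) = 0" if "l \<le> m" for l b
    using M that by (force simp: omsets_def not_in_iff)
  have MR: "M = R + replicate_mset i (m + 1, False) + replicate_mset g (m + 1, True)"
  proof (rule multiset_eqI)
    fix p :: "nat \<times> bool"
    obtain l b where p: "p = (l, b)" by fastforce
    consider "l \<le> m" | "l = m + 1" | "m + 1 < l" by linarith
    then show "count M p = count (R + replicate_mset i (m + 1, False) + replicate_mset g (m + 1, True)) p"
      by cases (cases b; use g in \<open>auto simp: p cR z\<close>)+
  qed
  have sum: "n = (\<Sum>p\<in>#R. fst p) + (m + 1) * (i + g)"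
  proof -
    have "n = (\<Sum>p\<in>#M. fst p)" using M by (simp add: omsets_def)
    also have "\<dots> = (\<Sum>p\<in>#R. fst p) + (m + 1) * (i + g)"
      by (subst MR) (simp add: algebra_simps)
    finally show ?thesis .
  qed
  have "R \<in> omsets k c (m + 1) (n - (m + 1) * (i + g))"
  proof -
    have "\<forall>p\<in>#R. m + 1 < fst p" by (simp add: R_def)
    moreover have "count R (l, True) \<le> 1" for l using M by (simp add: cR omsets_def)
    moreover have "count R (l + 1, False) + count R (l, False) + count R (l, True) < k" if "l > m + 1" for l
      using M that by (simp add: cR omsets_def)
    moreover have "count R (m + 1 + 1, False) < c"
    proof -
      have "count M (m + 1 + 1, False) + count M (m + 1, False) + count M (m + 1, True) < k"
        using M by (simp add: omsets_def)
      then show ?thesis using g c by (simp add: cR)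
    qed
    ultimately show ?thesis using sum by (simp add: omsets_def)
  qed
  then show ?thesis using MR sum by (auto simp: shift_set_def)
qed

lemma omsets_Suc:
  assumes "i < k"
  shows "omsets k (i + 1) m n = omsets k i m n \<union>
     (\<lambda>R. R + replicate_mset i (m + 1, False) + replicate_mset 0 (m + 1, True)) `
        shift_set ((m + 1) * (i + 0)) (omsets k (k - i) (m + 1)) n \<union>
     (\<lambda>R. R + replicate_mset i (m + 1, False) + replicate_mset 1 (m + 1, True)) `
        shift_set ((m + 1) * (i + 1)) (omsets k (k - i - 1) (m + 1)) n" (is "?L = ?A \<union> ?B \<union> ?C")
proof (intro subset_antisym subsetI)
  fix M assume M: "M \<in> ?L"
  show "M \<in> ?A \<union> ?B \<union> ?C"
  proof (cases "count M (m + 1, False) = i")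
    case False
    then show ?thesis using M by (auto simp: omsets_def)
  next
    case True
    have "count M (m + 1, True) \<le> 1" using M by (simp add: omsets_def)
    then consider "count M (m + 1, True) = 0" | "count M (m + 1, True) = 1" by linarith
    then show ?thesis
    proof cases
      case 1
      show ?thesis using omsets_remove[OF M 1 True, of "k - i"] assms by auto
    next
      case 2
      show ?thesis using omsets_remove[OF M 2 True, of "k - i - 1"] assms by auto
    qed
  qed
next
  fix M assume "M \<in> ?A \<union> ?B \<union> ?C"
  then consider "M \<in> ?A" | "M \<in> ?B" | "M \<in> ?C" by blast
  then show "M \<in> ?L"
  proof cases
    case 1
    then show ?thesis by (auto simp: omsets_def)
  next
    case 2
    then obtain R where R: "R \<in> omsets k (k - i) (m + 1) (n - (m + 1) * (i + 0))" "(m + 1) * (i + 0) \<le> n"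
      "M = R + replicate_mset i (m + 1, False) + replicate_mset 0 (m + 1, True)"
      by (auto simp: shift_set_def split: if_splits)
    show ?thesis using omsets_add[OF R(1), of 0 i] R(2,3) assms by auto
  next
    case 3
    then obtain R where R: "R \<in> omsets k (k - i - 1) (m + 1) (n - (m + 1) * (i + 1))" "(m + 1) * (i + 1) \<le> n"
      "M = R + replicate_mset i (m + 1, False) + replicate_mset 1 (m + 1, True)"
      by (auto simp: shift_set_def split: if_splits)
    show ?thesis using omsets_add[OF R(1), of 1 i] R(2,3) assms by auto
  qed
qed

text \<open>Each use of \<open>omsets_Suc\<close> either lowers i or raises m without raising n, and
  for n <= m at most the empty multiset is left.\<close>

lemma finite_omsets: "i \<le> k \<Longrightarrow> finite (omsets k i m n)"
proof (induction "n - m" arbitrary: i m n rule: less_induct)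
  case less
  have "i \<le> k \<Longrightarrow> finite (omsets k i m n)" for i
  proof (induction i)
    case (Suc i)
    show ?case
    proof (cases "n \<le> m")
      case True
      then show ?thesis using omsets_top[of n m "Suc i" k] Suc.prems by auto
    next
      case False
      have "finite (omsets k c (m + 1) (n - d))" if "c \<le> k" for c d
        using False that by (intro less.hyps) auto
      then show ?thesis
        using Suc omsets_Suc[of i k m n] by (auto simp: shift_set_def)
    qed
  qed (simp add: omsets_0)
  then show ?case using less.prems by blast
qed

lemma num_B_0: "num_B k 0 m n = 0"
  by (simp add: num_B_def omsets_0)

lemma num_B_top: "n \<le> m \<Longrightarrow> 0 < i \<Longrightarrow> 0 < k \<Longrightarrow> num_B k i m n = (if n = 0 then 1 else 0)"
  by (simp add: num_B_def omsets_top)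

text \<open>A majorant that depends neither on m nor on i; it provides convergence for all of them
  at once and dominates the limit for m to infinity.\<close>

lemma num_B_le:
  assumes "0 < k" "i \<le> k"
  shows "num_B k i m n \<le> num_B k k 0 n"
proof -
  have "M \<in> omsets k k 0 n" if M: "M \<in> omsets k i m n" for M
  proof -
    have z: "count M (l, b) = 0" if "l \<le> m" for l b
      using M that by (force simp: omsets_def not_in_iff)
    have "count M (l + 1, False) + count M (l, False) + count M (l, True) < k" for l
    proof -
      consider "l > m" | "l = m" | "l < m" by linarith
      then show ?thesis
        by cases (use M z[of l] z[of "l + 1"] assms in \<open>auto simp: omsets_def\<close>)
    qed
    moreover have "count M (1, False) < k"
      using M z[of 1] assms by (cases m) (auto simp: omsets_def)
    moreover have "\<forall>p\<in>#M. 0 < fst p"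
      using M by (force simp: omsets_def)
    ultimately show ?thesis using M by (simp add: omsets_def)
  qed
  then show ?thesis
    unfolding num_B_def by (intro card_mono finite_omsets) auto
qed

theorem num_B_Suc:
  assumes "i < k"
  shows "num_B k (i + 1) m n = num_B k i m n + shift ((m + 1) * i) (num_B k (k - i) (m + 1)) n +
     shift ((m + 1) * (i + 1)) (num_B k (k - i - 1) (m + 1)) n"
proof -
  let ?f = "\<lambda>g R. R + replicate_mset i (m + 1, False) + replicate_mset g (m + 1, True)"
  let ?S = "\<lambda>g. shift_set ((m + 1) * (i + g)) (omsets k (k - i - g) (m + 1)) n"
  have ct: "count M (m + 1, False) = i \<and> count M (m + 1, True) = g" if "M \<in> ?f g ` ?S g" "g \<le> 1" "i + g \<le> k" for M g
  proof -
    from that(1) obtain R n' where "R \<in> omsets k (k - i - g) (m + 1) n'" "M = ?f g R"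
      by (auto simp: shift_set_def split: if_splits)
    then show ?thesis using omsets_add[of R k "k - i - g" m n' g i] that(2,3) by auto
  qed
  have fin: "finite (?S g)" for g using finite_omsets by (simp add: shift_set_def)
  have crd: "card (?f g ` ?S g) = shift ((m + 1) * (i + g)) (num_B k (k - i - g) (m + 1)) n" for g
    by (subst card_image_shift_set) (auto simp: inj_def num_B_def[abs_def])
  define A B C where "A = omsets k i m n" and "B = ?f 0 ` ?S 0" and "C = ?f 1 ` ?S 1"
  have A: "count M (m + 1, False) < i" if "M \<in> A" for M
    using that by (simp add: A_def omsets_def)
  have B: "count M (m + 1, False) = i \<and> count M (m + 1, True) = 0" if "M \<in> B" for M
    using ct[of M 0] that assms unfolding B_def by simp
  have C: "count M (m + 1, False) = i \<and> count M (m + 1, True) = 1" if "M \<in> C" for M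
    using ct[of M 1] that assms unfolding C_def by simp
  have "finite A" "finite B" "finite C"
    unfolding A_def B_def C_def using assms by (intro finite_imageI fin finite_omsets; simp)+
  moreover have "M \<notin> B" "M \<notin> C" if "M \<in> A" for M
    using A[OF that] B[of M] C[of M] by auto
  moreover have "M \<notin> C" if "M \<in> B" for M
    using B[OF that] C[of M] by auto
  ultimately have "finite A" "finite B" "finite C" "A \<inter> B = {}" "(A \<union> B) \<inter> C = {}"
    by blast+
  then have "card (A \<union> B \<union> C) = card A + card B + card C"
    by (simp add: card_Un_disjoint)
  moreover have "num_B k (i + 1) m n = card (A \<union> B \<union> C)"
    unfolding num_B_def A_def B_def C_def using omsets_Suc[OF assms, of m n] by simp
  ultimately show ?thesis
    unfolding A_def B_def C_def crd by (simp add: num_B_def)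
qed

subsection \<open>Generating functions of paths\<close>

definition has_gf :: "(nat \<Rightarrow> nat) \<Rightarrow> complex \<Rightarrow> complex \<Rightarrow> bool" where
  "has_gf c q s \<longleftrightarrow> ((\<lambda>n. of_nat (c n) * q ^ n) has_sum s) UNIV"

lemma has_gf_add: "has_gf c q s \<Longrightarrow> has_gf d q t \<Longrightarrow> has_gf (\<lambda>n. c n + d n) q (s + t)"
  unfolding has_gf_def by (drule (1) has_sum_add) (simp add: algebra_simps)

lemma has_gf_zero: "has_gf (\<lambda>n. 0) q 0"
  by (simp add: has_gf_def)

lemma has_gf_one: "has_gf (\<lambda>n. if n = 0 then 1 else 0) q 1"
  unfolding has_gf_def by (rule has_sum_finite_neutralI[of "{0}"]) auto

lemma has_gf_shift:
  assumes "has_gf c q s"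
  shows "has_gf (shift d c) q (q ^ d * s)"
proof -
  have "((\<lambda>n. q ^ d * (of_nat (c n) * q ^ n)) has_sum q ^ d * s) UNIV"
    using assms unfolding has_gf_def by (rule has_sum_cmult_right)
  also have "?this \<longleftrightarrow> ((\<lambda>n. of_nat (shift d c n) * q ^ n) has_sum q ^ d * s) {d..}"
    by (rule has_sum_reindex_bij_witness[of _ "\<lambda>n. n - d" "\<lambda>n. n + d"])
       (auto simp: shift_def power_add)
  also have "\<dots> \<longleftrightarrow> ((\<lambda>n. of_nat (shift d c n) * q ^ n) has_sum q ^ d * s) UNIV"
    by (rule has_sum_cong_neutral) (auto simp: shift_def)
  finally show ?thesis by (simp add: has_gf_def)
qed

lemma has_gf_unique: "has_gf c q s \<Longrightarrow> has_gf c q t \<Longrightarrow> s = t"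
  unfolding has_gf_def by (rule has_sum_unique)

lemma has_gf_of_bounded:
  assumes "\<And>M. (\<Sum>n<M. real (c n) * norm q ^ n) \<le> B"
  shows "\<exists>s. has_gf c q s"
proof -
  have "summable (\<lambda>n. real (c n) * norm q ^ n)"
    using assms by (intro summableI_nonneg_bounded) auto
  then have "(\<lambda>n. of_nat (c n) * q ^ n) summable_on UNIV"
    by (intro norm_summable_imp_summable_on) (simp add: norm_mult norm_power)
  then show ?thesis
    unfolding has_gf_def by (auto simp: summable_on_def)
qed

lemma has_gf_norm:
  assumes "has_gf c q s"
  obtains t where "has_gf c (of_real (norm q)) (of_real t)" "0 \<le> t"
    "((\<lambda>n. real (c n) * norm q ^ n) has_sum t) UNIV"
proof -
  have "(\<lambda>n. norm (of_nat (c n) * q ^ n)) summable_on UNIV"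
    using assms unfolding has_gf_def
    by (metis has_sum_imp_summable summable_on_iff_abs_summable_on_complex)
  then obtain t where t: "((\<lambda>n. real (c n) * norm q ^ n) has_sum t) UNIV"
    by (auto simp: summable_on_def norm_mult norm_power)
  then have "((\<lambda>n. of_real (real (c n) * norm q ^ n)) has_sum (of_real t :: complex)) UNIV"
    by (rule has_sum_of_real)
  then show ?thesis
    using t by (intro that[of t]) (auto simp: has_gf_def has_sum_nonneg)
qed

lemma sum_shift_le:
  fixes r :: real
  assumes "0 \<le> r"
  shows "(\<Sum>n<M. real (shift d c n) * r ^ n) \<le> r ^ d * (\<Sum>n<M. real (c n) * r ^ n)"
proof (cases "d \<le> M")
  case True
  have "(\<Sum>n<M. real (shift d c n) * r ^ n) = (\<Sum>n\<in>{d..<M}. real (shift d c n) * r ^ n)"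
    by (intro sum.mono_neutral_right) (auto simp: shift_def)
  also have "\<dots> = (\<Sum>n<M - d. r ^ d * (real (c n) * r ^ n))"
    by (rule sum.reindex_bij_witness[of _ "\<lambda>n. n + d" "\<lambda>n. n - d"])
       (auto simp: shift_def simp flip: power_add)
  also have "\<dots> \<le> (\<Sum>n<M. r ^ d * (real (c n) * r ^ n))"
    using assms by (intro sum_mono2) auto
  finally show ?thesis by (simp add: sum_distrib_left)
next
  case False
  then have "(\<Sum>n<M. real (shift d c n) * r ^ n) = 0"
    by (intro sum.neutral) (auto simp: shift_def)
  then show ?thesis using assms by (simp add: sum_nonneg)
qed

text \<open>Convergence must be shown before the equation can be solved. Every truncated sum S at r
  = |q| satisfies S <= r^N S + t, hence S <= t / (1 - r^N), uniformly in the truncation.\<close>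

lemma has_gf_geometric:
  assumes q: "norm q < 1" and N: "N \<ge> 1" and rec: "\<And>n. c n = shift N c n + y n"
    and y: "has_gf y q s"
  shows "has_gf c q (s / (1 - q ^ N))"
proof -
  let ?r = "norm q"
  obtain t where t: "((\<lambda>n. real (y n) * ?r ^ n) has_sum t) UNIV"
    using has_gf_norm[OF y] by metis
  have rN: "?r ^ N < 1" using q N by (simp add: power_less_one_iff)
  have "(\<Sum>n<M. real (c n) * ?r ^ n) \<le> t / (1 - ?r ^ N)" for M
  proof -
    let ?S = "\<Sum>n<M. real (c n) * ?r ^ n"
    have "?S = (\<Sum>n<M. real (shift N c n) * ?r ^ n) + (\<Sum>n<M. real (y n) * ?r ^ n)"
      by (subst rec) (simp add: algebra_simps sum.distrib)
    also have "\<dots> \<le> ?r ^ N * ?S + t"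
      by (intro add_mono sum_shift_le finite_sum_le_has_sum[OF t]) auto
    finally show ?thesis using rN by (simp add: field_simps)
  qed
  then obtain S where S: "has_gf c q S" using has_gf_of_bounded by blast
  have "has_gf (\<lambda>n. shift N c n + y n) q (q ^ N * S + s)"
    by (intro has_gf_add has_gf_shift S y)
  moreover have "(\<lambda>n. shift N c n + y n) = c" using rec by auto
  ultimately have "has_gf c q (q ^ N * S + s)" by simp
  then have "S = q ^ N * S + s" using S has_gf_unique by blast
  moreover have "q ^ N \<noteq> 1" using rN by (metis norm_one norm_power less_irrefl)
  ultimately have "S = s / (1 - q ^ N)" by (simp add: field_simps)
  then show ?thesis using S by simp
qed

context nome
begin

section \<open>Closed forms for the path generating functions\<close>

definition mhalf :: "nat \<Rightarrow> complex" where
  "mhalf N = qpoch (- q) q (int N - 1)"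

lemma mhalf_Suc: "mhalf (Suc N) = pochm N"
  by (simp add: mhalf_def qpoch_def pochm_def)

text \<open>The quotient for index -1 is that of (-q) by (-1) at infinity, and the first factor of
  the latter product is 2.\<close>

lemma mhalf_0: "mhalf 0 = 1 / 2"
proof -
  have "(\<lambda>n. \<Prod>i<Suc n. 1 - (- 1) * q ^ i) \<longlonglongrightarrow> qpoch_inf (- 1) q"
    by (rule LIMSEQ_Suc[OF qpoch_inf_LIMSEQ[OF q_lt]])
  moreover have "(\<Prod>i<Suc n. 1 - (- 1) * q ^ i) = 2 * pochm n" for n
    by (subst prod.lessThan_Suc_shift) (simp add: pochm_def)
  ultimately have "(\<lambda>n. 2 * pochm n) \<longlonglongrightarrow> qpoch_inf (- 1) q" by simp
  moreover have "(\<lambda>n. 2 * pochm n) \<longlonglongrightarrow> 2 * qpoch_inf (- q) q"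
    by (intro tendsto_intros pochm_LIMSEQ)
  ultimately have "qpoch_inf (- 1) q = 2 * qpoch_inf (- q) q"
    by (rule LIMSEQ_unique)
  then show ?thesis
    using q_nz qpoch_inf_mq_nz by (simp add: mhalf_def qpoch_def)
qed

lemma mhalf_rec: "mhalf (Suc N) = (1 + q ^ N) * mhalf N"
  by (cases N) (simp_all add: mhalf_Suc mhalf_0 pochm_Suc)

text \<open>\<open>alpha\<close> and \<open>eps\<close> are the generating functions of
  \<open>paths_A\<close> and \<open>paths_E\<close> by major index, as \<open>gf_num_A\<close> and
  \<open>gf_num_E\<close> establish.\<close>

definition alpha :: "nat \<Rightarrow> int \<Rightarrow> nat \<Rightarrow> complex" where
  "alpha k h N = q ^ (N * (N - 1) div 2) * pochm N * W (int k) h N"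

definition eps :: "nat \<Rightarrow> int \<Rightarrow> nat \<Rightarrow> complex" where
  "eps k h N = q ^ ((N + 1) * N div 2) * mhalf N * (W (int k) h N + W (int k) (h - 1) N)"

lemma alpha_minus_1: "alpha k (- 1) N = alpha k 0 N"
  by (simp add: alpha_def W_minus_1)

lemma alpha_zero: "alpha k h 0 = 1"
  by (simp add: alpha_def W_zero)

lemma alpha_top: "alpha k (int k - 1) N = q ^ N * alpha k (int k - 2) N"
  using W_top[of "int k" N] by (simp add: alpha_def)

lemma tri_Suc: "Suc N * (Suc N - 1) div 2 = N * (N - 1) div 2 + N"
proof -
  have "Suc N * (Suc N - 1) = N * (N - 1) + N * 2" by (cases N) (simp_all add: algebra_simps)
  then show ?thesis by simp
qed

text \<open>In terms of b(h) = alpha(h) - q^N alpha(h - 1) the left-hand side is b(h) - q^N b(h +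
  1), so b obeys the recurrence \<open>num_Y_rec\<close>. The factor 1 + q^N gained by
  \<open>pochm\<close> accounts for the two kinds of peaks.\<close>

lemma alpha_rec:
  assumes "N \<ge> 1"
  shows "alpha k h N - q ^ N * alpha k (h - 1) N - q ^ N * (alpha k (h + 1) N - q ^ N * alpha k h N)
    = q ^ (N - 1) * alpha k h (N - 1) + q ^ (2 * N - 1) * alpha k h (N - 1)"
proof -
  obtain M where N: "N = Suc M" using assms by (cases N) auto
  let ?c = "q ^ (M * (M - 1) div 2 + M) * pochm M * (1 + q ^ N)"
  have a: "alpha k j N = ?c * W (int k) j N" for j
    unfolding alpha_def N tri_Suc by (simp add: pochm_Suc)
  have "alpha k h N - q ^ N * alpha k (h - 1) N - q ^ N * (alpha k (h + 1) N - q ^ N * alpha k h N)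
    = ?c * ((1 + q ^ (2 * N)) * W (int k) h N - q ^ N * (W (int k) (h - 1) N + W (int k) (h + 1) N))"
    unfolding a mult_2 power_add by (simp add: algebra_simps)
  also have "\<dots> = ?c * W (int k) h (N - 1)"
    unfolding W_rec[OF assms] ..
  also have "\<dots> = (q ^ M + q ^ (M + N)) * alpha k h M"
    unfolding alpha_def by (simp add: N power_add algebra_simps)
  also have "\<dots> = q ^ (N - 1) * alpha k h (N - 1) + q ^ (2 * N - 1) * alpha k h (N - 1)"
  proof -
    have "2 * N - 1 = M + N" "N - 1 = M" using N by auto
    then show ?thesis by (simp only: distrib_right)
  qed
  finally show ?thesis .
qed

text \<open>Induction downwards from h = k - 1, where no ascent is possible and
  \<open>alpha_top\<close> makes the claimed value 0.\<close>

lemma gf_num_Y: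
  assumes A: "\<And>h. h < k \<Longrightarrow> has_gf (num_A k h (N - 1)) q (alpha k (int h) (N - 1))" and N: "N \<ge> 1"
    and h: "h < k"
  shows "has_gf (num_Y k h N) q (alpha k (int h) N - q ^ N * alpha k (int h - 1) N)"
  using h
proof (induction "k - 1 - h" arbitrary: h)
  case 0
  then have h: "h = k - 1" by simp
  then have "int h = int k - 1" using 0 by simp
  then have "alpha k (int h) N - q ^ N * alpha k (int h - 1) N = 0"
    using alpha_top[of k N] by simp
  moreover have "num_Y k h N = (\<lambda>n. 0)"
    using num_Y_rec[OF N, of k h] h 0 by auto
  ultimately show ?case by (simp add: has_gf_zero)
next
  case (Suc d)
  then have h: "h + 1 < k" by simp
  have "num_Y k h N = (\<lambda>n. shift (N - 1) (num_A k h (N - 1)) n +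
     shift (2 * N - 1) (num_A k h (N - 1)) n + shift N (num_Y k (h + 1) N) n)"
    using num_Y_rec[OF N, of k h] h by auto
  moreover have "has_gf (num_Y k (h + 1) N) q (alpha k (int h + 1) N - q ^ N * alpha k (int h) N)"
    using Suc.hyps(1)[of "h + 1"] Suc.hyps(2) h by (simp add: add.commute)
  ultimately have "has_gf (num_Y k h N) q (q ^ (N - 1) * alpha k (int h) (N - 1) +
     q ^ (2 * N - 1) * alpha k (int h) (N - 1) + q ^ N * (alpha k (int h + 1) N - q ^ N * alpha k (int h) N))"
    using A[of h] h by (auto intro!: has_gf_add has_gf_shift)
  then show ?case
    unfolding alpha_rec[OF N, symmetric] by simp
qed

text \<open>The recurrence is that of \<open>num_Y\<close> with q^(2N-1) in place of q^(N-1) (1 +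
  q^N), so the solution is scaled by q^N / (1 + q^N).\<close>

lemma gf_num_X:
  assumes A: "\<And>h. h < k \<Longrightarrow> has_gf (num_A k h (N - 1)) q (alpha k (int h) (N - 1))" and N: "N \<ge> 1"
    and h: "h < k"
  shows "has_gf (num_X k h N) q (q ^ N / (1 + q ^ N) * (alpha k (int h) N - q ^ N * alpha k (int h - 1) N))"
  using h
proof (induction "k - 1 - h" arbitrary: h)
  case 0
  then have h: "h = k - 1" by simp
  then have "int h = int k - 1" using 0 by simp
  then have "alpha k (int h) N - q ^ N * alpha k (int h - 1) N = 0"
    using alpha_top[of k N] by simp
  moreover have "num_X k h N = (\<lambda>n. 0)"
    using num_X_rec[OF N, of k h] h 0 by auto
  ultimately show ?case by (simp add: has_gf_zero)
next
  case (Suc d)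
  then have h: "h + 1 < k" by simp
  let ?b = "\<lambda>h. alpha k h N - q ^ N * alpha k (h - 1) N"
  have X: "num_X k h N = (\<lambda>n. shift (2 * N - 1) (num_A k h (N - 1)) n + shift N (num_X k (h + 1) N) n)"
    using num_X_rec[OF N, of k h] h by auto
  have IH: "has_gf (num_X k (h + 1) N) q (q ^ N / (1 + q ^ N) * ?b (int h + 1))"
    using Suc.hyps(1)[of "h + 1"] Suc.hyps(2) h by (simp add: add.commute)
  have "has_gf (num_X k h N) q (q ^ (2 * N - 1) * alpha k (int h) (N - 1) +
      q ^ N * (q ^ N / (1 + q ^ N) * ?b (int h + 1)))"
    unfolding X using h by (intro has_gf_add has_gf_shift A IH) simp
  moreover have "q ^ (2 * N - 1) * alpha k (int h) (N - 1) + q ^ N * (q ^ N / (1 + q ^ N) * ?b (int h + 1))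
     = q ^ N / (1 + q ^ N) * ?b (int h)"
  proof -
    have p: "q ^ (2 * N - 1) = q ^ (N - 1) * q ^ N"
      using N by (simp flip: power_add add: mult_2)
    have b: "?b (int h) = q ^ (N - 1) * (1 + q ^ N) * alpha k (int h) (N - 1) + q ^ N * ?b (int h + 1)"
      using alpha_rec[OF N, of k "int h"] unfolding p by (simp add: algebra_simps)
    show ?thesis
      unfolding p b using one_plus_q_nz[of N] by (simp add: field_simps)
  qed
  ultimately show ?case by simp
qed

lemma gf_num_A: "h < k \<Longrightarrow> has_gf (num_A k h N) q (alpha k (int h) N)"
proof (induction N arbitrary: h)
  case 0
  have "num_A k h 0 = (\<lambda>n. if n = 0 then 1 else 0)" by (auto simp: num_A_0)
  then show ?case using has_gf_one by (simp add: alpha_zero)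
next
  case (Suc N)
  have Y: "has_gf (num_Y k h (Suc N)) q (alpha k (int h) (Suc N) - q ^ Suc N * alpha k (int h - 1) (Suc N))"
    if "h < k" for h
    using that Suc.IH by (intro gf_num_Y) auto
  from \<open>h < k\<close> show ?case
  proof (induction h)
    case 0
    \<comment> \<open>East steps stay at height 0, so the count refers to itself. The lower
      reflection, which equates \<open>alpha\<close> at -1 and at 0, cancels the
      denominator.\<close>
    have "has_gf (num_A k 0 (Suc N)) q ((alpha k 0 (Suc N) - q ^ Suc N * alpha k (- 1) (Suc N)) / (1 - q ^ Suc N))"
      using num_A_rec[of "Suc N" k 0] Y[OF 0] by (intro has_gf_geometric q_lt) auto
    moreover have "(alpha k 0 (Suc N) - q ^ Suc N * alpha k (- 1) (Suc N)) / (1 - q ^ Suc N) = alpha k 0 (Suc N)"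
      unfolding alpha_minus_1 using one_minus_q_nz[of "Suc N"] by (simp add: field_simps)
    ultimately show ?case by simp
  next
    case (Suc h)
    have "num_A k (Suc h) (Suc N) = (\<lambda>n. shift (Suc N) (num_A k h (Suc N)) n + num_Y k (Suc h) (Suc N) n)"
      using num_A_rec[of "Suc N" k "Suc h"] by auto
    moreover have "has_gf (\<lambda>n. shift (Suc N) (num_A k h (Suc N)) n + num_Y k (Suc h) (Suc N) n) q
      (q ^ Suc N * alpha k (int h) (Suc N) +
       (alpha k (int (Suc h)) (Suc N) - q ^ Suc N * alpha k (int (Suc h) - 1) (Suc N)))"
      using Suc by (intro has_gf_add has_gf_shift Y) auto
    ultimately show ?case by simp
  qed
qed

text \<open>In q^N alpha(h - 1) + q^N / (1 + q^N) (alpha(h) - q^N alpha(h - 1)) the two heights get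
  the same coefficient q^N / (1 + q^N); dividing \<open>pochm N\<close> by 1 + q^N gives
  \<open>mhalf N\<close>.\<close>

theorem gf_num_E:
  assumes "h < k"
  shows "has_gf (num_E k h N) q (eps k (int h) N)"
proof (cases N)
  case 0
  have "num_E k h 0 = (\<lambda>n. if n = 0 then 1 else 0)" by (auto simp: num_E_0)
  then show ?thesis using has_gf_one by (simp add: eps_def mhalf_0 W_zero 0)
next
  case (Suc M)
  then have N: "N \<ge> 1" by simp
  let ?b = "alpha k (int h) N - q ^ N * alpha k (int h - 1) N"
  have "has_gf (num_A k (h - 1) N) q (alpha k (int h - 1) N)"
    using gf_num_A[of "h - 1" k N] assms alpha_minus_1 by (cases h) auto
  moreover have "num_E k h N = (\<lambda>n. shift N (num_A k (h - 1) N) n + num_X k h N n)"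
    using num_E_rec[OF N, of k h] by auto
  ultimately have "has_gf (num_E k h N) q (q ^ N * alpha k (int h - 1) N + q ^ N / (1 + q ^ N) * ?b)"
    using gf_num_X[OF gf_num_A N assms] by (auto intro!: has_gf_add has_gf_shift)
  moreover have "q ^ N * alpha k (int h - 1) N + q ^ N / (1 + q ^ N) * ?b = eps k (int h) N"
  proof -
    have "q ^ N * alpha k (int h - 1) N + q ^ N / (1 + q ^ N) * ?b =
      q ^ N * (alpha k (int h) N + alpha k (int h - 1) N) / (1 + q ^ N)"
      using one_plus_q_nz[of N] by (simp add: field_simps)
    also have "\<dots> = q ^ N * (q ^ (N * (N - 1) div 2) * pochm N / (1 + q ^ N)) * (W (int k) (int h) N + W (int k) (int h - 1) N)"
      unfolding alpha_def by (simp add: algebra_simps add_divide_distrib)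
    also have "pochm N / (1 + q ^ N) = mhalf N"
      using one_plus_q_nz[of N] unfolding Suc by (simp add: pochm_Suc mhalf_Suc)
    then have "q ^ N * (q ^ (N * (N - 1) div 2) * pochm N / (1 + q ^ N)) = q ^ N * q ^ (N * (N - 1) div 2) * mhalf N"
      by (metis mult.assoc times_divide_eq_right)
    also have "q ^ N * q ^ (N * (N - 1) div 2) = q ^ ((N + 1) * N div 2)"
      using tri_Suc[of N] by (simp add: power_add algebra_simps)
    finally show ?thesis by (simp add: eps_def)
  qed
  ultimately show ?thesis by simp
qed

end

subsection \<open>The multiple series\<close>

definition tuples_at :: "nat \<Rightarrow> nat \<Rightarrow> (nat \<Rightarrow> nat) set" where
  "tuples_at k N = {t \<in> index_tuples k. t 1 = N}"

definition tuple_cons :: "nat \<Rightarrow> (nat \<Rightarrow> nat) \<Rightarrow> nat \<Rightarrow> nat" where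
  "tuple_cons N t i = (if i = 0 then 0 else if i = 1 then N else t (i - 1))"

text \<open>For k = 1 a tuple has no entries and N_1 is the conventional value N_k = 0; this matches
  the vanishing of \<open>W 1 0 N\<close> for positive N.\<close>

lemma tuples_at_1: "tuples_at (Suc 0) N = (if N = 0 then {\<lambda>_. 0} else {})"
  by (auto simp: tuples_at_def index_tuples_def)

lemma tuples_at_Suc:
  assumes "k \<ge> 1"
  shows "tuples_at (k + 1) N = (\<Union>r\<le>N. tuple_cons N ` tuples_at k r)"
proof (intro subset_antisym subsetI)
  fix t assume "t \<in> tuples_at (k + 1) N"
  then have t: "\<And>i. i \<notin> {1..<k + 1} \<Longrightarrow> t i = 0" "\<And>i. i \<in> {1..<k + 1} \<Longrightarrow> t (i + 1) \<le> t i" "t 1 = N"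
    by (auto simp: tuples_at_def index_tuples_def)
  define u where "u = (\<lambda>i. if i = 0 then 0 else t (i + 1))"
  have "t = tuple_cons N u"
    using t(1)[of 0] t(3) by (auto simp: fun_eq_iff tuple_cons_def u_def)
  moreover have "u \<in> tuples_at k (t 2)"
    using t(1,2) assms by (auto simp: tuples_at_def index_tuples_def u_def numeral_2_eq_2)
  moreover have "t 2 \<le> N" using t(2)[of 1] t(3) assms by (simp add: numeral_2_eq_2)
  ultimately show "t \<in> (\<Union>r\<le>N. tuple_cons N ` tuples_at k r)" by auto
next
  fix t assume "t \<in> (\<Union>r\<le>N. tuple_cons N ` tuples_at k r)"
  then obtain u where u: "t = tuple_cons N u" "u 1 \<le> N" "\<And>i. i \<notin> {1..<k} \<Longrightarrow> u i = 0"
    "\<And>i. i \<in> {1..<k} \<Longrightarrow> u (i + 1) \<le> u i"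
    by (auto simp: tuples_at_def index_tuples_def)
  have "t i = 0" if "i \<notin> {1..<k + 1}" for i
    using that u(3)[of "i - 1"] assms by (cases i) (auto simp: u(1) tuple_cons_def)
  moreover have "t (i + 1) \<le> t i" if "i \<in> {1..<k + 1}" for i
    using that u(2) u(4)[of "i - 1"] by (cases i) (auto simp: u(1) tuple_cons_def)
  ultimately show "t \<in> tuples_at (k + 1) N"
    by (auto simp: tuples_at_def index_tuples_def u(1) tuple_cons_def)
qed

lemma finite_tuples_at: "k \<ge> 1 \<Longrightarrow> finite (tuples_at k N)"
proof (induction k arbitrary: N rule: dec_induct)
  case base
  then show ?case by (simp add: tuples_at_1)
next
  case (step k)
  then show ?case using tuples_at_Suc[of k N] by simp
qed

lemma sum_tuples_at_Suc:
  assumes "k \<ge> 1"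
  shows "(\<Sum>t\<in>tuples_at (k + 1) N. f t) = (\<Sum>r\<le>N. \<Sum>t\<in>tuples_at k r. f (tuple_cons N t))"
proof -
  have inj: "inj_on (tuple_cons N) (tuples_at k r)" for r
  proof (rule inj_onI)
    fix t u assume tu: "t \<in> tuples_at k r" "u \<in> tuples_at k r" "tuple_cons N t = tuple_cons N u"
    have "t i = u i" for i
    proof (cases "i = 0")
      case True
      then show ?thesis using tu by (simp add: tuples_at_def index_tuples_def)
    next
      case False
      then show ?thesis using fun_cong[OF tu(3), of "i + 1"] by (simp add: tuple_cons_def)
    qed
    then show "t = u" by auto
  qed
  have r: "t 2 = r" if "t \<in> tuple_cons N ` tuples_at k r" for t r
    using that by (auto simp: tuples_at_def tuple_cons_def)
  have "(\<Sum>t\<in>tuples_at (k + 1) N. f t) = (\<Sum>r\<le>N. \<Sum>t\<in>tuple_cons N ` tuples_at k r. f t)"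
    unfolding tuples_at_Suc[OF assms]
    using finite_tuples_at[OF assms] r by (intro sum.UNION_disjoint) (simp, simp, blast)
  also have "\<dots> = (\<Sum>r\<le>N. \<Sum>t\<in>tuples_at k r. f (tuple_cons N t))"
    by (simp add: sum.reindex[OF inj])
  finally show ?thesis .
qed

lemma sum_tuple_cons:
  assumes "1 \<le> a"
  shows "(\<Sum>i\<in>{a + 1..<k + 1}. g (tuple_cons N t i)) = (\<Sum>i\<in>{a..<k}. g (t i))"
  by (rule sum.reindex_bij_witness[of _ "\<lambda>i. i + 1" "\<lambda>i. i - 1"]) (use assms in \<open>auto simp: tuple_cons_def\<close>)

lemma sum_from_1:
  assumes "k \<ge> 1" "t \<in> tuples_at k r"
  shows "(\<Sum>i\<in>{1..<k}. (t i) ^ Suc d) = r ^ Suc d + (\<Sum>i\<in>{2..<k}. (t i) ^ Suc d)"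
proof (cases "k = 1")
  case True
  then show ?thesis using assms by (auto simp: tuples_at_1 split: if_splits)
next
  case False
  then have "{1..<k} = insert 1 {2..<k}" using assms by auto
  then show ?thesis using assms(2) by (simp add: tuples_at_def)
qed

context nome
begin

definition tuple_denom :: "nat \<Rightarrow> (nat \<Rightarrow> nat) \<Rightarrow> complex" where
  "tuple_denom k t = (\<Prod>i\<in>{1..<k}. invq (int (t i) - int (t (i + 1))))"

text \<open>The term of the multiple series without its factor depending on N_1 alone, which does
  not take part in the Bailey chain.\<close>

definition core :: "nat \<Rightarrow> nat \<Rightarrow> (nat \<Rightarrow> nat) \<Rightarrow> complex" where
  "core k a t = q ^ ((\<Sum>i\<in>{2..<k}. (t i)\<^sup>2) + (\<Sum>i\<in>{a+1..<k}. t i)) * (1 + q ^ t a) * tuple_denom k t"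

lemma tuple_denom_cons:
  assumes "k \<ge> 1" "t \<in> tuples_at k r"
  shows "tuple_denom (k + 1) (tuple_cons N t) = invq (int N - int r) * tuple_denom k t"
proof -
  have "{1..<k + 1} = insert 1 {2..<k + 1}" using assms by auto
  then have "tuple_denom (k + 1) (tuple_cons N t) = invq (int N - int r) *
     (\<Prod>i\<in>{2..<k + 1}. invq (int (tuple_cons N t i) - int (tuple_cons N t (i + 1))))"
    using assms(2) by (simp add: tuple_denom_def tuple_cons_def tuples_at_def)
  also have "(\<Prod>i\<in>{2..<k + 1}. invq (int (tuple_cons N t i) - int (tuple_cons N t (i + 1)))) = tuple_denom k t"
    unfolding tuple_denom_def
    by (rule prod.reindex_bij_witness[of _ "\<lambda>i. i + 1" "\<lambda>i. i - 1"]) (auto simp: tuple_cons_def)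
  finally show ?thesis .
qed

text \<open>The first entry has no square in \<open>core\<close>, so r^2 appears once r becomes the
  second entry. The distinguished position a moves along with k.\<close>

lemma core_cons:
  assumes "k \<ge> 1" "a \<ge> 1" "t \<in> tuples_at k r"
  shows "core (k + 1) (a + 1) (tuple_cons N t) = q ^ (r\<^sup>2) * invq (int N - int r) * core k a t"
proof -
  have 1: "(\<Sum>i\<in>{2..<k + 1}. (tuple_cons N t i)\<^sup>2) = r\<^sup>2 + (\<Sum>i\<in>{2..<k}. (t i)\<^sup>2)"
    using sum_tuple_cons[of 1 "\<lambda>x. x\<^sup>2" N t k] sum_from_1[OF assms(1,3), of 1]
    by (simp add: numeral_2_eq_2)
  have 2: "(\<Sum>i\<in>{a + 1 + 1..<k + 1}. tuple_cons N t i) = (\<Sum>i\<in>{a + 1..<k}. t i)"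
    using sum_tuple_cons[of "a + 1" "\<lambda>x. x" N t k] by simp
  have 3: "tuple_cons N t (a + 1) = t a"
    using assms by (simp add: tuple_cons_def)
  show ?thesis
    unfolding core_def 1 2 3 tuple_denom_cons[OF assms(1,3)] by (simp add: power_add algebra_simps)
qed

text \<open>The case a = 1 without the factor 1 + q^(N_1), which is constant for given N_1. It needs
  its own recursion because the linear terms begin at the second entry.\<close>

definition core_one :: "nat \<Rightarrow> (nat \<Rightarrow> nat) \<Rightarrow> complex" where
  "core_one k t = q ^ ((\<Sum>i\<in>{2..<k}. (t i)\<^sup>2) + (\<Sum>i\<in>{2..<k}. t i)) * tuple_denom k t"

lemma core_one_cons:
  assumes "k \<ge> 1" "t \<in> tuples_at k r"
  shows "core_one (k + 1) (tuple_cons N t) = q ^ (r\<^sup>2) * invq (int N - int r) * (q ^ r * core_one k t)"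
proof -
  have 1: "(\<Sum>i\<in>{2..<k + 1}. (tuple_cons N t i)\<^sup>2) = r\<^sup>2 + (\<Sum>i\<in>{2..<k}. (t i)\<^sup>2)"
    using sum_tuple_cons[of 1 "\<lambda>x. x\<^sup>2" N t k] sum_from_1[OF assms, of 1]
    by (simp add: numeral_2_eq_2)
  have 2: "(\<Sum>i\<in>{2..<k + 1}. tuple_cons N t i) = r + (\<Sum>i\<in>{2..<k}. t i)"
    using sum_tuple_cons[of 1 "\<lambda>x. x" N t k] sum_from_1[OF assms, of 0]
    by (simp add: numeral_2_eq_2)
  show ?thesis
    unfolding core_one_def 1 2 tuple_denom_cons[OF assms] by (simp add: power_add algebra_simps)
qed

lemma core_eq_core_one: "t \<in> tuples_at k N \<Longrightarrow> core k 1 t = (1 + q ^ N) * core_one k t"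
  by (simp add: core_def core_one_def tuples_at_def numeral_2_eq_2)

text \<open>The additional factor q^r from the linear terms is absorbed by \<open>W_top\<close>,
  which raises h from k - 2 to k - 1; the Bailey step then raises k, and again h is the new k minus
  2.\<close>

lemma sum_core_one:
  assumes "k \<ge> 1"
  shows "(\<Sum>t\<in>tuples_at k N. core_one k t) = W (int k) (int k - 2) N"
  using assms
proof (induction k arbitrary: N rule: dec_induct)
  case base
  then show ?case
    using W_1[of N] W_minus_1[of 1 N] by (simp add: tuples_at_1 core_one_def tuple_denom_def)
next
  case (step k)
  have "(\<Sum>t\<in>tuples_at (k + 1) N. core_one (k + 1) t)
    = (\<Sum>r\<le>N. \<Sum>t\<in>tuples_at k r. core_one (k + 1) (tuple_cons N t))"
    using step by (simp add: sum_tuples_at_Suc del: One_nat_def)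
  also have "\<dots> = (\<Sum>r\<le>N. \<Sum>t\<in>tuples_at k r. q ^ (r\<^sup>2) * invq (int N - int r) * (q ^ r * core_one k t))"
    using step by (intro sum.cong refl core_one_cons) auto
  also have "\<dots> = (\<Sum>r\<le>N. q ^ (r\<^sup>2) * invq (int N - int r) * (q ^ r * W (int k) (int k - 2) r))"
    by (simp only: sum_distrib_left[symmetric] step.IH)
  also have "\<dots> = W (int k + 1) (int k - 1) N"
    unfolding W_top[symmetric] by (rule W_Suc)
  finally show ?case by (simp add: add.commute)
qed

text \<open>Raising k and a together keeps h = k - a, and so does the Bailey step. For a = 1,
  \<open>W_top\<close> splits (1 + q^N) W into the two heights k - 1 and k - 2.\<close>

lemma sum_core:
  assumes "1 \<le> a" "a \<le> k"
  shows "(\<Sum>t\<in>tuples_at k N. core k a t) = W (int k) (int k - int a) N + W (int k) (int k - int a - 1) N"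
  using assms
proof (induction a arbitrary: k N rule: dec_induct)
  case base
  have "(\<Sum>t\<in>tuples_at k N. core k 1 t) = (1 + q ^ N) * W (int k) (int k - 2) N"
    using base by (simp add: core_eq_core_one[simplified] sum_core_one flip: sum_distrib_left)
  then show ?case
    using W_top[of "int k" N] by (simp add: algebra_simps)
next
  case (step a)
  then obtain k' where k: "k = k' + 1" "a \<le> k'" by (cases k) auto
  then have k': "k' \<ge> 1" using step by simp
  have "(\<Sum>t\<in>tuples_at (k' + 1) N. core (k' + 1) (a + 1) t)
    = (\<Sum>r\<le>N. \<Sum>t\<in>tuples_at k' r. core (k' + 1) (a + 1) (tuple_cons N t))"
    using k' by (rule sum_tuples_at_Suc)
  also have "\<dots> = (\<Sum>r\<le>N. \<Sum>t\<in>tuples_at k' r. q ^ (r\<^sup>2) * invq (int N - int r) * core k' a t)"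
    using step k' by (intro sum.cong refl core_cons) auto
  also have "\<dots> = (\<Sum>r\<le>N. q ^ (r\<^sup>2) * invq (int N - int r) * (W (int k') (int k' - int a) r + W (int k') (int k' - int a - 1) r))"
    by (simp only: sum_distrib_left[symmetric] step.IH[OF k(2)])
  also have "\<dots> = W (int k' + 1) (int k' - int a) N + W (int k' + 1) (int k' - int a - 1) N"
    by (simp only: distrib_left sum.distrib W_Suc)
  finally show ?case by (simp add: k(1) add.commute)
qed

lemma series_term_eq:
  assumes "t \<in> tuples_at k N"
  shows "series_term k a q t = q ^ ((N + 1) * N div 2) * mhalf N * core k a t"
proof -
  have "qpoch q q (int (t i) - int (t (i + 1))) = inverse (invq (int (t i) - int (t (i + 1))))" if "i \<in> {1..<k}" for i
  proof -
    have "t (i + 1) \<le> t i" using assms that by (simp add: tuples_at_def index_tuples_def)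
    then show ?thesis by (simp add: qpoch_def invq_def pochq_def)
  qed
  then have "(\<Prod>i\<in>{1..<k}. qpoch q q (int (t i) - int (t (i + 1)))) = inverse (tuple_denom k t)"
    unfolding tuple_denom_def by (simp add: o_def flip: prod_inversef)
  then show ?thesis
    using assms by (simp add: series_term_def core_def mhalf_def tuples_at_def power_add divide_inverse mult_ac)
qed

theorem sum_series_term:
  assumes "1 \<le> a" "a \<le> k"
  shows "(\<Sum>t\<in>tuples_at k N. series_term k a q t) = eps k (int k - int a) N"
proof -
  have "(\<Sum>t\<in>tuples_at k N. series_term k a q t) =
    (\<Sum>t\<in>tuples_at k N. q ^ ((N + 1) * N div 2) * mhalf N * core k a t)"
    by (rule sum.cong[OF refl series_term_eq])
  then show ?thesis
    by (simp add: sum_core[OF assms] eps_def flip: sum_distrib_left)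
qed

end

subsection \<open>Summation over the number of peaks\<close>

lemma has_sum_int_split:
  fixes f :: "int \<Rightarrow> 'a :: {topological_ab_group_add, t2_space}"
  assumes "((\<lambda>n. f (int n)) has_sum a) UNIV" "((\<lambda>n. f (- 1 - int n)) has_sum b) UNIV"
  shows "(f has_sum (a + b)) UNIV"
proof -
  have "((\<lambda>n. f (int n)) has_sum a) UNIV \<longleftrightarrow> (f has_sum a) {0..}"
    by (rule has_sum_reindex_bij_witness[of _ nat int]) auto
  moreover have "((\<lambda>n. f (- 1 - int n)) has_sum b) UNIV \<longleftrightarrow> (f has_sum b) {..<0}"
    by (rule has_sum_reindex_bij_witness[of _ "\<lambda>n. nat (- 1 - n)" "\<lambda>n. - 1 - int n"]) auto
  ultimately have "(f has_sum (a + b)) ({0..} \<union> {..<0})"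
    using assms by (intro has_sum_Un_disjoint) auto
  moreover have "{0..} \<union> {..<0} = (UNIV :: int set)" by auto
  ultimately show ?thesis by simp
qed

lemma summable_on_power_abs_int:
  fixes s :: real
  assumes "0 \<le> s" "s < 1"
  shows "(\<lambda>n::int. s ^ nat \<bar>n\<bar>) summable_on UNIV"
proof -
  have s: "summable (\<lambda>n. s ^ n)" using assms by (intro summable_geometric) auto
  have "((\<lambda>n. s ^ n) has_sum (\<Sum>n. s ^ n)) UNIV"
    using s assms by (intro sums_nonneg_imp_has_sum summable_sums) auto
  then have a: "((\<lambda>n. s ^ nat \<bar>int n\<bar>) has_sum (\<Sum>n. s ^ n)) UNIV" by simp
  have "((\<lambda>n. s ^ Suc n) has_sum (\<Sum>n. s ^ Suc n)) UNIV"
    using s assms by (intro sums_nonneg_imp_has_sum summable_sums) (auto simp: summable_mult)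
  moreover have "nat \<bar>- 1 - int n\<bar> = Suc n" for n by simp
  ultimately have b: "((\<lambda>n. s ^ nat \<bar>- 1 - int n\<bar>) has_sum (\<Sum>n. s ^ Suc n)) UNIV" by simp
  show ?thesis using has_sum_int_split[OF a b] by (rule has_sum_imp_summable)
qed

text \<open>Iterated sums alone do not give a joint sum. The majorant is nonnegative, so for it they
  do, and this supplies the absolute convergence of f.\<close>

lemma has_sum_Sigma_majorant:
  fixes f :: "'a \<times> 'b \<Rightarrow> complex" and F :: "'a \<times> 'b \<Rightarrow> real"
  assumes f: "\<And>x. x \<in> A \<Longrightarrow> ((\<lambda>y. f (x, y)) has_sum g x) (B x)" and S: "(g has_sum S) A"
    and F: "\<And>x. x \<in> A \<Longrightarrow> ((\<lambda>y. F (x, y)) has_sum G x) (B x)" and G: "G summable_on A"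
    and le: "\<And>x y. x \<in> A \<Longrightarrow> y \<in> B x \<Longrightarrow> norm (f (x, y)) \<le> F (x, y)"
  shows "(f has_sum S) (Sigma A B)"
proof -
  have "F summable_on Sigma A B"
    using F G le by (intro summable_on_SigmaI[where g = G]) (auto intro: order_trans[OF norm_ge_zero])
  then have "(\<lambda>z. norm (f z)) summable_on Sigma A B"
    by (rule Infinite_Sum.abs_summable_on_comparison_test') (use le in auto)
  then have "f summable_on Sigma A B"
    by (rule abs_summable_summable)
  with f S show ?thesis by (intro has_sum_SigmaI) auto
qed

lemma abs_le_square_int: "\<bar>n\<bar> \<le> n\<^sup>2" for n :: int
proof -
  have "\<bar>n\<bar> * 1 \<le> \<bar>n\<bar> * \<bar>n\<bar>"
    by (cases "n = 0") (auto intro!: mult_left_mono simp del: mult_1_right abs_mult_self_eq)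
  then show ?thesis by (simp add: power2_eq_square)
qed

context nome
begin

section \<open>Evaluation of the sum over N\<close>

lemma norm_powi_le_1: "e \<ge> 0 \<Longrightarrow> norm (q powi e) \<le> 1"
  using norm_q_power_le[of "nat e"] by (simp add: power_int_def)

lemma norm_m1_powi [simp]: "norm ((- 1 :: complex) powi n) = 1"
  by (simp add: norm_power_int)

text \<open>Twice the exponent is (2k - 1) n^2 + (2h + 1) n, and |2h + 1| <= 2k - 1 on this range of
  heights.\<close>

lemma norm_tau_le:
  assumes "- k \<le> h" "h \<le> k - 1"
  shows "norm (tau k h n) \<le> 1"
proof -
  have "\<bar>(2 * h + 1) * n\<bar> \<le> (2 * k - 1) * \<bar>n\<bar>"
    unfolding abs_mult using assms by (intro mult_right_mono) auto
  also have "\<dots> \<le> (2 * k - 1) * n\<^sup>2"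
    using assms by (intro mult_left_mono abs_le_square_int) auto
  finally have "0 \<le> (2 * k - 1) * n\<^sup>2 + (2 * h + 1) * n" by linarith
  also have "\<dots> = 2 * (k * n\<^sup>2 + h * n - n * (n - 1) div 2)"
    unfolding right_diff_distrib[of 2] two_tri by (simp add: algebra_simps power2_eq_square)
  finally have "0 \<le> k * n\<^sup>2 + h * n - n * (n - 1) div 2" by simp
  then show ?thesis
    unfolding tau_def norm_mult by (simp add: norm_powi_le_1)
qed

definition gauss :: "nat \<Rightarrow> complex" where
  "gauss N = q ^ ((N + 1) * N div 2) * mhalf N"

lemma gauss_rec: "gauss (Suc N) = q ^ Suc N * (1 + q ^ N) * gauss N"
proof -
  have "(Suc N + 1) * Suc N div 2 = Suc N + (N + 1) * N div 2"
    using tri_Suc[of "Suc N"] by (simp add: algebra_simps)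
  then show ?thesis by (simp add: gauss_def mhalf_rec power_add algebra_simps)
qed

lemma gauss_bounded: obtains C where "C \<ge> 1" "\<And>N. norm (gauss N) \<le> C * norm q ^ N"
proof -
  obtain C where C: "C \<ge> 1" "\<And>n. norm (pochm n) \<le> C" using poch_bounded by metis
  have "norm (mhalf N) \<le> C" for N
    using C by (cases N) (auto simp: mhalf_0 mhalf_Suc)
  moreover have "norm (q ^ ((N + 1) * N div 2)) \<le> norm q ^ N" for N
  proof -
    have "N * 2 \<le> (N + 1) * N" by (cases N) auto
    then have "N \<le> (N + 1) * N div 2" by linarith
    then show ?thesis using q_lt by (simp only: norm_power) (intro power_decreasing, auto)
  qed
  ultimately have "norm (gauss N) \<le> norm q ^ N * C" for N
    unfolding gauss_def norm_mult by (intro mult_mono) auto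
  then show ?thesis using C by (intro that[of C]) (auto simp: mult.commute)
qed

definition bailey_term :: "int \<Rightarrow> nat \<Rightarrow> complex" where
  "bailey_term n N = gauss N * invq (int N - n) * invq (int N + n)"

lemma gauss_invq_bounded:
  obtains C where "C \<ge> 1" "\<And>N i j. norm (gauss N * invq i * invq j) \<le> C * norm q ^ N"
proof -
  obtain C where C: "C \<ge> 1" "\<And>N. norm (gauss N) \<le> C * norm q ^ N" using gauss_bounded by metis
  obtain D where D: "D \<ge> 1" "\<And>j. norm (invq j) \<le> D" using invq_bounded by metis
  have "norm (gauss N * invq i * invq j) \<le> (C * norm q ^ N * D) * D" for N i j
    unfolding norm_mult using C D by (intro mult_mono mult_nonneg_nonneg) (auto intro: order_trans[OF norm_ge_zero])
  moreover have "1 \<le> C * D * D"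
    using C(1) D(1) by (simp add: one_le_mult_iff mult_ge1_I)
  ultimately show ?thesis by (intro that[of "C * D * D"]) (auto simp: mult_ac)
qed

lemma summable_norm_bailey_term: "summable (\<lambda>N. norm (bailey_term n N))"
proof -
  obtain C where C: "\<And>N i j. norm (gauss N * invq i * invq j) \<le> C * norm q ^ N"
    using gauss_invq_bounded by metis
  show ?thesis
  proof (rule summable_comparison_test')
    show "summable (\<lambda>N. C * norm q ^ N)" using q_lt by (intro summable_mult summable_geometric) auto
    show "norm (norm (bailey_term n N)) \<le> C * norm q ^ N" for N using C by (simp add: bailey_term_def)
  qed
qed

definition bailey_sum :: "int \<Rightarrow> complex" where
  "bailey_sum n = (\<Sum>N. bailey_term n N)"

lemma bailey_term_sums: "bailey_term n sums bailey_sum n"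
  unfolding bailey_sum_def by (rule summable_sums[OF summable_norm_cancel[OF summable_norm_bailey_term]])

lemma bailey_sum_minus: "bailey_sum (- n) = bailey_sum n"
  unfolding bailey_sum_def bailey_term_def by (simp add: mult.assoc mult.commute mult.left_commute)

lemma bailey_sum_rec: "q ^ Suc m * (1 + q ^ m) * bailey_sum (int m) = (1 + q ^ Suc m) * bailey_sum (int (Suc m))"
proof -
  \<comment> \<open>the certificate that makes the recurrence in \<open>m\<close> telescope in \<open>N\<close>\<close>
  define R where "R = (\<lambda>N. gauss N * invq (int N - int m - 1) * invq (int N + int m))"
  obtain C where C: "\<And>N i j. norm (gauss N * invq i * invq j) \<le> C * norm q ^ N"
    using gauss_invq_bounded by metis
  have "R \<longlonglongrightarrow> 0"
  proof (rule Lim_null_comparison)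
    show "eventually (\<lambda>N. norm (R N) \<le> C * norm q ^ N) sequentially"
      using C by (simp add: R_def)
    show "(\<lambda>N. C * norm q ^ N) \<longlonglongrightarrow> 0"
      using q_lt by (intro tendsto_mult_right_zero LIMSEQ_power_zero) auto
  qed
  then have "(\<lambda>N. R (Suc N) - R N) sums (0 - R 0)" by (rule telescope_sums)
  moreover have "R 0 = 0" by (simp add: R_def)
  ultimately have "(\<lambda>N. (1 - q * (q ^ m)\<^sup>2) * (R (Suc N) - R N)) sums ((1 - q * (q ^ m)\<^sup>2) * 0)"
    by (intro sums_mult) simp
  moreover have "(1 - q * (q ^ m)\<^sup>2) * (R (Suc N) - R N) =
     q ^ Suc m * (1 + q ^ m) * bailey_term (int m) N - (1 + q ^ Suc m) * bailey_term (int (Suc m)) N" for N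
  proof -
    let ?F = "gauss N * invq (int N - int m) * invq (int N + int m + 1)"
    \<comment> \<open>After extracting the common factor \<open>?F\<close>, the telescoping claim is
      the identity \<open>key\<close> between rational functions of q, y and z.\<close>
    define y z where "y = q ^ N" and "z = q ^ m"
    have z: "z \<noteq> 0" using q_nz by (simp add: z_def)
    have 1: "invq (int N - int m - 1) = (1 - y / z) * invq (int N - int m)"
      using invq_rec[of "int N - int m"] q_nz by (simp add: power_int_diff y_def z_def)
    have 2: "invq (int N + int m) = (1 - q * y * z) * invq (int N + int m + 1)"
      using invq_rec[of "int N + int m + 1"] q_nz by (simp add: power_int_add y_def z_def mult_ac)
    have R: "R N = (1 - y / z) * (1 - q * y * z) * ?F"
      unfolding R_def 1 2 by (simp add: algebra_simps)
    have R': "R (Suc N) = q * y * (1 + y) * ?F"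
      unfolding R_def gauss_rec by (simp add: y_def algebra_simps)
    have t: "bailey_term (int m) N = (1 - q * y * z) * ?F"
      unfolding bailey_term_def 2 by (simp add: algebra_simps)
    have "int N - int (Suc m) = int N - int m - 1" "int N + int (Suc m) = int N + int m + 1" by auto
    then have t': "bailey_term (int (Suc m)) N = (1 - y / z) * ?F"
      unfolding bailey_term_def by (simp only: 1 mult_ac)
    have key: "(1 - q * z\<^sup>2) * (q * y * (1 + y) - (1 - y / z) * (1 - q * y * z)) =
       q * z * (1 + z) * (1 - q * y * z) - (1 + q * z) * (1 - y / z)"
      using z by (simp add: field_simps power2_eq_square)
    have "(1 - q * z\<^sup>2) * (q * y * (1 + y) * F - (1 - y / z) * (1 - q * y * z) * F) =
       q * z * (1 + z) * ((1 - q * y * z) * F) - (1 + q * z) * ((1 - y / z) * F)" for F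
    proof -
      have "(1 - q * z\<^sup>2) * (q * y * (1 + y) * F - (1 - y / z) * (1 - q * y * z) * F) =
        (1 - q * z\<^sup>2) * (q * y * (1 + y) - (1 - y / z) * (1 - q * y * z)) * F"
        by (subst left_diff_distrib[of _ _ F, symmetric]) (simp only: mult.assoc)
      also have "\<dots> = q * z * (1 + z) * ((1 - q * y * z) * F) - (1 + q * z) * ((1 - y / z) * F)"
        unfolding key by (simp only: left_diff_distrib[of _ _ F] mult.assoc)
      finally show ?thesis .
    qed
    then show ?thesis
      unfolding R R' t t' power_Suc z_def[symmetric] .
  qed
  ultimately have "(\<lambda>N. q ^ Suc m * (1 + q ^ m) * bailey_term (int m) N - (1 + q ^ Suc m) * bailey_term (int (Suc m)) N) sums 0"
    by simp
  moreover have "(\<lambda>N. q ^ Suc m * (1 + q ^ m) * bailey_term (int m) N - (1 + q ^ Suc m) * bailey_term (int (Suc m)) N)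
     sums (q ^ Suc m * (1 + q ^ m) * bailey_sum (int m) - (1 + q ^ Suc m) * bailey_sum (int (Suc m)))"
    by (intro sums_diff sums_mult bailey_term_sums)
  ultimately show ?thesis using sums_unique2 by fastforce
qed

text \<open>The recurrence in m determines \<open>bailey_sum\<close> up to its value at 0. The
  factor 2 compensates the denominator 1 + q^0.\<close>

definition bailey_const :: complex where
  "bailey_const = 2 * bailey_sum 0"

lemma bailey_sum_of_nat: "bailey_sum (int m) = bailey_const * q ^ (m * (m + 1) div 2) / (1 + q ^ m)"
proof (induction m)
  case (Suc m)
  have "Suc m * (Suc m + 1) div 2 = m * (m + 1) div 2 + Suc m"
    using tri_Suc[of "Suc m"] by (simp add: algebra_simps)
  then have "q ^ (Suc m * (Suc m + 1) div 2) = q ^ (m * (m + 1) div 2) * q ^ Suc m"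
    by (simp only: power_add)
  moreover have IH: "(1 + q ^ m) * bailey_sum (int m) = bailey_const * q ^ (m * (m + 1) div 2)"
    using Suc one_plus_q_nz[of m] by simp
  have "(1 + q ^ Suc m) * bailey_sum (int (Suc m)) = q ^ Suc m * ((1 + q ^ m) * bailey_sum (int m))"
    using bailey_sum_rec[of m] by (simp only: mult.assoc)
  ultimately have "bailey_const * q ^ (Suc m * (Suc m + 1) div 2) = (1 + q ^ Suc m) * bailey_sum (int (Suc m))"
    unfolding IH by (simp only: mult_ac)
  then show ?case using one_plus_q_nz[of "Suc m"] by (metis nonzero_mult_div_cancel_left)
qed (simp add: bailey_const_def)

lemma bailey_sum_eq: "bailey_sum n = bailey_const * q powi (n * (n - 1) div 2 + n) / (1 + q powi n)"
proof (cases "n \<ge> 0")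
  case True
  then obtain m where n: "n = int m" using nonneg_int_cases by blast
  have "n * (n - 1) div 2 + n = int (m * (m + 1) div 2)"
  proof -
    have "n * (n - 1) div 2 + n = n * (n + 1) div 2"
      using two_tri[of n] two_tri[of "n + 1"] by (simp add: algebra_simps)
    also have "\<dots> = int (m * (m + 1)) div 2" by (simp add: n algebra_simps)
    finally show ?thesis by (simp only: zdiv_int of_nat_numeral)
  qed
  then have "q powi (n * (n - 1) div 2 + n) = q ^ (m * (m + 1) div 2)"
    by (metis power_int_of_nat)
  then show ?thesis using bailey_sum_of_nat[of m] by (simp add: n)
next
  case False
  then obtain m where n: "n = - int m"
    by (metis le_cases neg_0_le_iff_le nonneg_int_cases minus_minus)
  have "n * (n - 1) div 2 = int (m * (m + 1) div 2)"
  proof -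
    have "n * (n - 1) = int (m * (m + 1))" by (simp add: n algebra_simps)
    then show ?thesis by (simp only: zdiv_int of_nat_numeral)
  qed
  then have "q powi (n * (n - 1) div 2 + n) = q ^ (m * (m + 1) div 2) / q ^ m"
    using q_nz by (simp only: power_int_add[OF disjI1[OF q_nz]] power_int_of_nat) (simp add: n power_int_minus divide_inverse)
  then show ?thesis using bailey_sum_of_nat[of m] bailey_sum_minus[of "int m"] q_nz
    by (simp add: n power_int_minus field_simps)
qed

definition theta :: "int \<Rightarrow> int \<Rightarrow> int \<Rightarrow> complex" where
  "theta k h n = (- 1) powi n * q powi (k * n\<^sup>2 + h * n)"

text \<open>The two neighbouring heights contribute 1 + q^(-n), which cancels the denominator 1 +
  q^n up to q^(-n). The remaining triangular power removes the half-integers from the exponent of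
  \<open>tau\<close>.\<close>

lemma tau_bailey_sum: "(tau k h n + tau k (h - 1) n) * bailey_sum n = bailey_const * theta k h n"
proof -
  have 1: "tau k (h - 1) n = tau k h n / q powi n"
    using tau_add[of k h "- 1" n] q_nz by (simp add: power_int_minus divide_inverse)
  have 2: "tau k h n * q powi (n * (n - 1) div 2) = theta k h n"
  proof -
    have "q powi (k * n\<^sup>2 + h * n) = q powi (k * n\<^sup>2 + h * n - n * (n - 1) div 2) * q powi (n * (n - 1) div 2)"
      using q_nz by (subst power_int_add[symmetric]) auto
    then show ?thesis unfolding tau_def theta_def by simp
  qed
  have "(tau k h n + tau k (h - 1) n) * bailey_sum n = bailey_const * (tau k h n * q powi (n * (n - 1) div 2))"
    unfolding 1 bailey_sum_eq using q_nz one_plus_q_powi_nz[of n]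
    by (simp add: power_int_add divide_simps) (simp add: algebra_simps)
  then show ?thesis unfolding 2 .
qed

text \<open>One absolutely convergent double sum read in two orders: summing over n first gives
  \<open>eps\<close>, summing over N first gives the theta terms.\<close>

lemma sum_eps_exists:
  assumes "0 \<le> h" "h < int k"
  shows "\<exists>X. (eps k h has_sum X) UNIV \<and> ((\<lambda>n. bailey_const * theta (int k) h n) has_sum X) UNIV"
proof -
  \<comment> \<open>A summand is nonzero only for |n| <= N. There |q|^N = s^N s^N <= s^N s^|n|, so
    half of the decay in N is traded for decay in n.\<close>
  define s where "s = sqrt (norm q)"
  have s: "0 < s" "s < 1" "s * s = norm q" using q_lt q_nz by (auto simp: s_def)
  define u where "u = (\<lambda>(N, n). (tau (int k) h n + tau (int k) (h - 1) n) * bailey_term n N)"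
  obtain C where C: "C \<ge> 1" "\<And>N i j. norm (gauss N * invq i * invq j) \<le> C * norm q ^ N"
    using gauss_invq_bounded by metis
  have bound: "norm (u (N, n)) \<le> 2 * C * s ^ N * s ^ nat \<bar>n\<bar>" for N n
  proof (cases "\<bar>n\<bar> \<le> int N")
    case True
    have "norm (tau (int k) h n + tau (int k) (h - 1) n) \<le> 2"
      using norm_tau_le[of "int k" h n] norm_tau_le[of "int k" "h - 1" n] assms
      by (intro order_trans[OF norm_triangle_ineq]) auto
    then have "norm (u (N, n)) \<le> 2 * (C * norm q ^ N)"
      unfolding u_def case_prod_conv norm_mult[of "_ + _"] bailey_term_def using C by (intro mult_mono) auto
    also have "norm q ^ N = s ^ N * s ^ N" by (simp flip: s(3) add: power_mult_distrib)
    also have "s ^ N \<le> s ^ nat \<bar>n\<bar>" using s True by (intro power_decreasing) auto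
    then have "2 * (C * (s ^ N * s ^ N)) \<le> 2 * (C * (s ^ N * s ^ nat \<bar>n\<bar>))"
      using C s by (intro mult_left_mono) auto
    finally show ?thesis by (simp add: mult_ac)
  next
    case False
    then have "int N - n < 0 \<or> int N + n < 0" by auto
    then have "u (N, n) = 0" by (auto simp: u_def bailey_term_def)
    then show ?thesis using C s by simp
  qed
  obtain G where G: "((\<lambda>n::int. s ^ nat \<bar>n\<bar>) has_sum G) UNIV"
    using summable_on_power_abs_int[of s] s by (auto simp: summable_on_def)
  have "0 \<le> G" by (rule has_sum_nonneg[OF G]) (use s in auto)
  have "(\<lambda>(N, n). 2 * C * s ^ N * s ^ nat \<bar>n\<bar>) summable_on (UNIV :: nat set) \<times> (UNIV :: int set)"
  proof (rule summable_on_SigmaI)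
    show "((\<lambda>n. (\<lambda>(N, n). 2 * C * s ^ N * s ^ nat \<bar>n\<bar>) (N, n)) has_sum 2 * C * s ^ N * G) UNIV" for N
      using has_sum_cmult_right[OF G, of "2 * C * s ^ N"] by simp
    have "summable (\<lambda>N. 2 * C * s ^ N * G)"
      using s by (intro summable_mult summable_mult2 summable_geometric) auto
    then show "(\<lambda>N. 2 * C * s ^ N * G) summable_on UNIV"
      using C s \<open>0 \<le> G\<close> by (intro summable_nonneg_imp_summable_on) auto
    show "0 \<le> (case (N, n) of (N, n) \<Rightarrow> 2 * C * s ^ N * s ^ nat \<bar>n\<bar>)" for N and n :: int
      using C s by simp
  qed
  then have "(\<lambda>z. norm (u z)) summable_on UNIV \<times> UNIV"
    by (rule Infinite_Sum.abs_summable_on_comparison_test') (use bound in auto)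
  then have "u summable_on UNIV \<times> UNIV"
    by (rule abs_summable_summable)
  then obtain X where X: "(u has_sum X) (UNIV \<times> UNIV)" by (auto simp: summable_on_def)
  have "((\<lambda>n. u (N, n)) has_sum eps k h N) UNIV" for N
  proof (rule has_sum_finite_neutralI)
    show "finite {- int N..int N}" by simp
    show "u (N, n) = 0" if "n \<in> UNIV - {- int N..int N}" for n
      using that by (auto simp: u_def bailey_term_def)
    show "eps k h N = (\<Sum>n\<in>{- int N..int N}. u (N, n))"
      by (simp add: eps_def W_def u_def bailey_term_def gauss_def sum_distrib_left distrib_left
          distrib_right sum.distrib mult_ac)
  qed auto
  then have "(eps k h has_sum X) UNIV" using X by (intro has_sum_Sigma'[OF X]) auto
  moreover have "((\<lambda>n. bailey_const * theta (int k) h n) has_sum X) UNIV"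
  proof (rule has_sum_Sigma')
    show "((\<lambda>(x, y). u (y, x)) has_sum X) (UNIV \<times> UNIV)" using X by (rule has_sum_swap[THEN iffD1])
    have "((\<lambda>N. bailey_term n N) has_sum bailey_sum n) UNIV" for n
      by (rule norm_summable_imp_has_sum[OF summable_norm_bailey_term bailey_term_sums])
    then show "((\<lambda>N. case (n, N) of (x, y) \<Rightarrow> u (y, x)) has_sum bailey_const * theta (int k) h n) UNIV" for n
      unfolding tau_bailey_sum[symmetric] u_def case_prod_conv by (intro has_sum_cmult_right)
  qed
  ultimately show ?thesis by blast
qed

lemma eps_1: "eps 1 0 N = (if N = 0 then 1 else 0)"
  using W_1[of N] W_minus_1[of 1 N] by (simp add: eps_def mhalf_0)

lemma bailey_const_theta: "((\<lambda>n. bailey_const * theta 1 0 n) has_sum 1) UNIV"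
proof -
  obtain X where X: "(eps 1 0 has_sum X) UNIV" "((\<lambda>n. bailey_const * theta 1 0 n) has_sum X) UNIV"
    using sum_eps_exists[of 0 1] by auto
  have "(eps 1 0 has_sum 1) UNIV"
    by (rule has_sum_finite_neutralI[of "{0}"]) (auto simp: eps_1[simplified])
  with X show ?thesis using has_sum_unique by blast
qed

lemma bailey_const_nz: "bailey_const \<noteq> 0"
proof
  assume "bailey_const = 0"
  with bailey_const_theta have "((\<lambda>_::int. 0 :: complex) has_sum 1) UNIV" by simp
  then have "(1 :: complex) = 0" using has_sum_0_simp by (rule has_sum_unique)
  then show False by simp
qed

definition thetas :: "int \<Rightarrow> int \<Rightarrow> complex" where
  "thetas k h = infsum (theta k h) UNIV"

theorem sum_eps:
  assumes "0 \<le> h" "h < int k"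
  shows "(eps k h has_sum bailey_const * thetas (int k) h) UNIV" "(theta (int k) h has_sum thetas (int k) h) UNIV"
proof -
  obtain X where X: "(eps k h has_sum X) UNIV" "((\<lambda>n. bailey_const * theta (int k) h n) has_sum X) UNIV"
    using sum_eps_exists[OF assms] by auto
  from has_sum_cmult_right[OF X(2), of "inverse bailey_const"]
  have "(theta (int k) h has_sum X / bailey_const) UNIV"
    using bailey_const_nz by (simp add: field_simps)
  moreover from this have "thetas (int k) h = X / bailey_const" by (simp add: thetas_def infsumI)
  ultimately show "(eps k h has_sum bailey_const * thetas (int k) h) UNIV" "(theta (int k) h has_sum thetas (int k) h) UNIV"
    using X bailey_const_nz by simp_all
qed

lemma bailey_const_thetas: "bailey_const * thetas 1 0 = 1"
proof -
  have "(theta 1 0 has_sum thetas 1 0) UNIV" using sum_eps(2)[of 0 1] by simp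
  from has_sum_cmult_right[OF this, of bailey_const] bailey_const_theta show ?thesis by (rule has_sum_unique)
qed

end

subsection \<open>The Jacobi triple product\<close>

context nome
begin

definition jterm :: "complex \<Rightarrow> int \<Rightarrow> complex" where
  "jterm x l = (- x) powi l * q powi (l * (l - 1) div 2)"

text \<open>Finite form of the triple product. Its two lengths are independent, so that the factors
  in x and in q/x can be added one at a time.\<close>

definition jfin :: "complex \<Rightarrow> nat \<Rightarrow> nat \<Rightarrow> complex" where
  "jfin x a b = (\<Sum>l\<in>{- int a..int b}. jterm x l * invq (int a + l) * invq (int b - l))"

lemma jfin_eq:
  assumes "finite A" "{- int a..int b} \<subseteq> A"
  shows "jfin x a b = (\<Sum>l\<in>A. jterm x l * invq (int a + l) * invq (int b - l))"
  unfolding jfin_def using assms by (intro sum.mono_neutral_left) auto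

lemma jterm_Suc:
  assumes "x \<noteq> 0"
  shows "jterm x (l + 1) = - x * q powi l * jterm x l"
proof -
  have "(l + 1) * (l + 1 - 1) div 2 = l + l * (l - 1) div 2"
    using two_tri[of l] two_tri[of "l + 1"] by (simp add: algebra_simps)
  then show ?thesis
    unfolding jterm_def using assms q_nz by (simp add: power_int_add)
qed

text \<open>The weight splits as (1 - q^(b+1-l)) + q^(b+1-l) (1 - q^(a+l)). Each part lowers one
  \<open>invq\<close>, and shifting l by one in the second part brings out the factor -x
  q^b.\<close>

lemma jfin_Suc_right:
  assumes "x \<noteq> 0"
  shows "(1 - q ^ (a + Suc b)) * jfin x a (Suc b) = (1 - x * q ^ b) * jfin x a b"
proof -
  let ?A = "{- int a..int (Suc b)}"
  let ?f = "\<lambda>l. jterm x l * invq (int a + l) * invq (int b - l)"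
  let ?g = "\<lambda>l. q powi (int (Suc b) - l) * jterm x l * invq (int a + l - 1) * invq (int (Suc b) - l)"
  have "(1 - q ^ (a + Suc b)) * jfin x a (Suc b) = (\<Sum>l\<in>?A. ?f l + ?g l)"
    unfolding jfin_def sum_distrib_left
  proof (rule sum.cong[OF refl])
    fix l
    have "int (Suc b) - l - 1 = int b - l" by simp
    then have 1: "invq (int b - l) = (1 - q powi (int (Suc b) - l)) * invq (int (Suc b) - l)"
      using invq_rec[of "int (Suc b) - l"] by simp
    have 2: "invq (int a + l - 1) = (1 - q powi (int a + l)) * invq (int a + l)"
      using invq_rec[of "int a + l"] by simp
    have "q ^ (a + Suc b) = q powi int (a + Suc b)" by (rule power_int_of_nat[symmetric])
    also have "int (a + Suc b) = (int (Suc b) - l) + (int a + l)" by simp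
    finally have 3: "q ^ (a + Suc b) = q powi (int (Suc b) - l) * q powi (int a + l)"
      using q_nz by (simp only: power_int_add[OF disjI1[OF q_nz]])
    show "(1 - q ^ (a + Suc b)) * (jterm x l * invq (int a + l) * invq (int (Suc b) - l)) = ?f l + ?g l"
      unfolding 1 2 3 by (simp only: algebra_simps mult_1_left)
  qed
  also have "\<dots> = (\<Sum>l\<in>?A. ?f l) + (\<Sum>l\<in>?A. ?g l)" by (rule sum.distrib)
  also have "(\<Sum>l\<in>?A. ?f l) = jfin x a b" by (rule jfin_eq[symmetric]) auto
  also have "(\<Sum>l\<in>?A. ?g l) = (\<Sum>l\<in>{- int a - 1..int b}. - x * q ^ b * ?f l)"
  proof (rule sum.reindex_bij_witness_not_neutral[of "{- int a}" "{- int a - 1}" _ "\<lambda>l. l + 1" "\<lambda>l. l - 1"])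
    fix l assume "l \<in> ?A"
    have e: "q ^ b = q powi (int b - (l - 1)) * q powi (l - 1)"
      using power_int_add[OF disjI1[OF q_nz], of "int b - (l - 1)" "l - 1"] by simp
    show "- x * q ^ b * (jterm x (l - 1) * invq (int a + (l - 1)) * invq (int b - (l - 1))) = ?g l"
      using jterm_Suc[OF assms, of "l - 1"] unfolding e by (simp add: algebra_simps)
  qed auto
  also have "\<dots> = - x * q ^ b * jfin x a b"
    unfolding sum_distrib_left[symmetric] by (subst jfin_eq[of "{- int a - 1..int b}" a b x]) auto
  finally show ?thesis by (simp add: algebra_simps)
qed

lemma jterm_reflect:
  assumes "x \<noteq> 0"
  shows "jterm (q / x) (- l) = jterm x l"
proof -
  have "(- l) * (- l - 1) div 2 = l + l * (l - 1) div 2"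
    using two_tri[of l] two_tri[of "- l"] by (simp add: algebra_simps)
  then have "jterm (q / x) (- l) = (- (q / x)) powi (- l) * q powi (l + l * (l - 1) div 2)"
    by (simp only: jterm_def)
  also have "\<dots> = jterm x l"
  proof -
    have "(- (q / x)) powi (- l) = (- x) powi l / q powi l"
      using power_int_divide_distrib[of q "- x" "- l"] q_nz assms
      by (simp add: power_int_minus divide_inverse mult.commute)
    then show ?thesis
      unfolding jterm_def using q_nz by (simp add: power_int_add)
  qed
  finally show ?thesis .
qed

lemma jfin_reflect: "x \<noteq> 0 \<Longrightarrow> jfin (q / x) b a = jfin x a b"
  unfolding jfin_def
proof (rule sum.reindex_bij_witness[of _ uminus uminus])
  fix l :: int assume "x \<noteq> 0"
  then show "jterm x (- l) * invq (int a + - l) * invq (int b - - l)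
     = jterm (q / x) l * invq (int b + l) * invq (int a - l)"
    using jterm_reflect[of x "- l"] by (simp add: mult_ac)
qed auto

lemma jfin_Suc_left:
  assumes "x \<noteq> 0"
  shows "(1 - q ^ (Suc a + b)) * jfin x (Suc a) b = (1 - q / x * q ^ a) * jfin x a b"
  using jfin_Suc_right[of "q / x" b a] assms q_nz by (simp add: jfin_reflect add.commute)

lemma jfin_product:
  assumes "x \<noteq> 0"
  shows "jfin x a b = (\<Prod>i<b. 1 - x * q ^ i) * (\<Prod>i<a. 1 - q / x * q ^ i) / pochq (a + b)"
proof -
  have 0: "jfin x 0 b = (\<Prod>i<b. 1 - x * q ^ i) / pochq b" for b
  proof (induction b)
    case 0
    then show ?case by (simp add: jfin_def jterm_def)
  next
    case (Suc b)
    have "jfin x 0 (Suc b) = (1 - x * q ^ b) * jfin x 0 b / (1 - q ^ Suc b)"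
      using jfin_Suc_right[OF assms, of 0 b] one_minus_q_nz[of "Suc b"]
      by (simp add: eq_divide_eq mult.commute del: power_Suc)
    then show ?case
      by (simp add: Suc pochq_Suc mult_ac)
  qed
  show ?thesis
  proof (induction a)
    case (Suc a)
    have "jfin x (Suc a) b = (1 - q / x * q ^ a) * jfin x a b / (1 - q ^ Suc (a + b))"
      using jfin_Suc_left[OF assms, of a b] one_minus_q_nz[of "Suc (a + b)"]
      by (simp add: eq_divide_eq mult.commute del: power_Suc)
    then show ?case
      by (simp add: Suc pochq_Suc mult_ac)
  qed (simp add: 0)
qed

theorem jacobi_triple_product:
  assumes x: "x \<noteq> 0" and T: "(jterm x has_sum T) UNIV"
  shows "T = qpoch_inf x q * qpoch_inf (q / x) q * qpoch_inf q q"
proof -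
  let ?P = "qpoch_inf q q"
  obtain C where C: "C \<ge> 1" "\<And>j. norm (invq j) \<le> C" using invq_bounded by metis
  \<comment> \<open>The dominated limit theorem is applied to sums over natural numbers, so the
    integers are enumerated.\<close>
  define a where "a = (\<lambda>j n. jterm x (int_decode j) * invq (int n + int_decode j) * invq (int n - int_decode j))"
  have bij: "bij_betw int_decode UNIV (UNIV :: int set)" by (rule bij_int_decode)
  have T': "((\<lambda>j. jterm x (int_decode j)) has_sum T) UNIV"
    using has_sum_reindex_bij_betw[OF bij, of "jterm x" T] T by simp
  then have sums: "(\<lambda>j. jterm x (int_decode j)) sums T" by (rule has_sum_imp_sums)
  have summable: "summable (\<lambda>j. norm (jterm x (int_decode j)))"
  proof -
    have "(\<lambda>j. norm (jterm x (int_decode j))) summable_on UNIV"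
      using T' by (metis has_sum_imp_summable summable_on_iff_abs_summable_on_complex)
    then show ?thesis by (rule summable_on_imp_summable)
  qed
  have inv_lim: "(\<lambda>n. invq (int n + l)) \<longlonglongrightarrow> 1 / ?P" for l
  proof -
    have "(\<lambda>n. 1 / pochq n) \<longlonglongrightarrow> 1 / ?P"
      by (intro tendsto_intros pochq_LIMSEQ qpoch_inf_q_nz)
    then have "(\<lambda>n. invq (int n)) \<longlonglongrightarrow> 1 / ?P" by simp
    moreover have "filterlim (\<lambda>n. nat (int n + l)) at_top sequentially"
    proof (rule filterlim_at_top_mono)
      show "filterlim (\<lambda>n. n - nat \<bar>l\<bar>) at_top sequentially"
        by (rule filterlim_minus_const_nat_at_top)
      show "eventually (\<lambda>n. n - nat \<bar>l\<bar> \<le> nat (int n + l)) sequentially"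
        by (rule always_eventually) (auto simp: nat_le_iff le_nat_iff)
    qed
    ultimately have "(\<lambda>n. invq (int (nat (int n + l)))) \<longlonglongrightarrow> 1 / ?P"
      by (rule filterlim_compose)
    moreover have "eventually (\<lambda>n. invq (int (nat (int n + l))) = invq (int n + l)) sequentially"
      using eventually_ge_at_top[of "nat \<bar>l\<bar>"] by eventually_elim (simp del: invq_of_nat)
    ultimately show ?thesis by (rule Lim_transform_eventually)
  qed
  have lim: "(\<lambda>n. a j n) \<longlonglongrightarrow> jterm x (int_decode j) * (1 / ?P) * (1 / ?P)" for j
    unfolding a_def using inv_lim[of "- int_decode j"] by (intro tendsto_mult tendsto_const inv_lim) simp
  have bound: "norm (a j n) \<le> norm (jterm x (int_decode j)) * (C * C)" for j n
    unfolding a_def norm_mult mult.assoc using C by (intro mult_mono mult_nonneg_nonneg) auto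
  have "(\<lambda>n. \<Sum>j. a j n) \<longlonglongrightarrow> (\<Sum>j. jterm x (int_decode j) * (1 / ?P) * (1 / ?P))"
    using lim bound summable
    by (intro tannerys_theorem[where M = "\<lambda>j. norm (jterm x (int_decode j)) * (C * C)", THEN conjunct2, THEN conjunct2])
       (auto intro!: always_eventually summable_mult2)
  moreover have "(\<Sum>j. jterm x (int_decode j) * (1 / ?P) * (1 / ?P)) = T * (1 / ?P) * (1 / ?P)"
    by (intro sums_unique[symmetric] sums_mult2 sums)
  moreover have "(\<Sum>j. a j n) = jfin x n n" for n
  proof -
    have "((\<lambda>l. jterm x l * invq (int n + l) * invq (int n - l)) has_sum jfin x n n) UNIV"
      unfolding jfin_def by (rule has_sum_finite_neutralI[of "{- int n..int n}"]) auto
    then have "((\<lambda>j. a j n) has_sum jfin x n n) UNIV"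
      using has_sum_reindex_bij_betw[OF bij, of "\<lambda>l. jterm x l * invq (int n + l) * invq (int n - l)"]
      by (simp add: a_def)
    then show ?thesis using has_sum_imp_sums sums_unique by metis
  qed
  ultimately have 1: "(\<lambda>n. jfin x n n) \<longlonglongrightarrow> T * (1 / ?P) * (1 / ?P)" by simp
  have "(\<lambda>n. pochq (n + n)) \<longlonglongrightarrow> ?P"
    using LIMSEQ_subseq_LIMSEQ[OF pochq_LIMSEQ, of "\<lambda>n. n + n"] by (simp add: strict_mono_def o_def)
  then have 2: "(\<lambda>n. jfin x n n) \<longlonglongrightarrow> qpoch_inf x q * qpoch_inf (q / x) q / ?P"
    unfolding jfin_product[OF x]
    by (intro tendsto_divide tendsto_mult qpoch_inf_LIMSEQ q_lt qpoch_inf_q_nz)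
  show ?thesis
    using LIMSEQ_unique[OF 1 2] qpoch_inf_q_nz by (simp add: field_simps)
qed

theorem thetas_product:
  assumes "h < k"
  shows "thetas (int k) (int h) = qpoch_inf (q ^ (k - h)) (q ^ (2 * k)) * qpoch_inf (q ^ (k + h)) (q ^ (2 * k))
     * qpoch_inf (q ^ (2 * k)) (q ^ (2 * k))"
proof -
  interpret Q: nome "q ^ (2 * k)"
    using q_nz norm_q_power[of "2 * k"] assms by unfold_locales auto
  \<comment> \<open>For the nome q^(2k) the triangular exponent becomes k l (l - 1), and x = q^(k+h)
    supplies the remaining (k + h) l.\<close>
  have "Q.jterm (q ^ (k + h)) l = theta (int k) (int h) l" for l
  proof -
    have "int (2 * k) * (l * (l - 1) div 2) = int k * (2 * (l * (l - 1) div 2))" by simp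
    also have "\<dots> = int k * (l * (l - 1))" unfolding two_tri ..
    finally have "(q ^ (2 * k)) powi (l * (l - 1) div 2) = q powi (int k * (l * (l - 1)))"
      by (simp only: power_int_power)
    moreover have "(- (q ^ (k + h))) powi l = (- 1) powi l * q powi (int (k + h) * l)"
      using power_int_mult_distrib[of "- 1" "q ^ (k + h)" l] by (simp only: mult_minus1 power_int_power)
    moreover have "int k * l\<^sup>2 + int h * l = int (k + h) * l + int k * (l * (l - 1))"
      by (simp add: algebra_simps power2_eq_square)
    then have "q powi (int k * l\<^sup>2 + int h * l) = q powi (int (k + h) * l) * q powi (int k * (l * (l - 1)))"
      using q_nz by (simp only: power_int_add[OF disjI1[OF q_nz]])
    ultimately show ?thesis
      unfolding Q.jterm_def theta_def by (simp only: mult.assoc)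
  qed
  then have "Q.jterm (q ^ (k + h)) = theta (int k) (int h)" by auto
  then have "(Q.jterm (q ^ (k + h)) has_sum thetas (int k) (int h)) UNIV"
    using sum_eps(2)[of "int h" k] assms by simp
  moreover have "q ^ (2 * k) / q ^ (k + h) = q ^ (k - h)"
  proof -
    have "2 * k = (k - h) + (k + h)" using assms by simp
    then have "q ^ (2 * k) = q ^ (k - h) * q ^ (k + h)" by (metis power_add)
    then show ?thesis using q_nz by simp
  qed
  ultimately show ?thesis
    using Q.jacobi_triple_product[of "q ^ (k + h)"] q_nz by (simp add: mult_ac)
qed

end

subsection \<open>The recurrence for overpartitions\<close>

text \<open>If all values at level m + 1 are at most v, then building up i from 0 at level m gives
  at most (1 + 2 i r^(m+1)) v. The product of these factors over p levels is bounded by an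
  exponential.\<close>

lemma recurrence_growth:
  fixes d :: "nat \<Rightarrow> nat \<Rightarrow> real"
  assumes r: "0 \<le> r" "r < 1" and d0: "\<And>m. d 0 m = 0"
    and rec: "\<And>i m. i < k \<Longrightarrow>
      d (Suc i) m \<le> d i m + r ^ (Suc m * i) * (d (k - i) (Suc m) + r ^ Suc m * d (k - i - 1) (Suc m))"
    and u: "0 \<le> u" "\<And>i. i \<le> k \<Longrightarrow> d i (m + p) \<le> u"
  shows "i \<le> k \<Longrightarrow> d i m \<le> exp (2 * real k * (\<Sum>t<p. r ^ (m + t))) * u"
  using u(2)
proof (induction p arbitrary: m i)
  case 0
  then show ?case by simp
next
  case (Suc p)
  define v where "v = exp (2 * real k * (\<Sum>t<p. r ^ (Suc m + t))) * u"
  have v: "0 \<le> v" "\<And>i. i \<le> k \<Longrightarrow> d i (Suc m) \<le> v"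
    using u(1) Suc.IH[of _ "Suc m"] Suc.prems(2) by (auto simp: v_def)
  let ?x = "r ^ Suc m"
  have x: "0 \<le> ?x" "?x \<le> 1" using r by (auto simp: power_le_one mult_le_one simp del: power_Suc)
  have "i \<le> k \<Longrightarrow> d i m \<le> (1 + 2 * real i * ?x) * v" for i
  proof (induction i)
    case 0
    then show ?case using v d0 by simp
  next
    case (Suc i)
    then have i: "i < k" by simp
    have b: "d (k - i) (Suc m) + ?x * d (k - i - 1) (Suc m) \<le> v + ?x * v"
      using v x by (intro add_mono mult_left_mono) auto
    have dm: "d (Suc i) m \<le> d i m + r ^ (Suc m * i) * (v + ?x * v)"
      using rec[OF i, of m] mult_left_mono[OF b, of "r ^ (Suc m * i)"] r by simp
    show ?case
    \<comment> \<open>For i = 0 the coefficient of the next level is 1 and not small; as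
      \<open>d 0 m\<close> vanishes, this step supplies the leading v.\<close>
    proof (cases "i = 0")
      case True
      then have "d (Suc i) m \<le> v + ?x * v" using dm d0 by simp
      also have "\<dots> \<le> (1 + 2 * real (Suc i) * ?x) * v"
        using v x True by (simp add: algebra_simps del: power_Suc)
      finally show ?thesis .
    next
      case False
      have "Suc m * 1 \<le> Suc m * i" using False by (intro mult_le_mono2) simp
      then have "r ^ (Suc m * i) \<le> ?x" using r by (intro power_decreasing) simp_all
      then have "r ^ (Suc m * i) * (v + ?x * v) \<le> ?x * (v + ?x * v)"
        using v x by (intro mult_right_mono) auto
      also have "\<dots> \<le> ?x * (v + 1 * v)"
        using v x by (intro mult_left_mono add_left_mono mult_right_mono) auto
      finally have "r ^ (Suc m * i) * (v + ?x * v) \<le> 2 * ?x * v" by simp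
      with dm Suc i show ?thesis by (simp add: algebra_simps del: power_Suc)
    qed
  qed
  then have "d i m \<le> (1 + 2 * real i * ?x) * v" using Suc.prems by blast
  also have "\<dots> \<le> exp (2 * real k * r ^ m) * v"
  proof (rule mult_right_mono)
    have "2 * real i * ?x \<le> 2 * real k * r ^ m"
      using Suc.prems(1) r by (intro mult_mono power_decreasing) auto
    then show "1 + 2 * real i * ?x \<le> exp (2 * real k * r ^ m)"
      using exp_ge_add_one_self[of "2 * real k * r ^ m"] by linarith
  qed (rule v)
  also have "\<dots> = exp (2 * real k * (\<Sum>t<Suc p. r ^ (m + t))) * u"
    unfolding v_def by (subst sum.lessThan_Suc_shift) (simp add: exp_add distrib_left)
  finally show ?case .
qed

text \<open>The geometric series makes the bound independent of m and p. It serves twice: for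
  convergence, with p the truncation degree, and for uniqueness, with p tending to infinity.\<close>

corollary recurrence_growth_const:
  fixes d :: "nat \<Rightarrow> nat \<Rightarrow> real"
  assumes r: "0 \<le> r" "r < 1" and d0: "\<And>m. d 0 m = 0"
    and rec: "\<And>i m. i < k \<Longrightarrow>
      d (Suc i) m \<le> d i m + r ^ (Suc m * i) * (d (k - i) (Suc m) + r ^ Suc m * d (k - i - 1) (Suc m))"
    and u: "0 \<le> u" "\<And>i. i \<le> k \<Longrightarrow> d i (m + p) \<le> u" and i: "i \<le> k"
  shows "d i m \<le> exp (2 * real k * (1 / (1 - r))) * u"
proof -
  have "(\<Sum>t<p. r ^ (m + t)) \<le> (\<Sum>t<p. r ^ t)"
    using r by (intro sum_mono power_decreasing) auto
  also have "\<dots> \<le> 1 / (1 - r)"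
    using r sum_le_suminf[of "\<lambda>t. r ^ t" "{..<p}"] by (simp add: suminf_geometric)
  finally have "2 * real k * (\<Sum>t<p. r ^ (m + t)) \<le> 2 * real k * (1 / (1 - r))"
    by (intro mult_left_mono) auto
  then have "exp (2 * real k * (\<Sum>t<p. r ^ (m + t))) * u \<le> exp (2 * real k * (1 / (1 - r))) * u"
    using u(1) by (intro mult_right_mono) (simp_all only: exp_le_cancel_iff)
  moreover have "d i m \<le> exp (2 * real k * (\<Sum>t<p. r ^ (m + t))) * u"
    using recurrence_growth[of r d k u m p i] assms by blast
  ultimately show ?thesis by linarith
qed

lemma le_mult_square: "0 < k \<Longrightarrow> n \<le> k * n\<^sup>2" for k n :: nat
  using mult_le_mono[of 1 k n "n * n"] by (simp add: power2_eq_square)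

context nome
begin

lemma num_B_Suc_fun:
  "i < k \<Longrightarrow> num_B k (Suc i) m = (\<lambda>n. num_B k i m n + shift (Suc m * i) (num_B k (k - i) (Suc m)) n +
     shift (Suc m * i + Suc m) (num_B k (k - i - 1) (Suc m)) n)"
  using num_B_Suc[of i k m] by (auto simp: fun_eq_iff add.commute)

text \<open>Truncation at degree M turns the recurrence into an inequality with the same
  coefficients, so the growth bound holds uniformly in M.\<close>

lemma gf_num_B_exists:
  assumes k: "0 < k" and i: "i \<le> k"
  shows "\<exists>s. has_gf (num_B k i m) q s"
proof -
  let ?r = "norm q"
  define d where "d = (\<lambda>M i m. \<Sum>n<M. real (num_B k i m n) * ?r ^ n)"
  have "d M k 0 \<le> exp (2 * real k * (1 / (1 - ?r))) * 1" for M
  proof (rule recurrence_growth_const[where p = M])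
    show "d M 0 m = 0" for m by (simp add: d_def num_B_0)
    show "d M (Suc i) m \<le> d M i m + ?r ^ (Suc m * i) * (d M (k - i) (Suc m) + ?r ^ Suc m * d M (k - i - 1) (Suc m))"
      if "i < k" for i m
    proof -
      have "d M (Suc i) m = d M i m + (\<Sum>n<M. real (shift (Suc m * i) (num_B k (k - i) (Suc m)) n) * ?r ^ n) +
        (\<Sum>n<M. real (shift (Suc m * i + Suc m) (num_B k (k - i - 1) (Suc m)) n) * ?r ^ n)"
        unfolding d_def num_B_Suc_fun[OF that] by (simp add: distrib_right sum.distrib)
      also have "\<dots> \<le> d M i m + ?r ^ (Suc m * i) * d M (k - i) (Suc m) + ?r ^ (Suc m * i + Suc m) * d M (k - i - 1) (Suc m)"
        unfolding d_def by (intro add_mono sum_shift_le) auto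
      finally show ?thesis by (simp only: power_add distrib_left mult.assoc add.assoc)
    qed
    \<comment> \<open>At level M all parts exceed M, so below degree M only the empty multiset is
      counted.\<close>
    show "d M i (0 + M) \<le> 1" if "i \<le> k" for i
    proof (cases "i = 0")
      case False
      have "d M i M = (\<Sum>n<M. if n = 0 then 1 else 0)"
        unfolding d_def using False k by (intro sum.cong refl) (auto simp: num_B_top)
      then show ?thesis by simp
    qed (simp add: d_def num_B_0)
  qed (use q_lt in auto)
  moreover have "(\<Sum>n<M. real (num_B k i m n) * ?r ^ n) \<le> d M k 0" for M
    unfolding d_def using num_B_le[OF k i] by (intro sum_mono mult_right_mono) auto
  ultimately have "(\<Sum>n<M. real (num_B k i m n) * ?r ^ n) \<le> exp (2 * real k * (1 / (1 - ?r))) * 1" for M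
    using order_trans by blast
  then show ?thesis by (rule has_gf_of_bounded)
qed

definition gfB :: "nat \<Rightarrow> nat \<Rightarrow> nat \<Rightarrow> complex" where
  "gfB k i m = (THE s. has_gf (num_B k i m) q s)"

lemma gfB:
  assumes "0 < k" "i \<le> k"
  shows "has_gf (num_B k i m) q (gfB k i m)"
  unfolding gfB_def using gf_num_B_exists[OF assms, of m] has_gf_unique by (metis the_equality)

lemma gfB_0: "0 < k \<Longrightarrow> gfB k 0 m = 0"
proof -
  assume "0 < k"
  moreover have "num_B k 0 m = (\<lambda>n. 0)" by (auto simp: num_B_0)
  ultimately show ?thesis using gfB[of k 0 m] has_gf_zero has_gf_unique by fastforce
qed

lemma gfB_Suc:
  assumes "i < k"
  shows "gfB k (Suc i) m = gfB k i m + q ^ (Suc m * i) * (gfB k (k - i) (Suc m) + q ^ Suc m * gfB k (k - i - 1) (Suc m))"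
proof -
  have "has_gf (num_B k (Suc i) m) q (gfB k i m + q ^ (Suc m * i) * gfB k (k - i) (Suc m)
      + q ^ (Suc m * i + Suc m) * gfB k (k - i - 1) (Suc m))"
    unfolding num_B_Suc_fun[OF assms] using assms by (intro has_gf_add has_gf_shift gfB) auto
  then have "gfB k (Suc i) m = gfB k i m + q ^ (Suc m * i) * gfB k (k - i) (Suc m)
      + q ^ (Suc m * i + Suc m) * gfB k (k - i - 1) (Suc m)"
    using gfB[of k "Suc i" m] assms has_gf_unique by force
  then show ?thesis by (simp only: power_add distrib_left mult.assoc add.assoc)
qed

text \<open>A nonempty multiset with all parts above m has sum above m, so each coefficient is
  eventually that of the series 1.\<close>

lemma gfB_LIMSEQ:
  assumes "0 < i" "i \<le> k"
  shows "(\<lambda>m. gfB k i m) \<longlonglongrightarrow> 1"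
proof -
  have k: "0 < k" using assms by simp
  have gs: "gfB k i m = (\<Sum>n. of_nat (num_B k i m n) * q ^ n)" for m
    using has_sum_imp_sums[OF gfB[OF k assms(2), of m, unfolded has_gf_def]] by (rule sums_unique)
  have "(\<lambda>m. \<Sum>n. of_nat (num_B k i m n) * q ^ n) \<longlonglongrightarrow> (\<Sum>n. if n = 0 then 1 else 0 :: complex)"
  proof (rule tannerys_theorem[where M = "\<lambda>n. real (num_B k k 0 n) * norm q ^ n", THEN conjunct2, THEN conjunct2])
    show "(\<lambda>m. of_nat (num_B k i m n) * q ^ n) \<longlonglongrightarrow> (if n = 0 then 1 else 0)" for n
    proof (rule tendsto_eventually)
      show "eventually (\<lambda>m. of_nat (num_B k i m n) * q ^ n = (if n = 0 then 1 else 0)) sequentially"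
        using eventually_ge_at_top[of n] by eventually_elim (use assms k in \<open>auto simp: num_B_top\<close>)
    qed
    show "eventually (\<lambda>(n, m). norm (of_nat (num_B k i m n) * q ^ n) \<le> real (num_B k k 0 n) * norm q ^ n)
       (sequentially \<times>\<^sub>F sequentially)"
      using num_B_le[OF k assms(2)]
      by (intro always_eventually) (auto simp: norm_mult norm_power intro!: mult_right_mono)
    obtain t where "((\<lambda>n. real (num_B k k 0 n) * norm q ^ n) has_sum t) UNIV"
      using has_gf_norm[OF gfB[OF k order_refl, of 0]] by metis
    then show "summable (\<lambda>n. real (num_B k k 0 n) * norm q ^ n)"
      using has_sum_imp_sums sums_summable by blast
  qed simp
  moreover have "(\<Sum>n. if n = 0 then 1 else 0 :: complex) = 1"
    using sums_unique[OF sums_If_finite_set[of "{0::nat}" "\<lambda>_. 1 :: complex"]] by simp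
  ultimately show ?thesis by (simp add: gs)
qed

text \<open>This is the quotient of the shifted factorials of length m with arguments q^(n+1) and
  -q^(n+1); it is 1 for m = 0.\<close>

definition rho :: "nat \<Rightarrow> nat \<Rightarrow> complex" where
  "rho m n = pochq (m + n) * pochm n / (pochm (m + n) * pochq n)"

lemma rho_Suc_left: "rho m n * (1 - q ^ Suc (m + n)) = rho (Suc m) n * (1 + q ^ Suc (m + n))"
  using one_plus_q_nz[of "Suc (m + n)"] unfolding rho_def add_Suc pochq_Suc pochm_Suc
  by (simp add: divide_simps del: power_Suc)

lemma rho_Suc_right: "rho m (Suc n) * (1 - q ^ Suc n) = rho (Suc m) n * (1 + q ^ Suc n)"
  using one_minus_q_nz[of "Suc n"] unfolding rho_def add_Suc add_Suc_right pochq_Suc pochm_Suc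
  by (simp add: divide_simps del: power_Suc)

lemma rho_bounded: obtains C where "C \<ge> 1" "\<And>m n. norm (rho m n) \<le> C"
proof -
  obtain C where C: "C \<ge> 1" "\<And>n. norm (pochq n) \<le> C" "\<And>n. norm (inverse (pochq n)) \<le> C"
    "\<And>n. norm (pochm n) \<le> C" "\<And>n. norm (inverse (pochm n)) \<le> C" using poch_bounded by metis
  have "norm (rho m n) \<le> (C * C) * (C * C)" for m n
  proof -
    have "rho m n = (pochq (m + n) * pochm n) * (inverse (pochm (m + n)) * inverse (pochq n))"
      by (simp add: rho_def divide_inverse)
    then show ?thesis
      unfolding norm_mult using C by (simp only: norm_mult) (intro mult_mono mult_nonneg_nonneg, auto)
  qed
  moreover have "1 \<le> (C * C) * (C * C)" using C(1) by (simp add: mult_ge1_I)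
  ultimately show ?thesis by (rule that[rotated])
qed

text \<open>Multiplied by \<open>euler_quotient\<close>, this is the general term of Andrews'
  function H with indices k, i, for a = -1/q and x = q^(m+1).\<close>

definition andrews_term :: "nat \<Rightarrow> nat \<Rightarrow> nat \<Rightarrow> nat \<Rightarrow> complex" where
  "andrews_term k i m n = (- 1) ^ n * q ^ (m * k * n + k * n\<^sup>2 + (k - i) * n) * (1 - q ^ (i * (2 * n + 1 + m))) * rho m n"

definition andrews_sum :: "nat \<Rightarrow> nat \<Rightarrow> nat \<Rightarrow> complex" where
  "andrews_sum k i m = (\<Sum>n. andrews_term k i m n)"

lemma andrews_term_bounded:
  assumes "0 < k"
  obtains C where "C \<ge> 1" "\<And>i m n. norm (andrews_term k i m n) \<le> C * norm q ^ n"
    "\<And>i m n. n > 0 \<Longrightarrow> norm (andrews_term k i m n) \<le> C * norm q ^ m"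
proof -
  obtain C where C: "C \<ge> 1" "\<And>m n. norm (rho m n) \<le> C" using rho_bounded by metis
  have gen: "norm (andrews_term k i m n) \<le> (2 * C) * norm q ^ e" if "e \<le> m * k * n + k * n\<^sup>2 + (k - i) * n" for i m n e
  proof -
    have "norm (1 - q ^ (i * (2 * n + 1 + m))) \<le> 2"
      using norm_q_power_le by (intro order_trans[OF norm_triangle_ineq4]) (simp add: order_trans[OF add_left_mono])
    moreover have "norm (q ^ (m * k * n + k * n\<^sup>2 + (k - i) * n)) \<le> norm q ^ e"
      unfolding norm_power using q_lt that by (intro power_decreasing) auto
    ultimately have "norm (andrews_term k i m n) \<le> norm q ^ e * 2 * C"
      unfolding andrews_term_def norm_mult using C
      by (intro mult_mono mult_nonneg_nonneg) (auto simp: norm_power)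
    then show ?thesis by (simp add: mult_ac)
  qed
  show ?thesis
  proof (rule that[of "2 * C"])
    show "norm (andrews_term k i m n) \<le> (2 * C) * norm q ^ n" for i m n
    proof (rule gen)
      have "n \<le> k * n\<^sup>2" using le_mult_square[OF assms] .
      then show "n \<le> m * k * n + k * n\<^sup>2 + (k - i) * n" by simp
    qed
    show "norm (andrews_term k i m n) \<le> (2 * C) * norm q ^ m" if "n > 0" for i m n
    proof (rule gen)
      have "m * 1 \<le> m * (k * n)" using assms that by (intro mult_left_mono) auto
      then have "m \<le> m * k * n" by (simp only: mult.assoc mult_1_right)
      then show "m \<le> m * k * n + k * n\<^sup>2 + (k - i) * n" by linarith
    qed
  qed (use C in simp)
qed

lemma summable_andrews_term: "0 < k \<Longrightarrow> summable (\<lambda>n. andrews_term k i m n)"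
proof -
  assume k: "0 < k"
  obtain C where C: "\<And>i m n. norm (andrews_term k i m n) \<le> C * norm q ^ n" using andrews_term_bounded[OF k] by metis
  show ?thesis
  proof (rule summable_comparison_test')
    show "summable (\<lambda>n. C * norm q ^ n)" using q_lt by (intro summable_mult summable_geometric) auto
  qed (use C in auto)
qed

lemma andrews_sum_sums: "0 < k \<Longrightarrow> andrews_term k i m sums andrews_sum k i m"
  unfolding andrews_sum_def by (rule summable_sums[OF summable_andrews_term])

lemma andrews_sum_0: "andrews_sum k 0 m = 0"
  by (simp add: andrews_sum_def andrews_term_def)

text \<open>The difference of two consecutive terms splits into two parts, the first of which has to
  be shifted by one before the recurrence can be read off.\<close>

lemma andrews_sum_Suc:
  assumes i: "i < k"
  shows "andrews_sum k (Suc i) m = andrews_sum k i m + q ^ (Suc m * i) * (andrews_sum k (k - i) (Suc m) + q ^ Suc m * andrews_sum k (k - i - 1) (Suc m))"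
proof -
  have k: "0 < k" using i by simp
  define j where "j = k - i - 1"
  have kj: "k = i + 1 + j" using i by (simp add: j_def)
  define A where "A = (\<lambda>n. (- 1) ^ n * q ^ (m * k * n + k * n\<^sup>2 + j * n) * ((1 - q ^ n) * rho m n))"
  define B where "B = (\<lambda>n. (- 1) ^ n * q ^ (m * k * n + k * n\<^sup>2 + k * n + (m + n + 1) * i) * (rho m n * (1 - q ^ Suc (m + n))))"
  define R where "R = (\<lambda>n. q ^ (Suc m * i) * (andrews_term k (k - i) (Suc m) n + q ^ Suc m * andrews_term k (k - i - 1) (Suc m) n))"
  have split: "andrews_term k (Suc i) m n - andrews_term k i m n = A n + B n" for n
  proof -
    define y where "y = q ^ (m * k * n + k * n\<^sup>2 + j * n)"
    have e1: "m * k * n + k * n\<^sup>2 + (k - Suc i) * n = m * k * n + k * n\<^sup>2 + j * n" by (simp add: j_def)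
    have e2: "m * k * n + k * n\<^sup>2 + (k - i) * n = (m * k * n + k * n\<^sup>2 + j * n) + n" by (simp add: kj)
    have e3: "m * k * n + k * n\<^sup>2 + k * n + (m + n + 1) * i = (m * k * n + k * n\<^sup>2 + j * n) + (n + i * (2 * n + 1 + m))"
      by (simp add: kj algebra_simps)
    have e4: "Suc i * (2 * n + 1 + m) = (n + i * (2 * n + 1 + m)) + Suc (m + n)" by (simp add: algebra_simps)
    define z where "z = q ^ (i * (2 * n + 1 + m))"
    define w where "w = q ^ Suc (m + n)"
    show ?thesis
      unfolding andrews_term_def A_def B_def e1 e2 e3 e4 power_add[of q _ n] power_add[of q "_ + _ * _" "_ + _ * _"]
        power_add[of q n "_ * _"] power_add[of q "_ + _ * _" "Suc _"] y_def[symmetric] z_def[symmetric] w_def[symmetric]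
      by (simp add: algebra_simps)
  qed
  \<comment> \<open>\<open>rho_Suc_right\<close> relates A at n + 1, and \<open>rho_Suc_left\<close>
    relates B at n, to the same \<open>rho (Suc m) n\<close>; hence the delay in A. It does not
    change the sum, because A vanishes at 0 and at infinity.\<close>
  have comb: "A (Suc n) + B n = R n" for n
  proof -
    define E where "E = Suc m * i + Suc m * k * n + k * n\<^sup>2 + i * n"
    have eA: "m * k * Suc n + k * (Suc n)\<^sup>2 + j * Suc n = E + (Suc (m + n) + j * (2 * n + 1 + Suc m))"
      by (simp add: E_def kj power2_eq_square algebra_simps)
    have eB: "m * k * n + k * n\<^sup>2 + k * n + (m + n + 1) * i = E"
      by (simp add: E_def algebra_simps)
    have ki: "k - i = Suc j" "k - i - 1 = j" "k - Suc j = i" "k - j = Suc i" using kj by auto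
    have A: "A (Suc n) = - ((- 1) ^ n * q ^ (E + (Suc (m + n) + j * (2 * n + 1 + Suc m))) * (rho (Suc m) n * (1 + q ^ Suc n)))"
      unfolding A_def eA using rho_Suc_right[of m n] by (simp add: mult.commute del: power_Suc) simp
    have B: "B n = (- 1) ^ n * q ^ E * (rho (Suc m) n * (1 + q ^ Suc (m + n)))"
      unfolding B_def eB rho_Suc_left ..
    have R: "R n = (- 1) ^ n * q ^ E * ((1 - q ^ (Suc j * (2 * n + 1 + Suc m)))
        + q ^ Suc (m + n) * (1 - q ^ (j * (2 * n + 1 + Suc m)))) * rho (Suc m) n"
    proof -
      have "q ^ E = q ^ (Suc m * i) * q ^ (Suc m * k * n + k * n\<^sup>2 + i * n)"
        unfolding E_def by (simp only: power_add mult.assoc)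
      moreover have "q ^ E * q ^ Suc (m + n) = q ^ (Suc m * i) * (q ^ Suc m * q ^ (Suc m * k * n + k * n\<^sup>2 + Suc i * n))"
        unfolding E_def power_add[symmetric] by (rule arg_cong[of _ _ "\<lambda>e. q ^ e"]) (simp add: algebra_simps)
      moreover have "a * (s * x1 * y1 * u + v * (s * x2 * y2 * u)) = s * e * (y1 + w * y2) * u"
        if e: "e = a * x1" "e * w = a * (v * x2)" for a s x1 y1 u v x2 y2 e w :: complex
      proof -
        have "s * e * (y1 + w * y2) * u = s * (e * y1 + (e * w) * y2) * u" by (simp only: algebra_simps)
        also have "\<dots> = a * (s * x1 * y1 * u + v * (s * x2 * y2 * u))"
          unfolding e(2) unfolding e(1) by (simp only: algebra_simps)
        finally show ?thesis ..
      qed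
      ultimately show ?thesis
        unfolding R_def ki(2) unfolding ki(1) andrews_term_def ki(3) ki(4) by blast
    qed
    have "Suc j * (2 * n + 1 + Suc m) = (Suc (m + n) + j * (2 * n + 1 + Suc m)) + Suc n" by (simp add: algebra_simps)
    then have r1: "q ^ (Suc j * (2 * n + 1 + Suc m)) = q ^ (Suc (m + n) + j * (2 * n + 1 + Suc m)) * q ^ Suc n"
      by (simp only: power_add)
    have r2: "q ^ (Suc (m + n) + j * (2 * n + 1 + Suc m)) = q ^ Suc (m + n) * q ^ (j * (2 * n + 1 + Suc m))"
      by (simp only: power_add)
    define x y z where "x = q ^ Suc (m + n)" and "y = q ^ (j * (2 * n + 1 + Suc m))" and "z = q ^ Suc n"
    show ?thesis
      unfolding A B R r1 power_add[of q E] r2 x_def[symmetric] y_def[symmetric] z_def[symmetric]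
      by (simp add: algebra_simps)
  qed
  have Rs: "R sums (q ^ (Suc m * i) * (andrews_sum k (k - i) (Suc m) + q ^ Suc m * andrews_sum k (k - i - 1) (Suc m)))"
    unfolding R_def by (intro sums_mult sums_add andrews_sum_sums k)
  have Ds: "(\<lambda>n. A n + B n) sums (andrews_sum k (Suc i) m - andrews_sum k i m)"
    unfolding split[symmetric] by (intro sums_diff andrews_sum_sums k)
  have "A \<longlonglongrightarrow> 0"
  proof -
    obtain C where C: "C \<ge> 1" "\<And>m n. norm (rho m n) \<le> C" using rho_bounded by metis
    show ?thesis
    proof (rule Lim_null_comparison)
      show "eventually (\<lambda>n. norm (A n) \<le> (2 * C) * norm q ^ n) sequentially"
      proof (rule always_eventually, rule allI)
        fix n
        have "n \<le> k * n\<^sup>2" using le_mult_square[OF k] .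
        then have "norm (q ^ (m * k * n + k * n\<^sup>2 + j * n)) \<le> norm q ^ n"
          unfolding norm_power using q_lt by (intro power_decreasing) auto
        moreover have "norm (1 - q ^ n) \<le> 2"
          using norm_q_power_le[of n] by (intro order_trans[OF norm_triangle_ineq4]) simp
        ultimately have "norm (A n) \<le> norm q ^ n * (2 * C)"
          unfolding A_def norm_mult using C by (intro mult_mono mult_nonneg_nonneg) (auto simp: norm_power)
        then show "norm (A n) \<le> (2 * C) * norm q ^ n" by (simp add: mult.commute)
      qed
      show "(\<lambda>n. (2 * C) * norm q ^ n) \<longlonglongrightarrow> 0"
        using q_lt by (intro tendsto_mult_right_zero LIMSEQ_power_zero) auto
    qed
  qed
  then have "(\<lambda>n. A (Suc n) - A n) sums (0 - A 0)" by (rule telescope_sums)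
  moreover have "A 0 = 0" by (simp add: A_def)
  ultimately have "(\<lambda>n. (A n + B n) + (A (Suc n) - A n)) sums (andrews_sum k (Suc i) m - andrews_sum k i m + 0)"
    using Ds by (intro sums_add) auto
  moreover have "(A n + B n) + (A (Suc n) - A n) = R n" for n using comb[of n] by (simp add: algebra_simps)
  ultimately have "R sums (andrews_sum k (Suc i) m - andrews_sum k i m)" by simp
  with Rs have "andrews_sum k (Suc i) m - andrews_sum k i m
    = q ^ (Suc m * i) * (andrews_sum k (k - i) (Suc m) + q ^ Suc m * andrews_sum k (k - i - 1) (Suc m))"
    using sums_unique2 by blast
  then show ?thesis by (simp add: algebra_simps)
qed

definition euler_quotient :: complex where
  "euler_quotient = qpoch_inf (- q) q / qpoch_inf q q"

text \<open>Terms with n > 0 carry at least q^m. The term n = 0 tends to the quotient of (q) by (-q)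
  at infinity, which is where \<open>euler_quotient\<close> comes from.\<close>

lemma andrews_sum_LIMSEQ:
  assumes "0 < i" "i \<le> k"
  shows "(\<lambda>m. euler_quotient * andrews_sum k i m) \<longlonglongrightarrow> 1"
proof -
  have k: "0 < k" using assms by simp
  obtain C where C: "C \<ge> 1" "\<And>i m n. norm (andrews_term k i m n) \<le> C * norm q ^ n"
    "\<And>i m n. n > 0 \<Longrightarrow> norm (andrews_term k i m n) \<le> C * norm q ^ m"
    using andrews_term_bounded[OF k] by metis
  have q0: "(\<lambda>m. norm q ^ m) \<longlonglongrightarrow> 0" using q_lt by (intro LIMSEQ_power_zero) auto
  have "(\<lambda>m. \<Sum>n. andrews_term k i m n) \<longlonglongrightarrow> (\<Sum>n. if n = 0 then inverse euler_quotient else 0)"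
  proof (rule tannerys_theorem[where M = "\<lambda>n. C * norm q ^ n", THEN conjunct2, THEN conjunct2])
    show "(\<lambda>m. andrews_term k i m n) \<longlonglongrightarrow> (if n = 0 then inverse euler_quotient else 0)" for n
    proof (cases "n = 0")
      case True
      have "(\<lambda>m. q ^ (i * Suc m)) \<longlonglongrightarrow> 0"
      proof (rule Lim_null_comparison[OF _ q0])
        have "m \<le> i * Suc m" for m using assms by (cases i) auto
        then show "eventually (\<lambda>m. norm (q ^ (i * Suc m)) \<le> norm q ^ m) sequentially"
          unfolding norm_power using q_lt by (intro always_eventually allI power_decreasing) auto
      qed
      then have "(\<lambda>m. (1 - q ^ (i * Suc m)) * (pochq m / pochm m)) \<longlonglongrightarrow> (1 - 0) * (qpoch_inf q q / qpoch_inf (- q) q)"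
        by (intro tendsto_intros pochq_LIMSEQ pochm_LIMSEQ qpoch_inf_mq_nz)
      then show ?thesis using True by (simp add: andrews_term_def rho_def euler_quotient_def)
    next
      case False
      have "(\<lambda>m. andrews_term k i m n) \<longlonglongrightarrow> 0"
      proof (rule Lim_null_comparison)
        show "eventually (\<lambda>m. norm (andrews_term k i m n) \<le> C * norm q ^ m) sequentially"
          using C(3) False by simp
        show "(\<lambda>m. C * norm q ^ m) \<longlonglongrightarrow> 0" by (rule tendsto_mult_right_zero[OF q0])
      qed
      then show ?thesis using False by simp
    qed
    show "eventually (\<lambda>(n, m). norm (andrews_term k i m n) \<le> C * norm q ^ n) (sequentially \<times>\<^sub>F sequentially)"
      using C(2) by (intro always_eventually) auto
    show "summable (\<lambda>n. C * norm q ^ n)" using q_lt by (intro summable_mult summable_geometric) auto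
  qed simp
  moreover have "(\<Sum>n. if n = 0 then inverse euler_quotient else 0) = inverse euler_quotient"
    using sums_unique[OF sums_If_finite_set[of "{0::nat}" "\<lambda>_. inverse euler_quotient"]] by simp
  ultimately have "(\<lambda>m. euler_quotient * andrews_sum k i m) \<longlonglongrightarrow> euler_quotient * inverse euler_quotient"
    unfolding andrews_sum_def by (intro tendsto_mult tendsto_const) simp
  moreover have "euler_quotient \<noteq> 0" using qpoch_inf_q_nz qpoch_inf_mq_nz by (simp add: euler_quotient_def)
  ultimately show ?thesis by simp
qed

text \<open>The difference satisfies the same homogeneous recurrence and tends to 0 as m grows. By
  the growth bound it is at every level at most a constant times its size arbitrarily far
  out.\<close>

lemma gfB_eq_andrews_sum:
  assumes k: "0 < k" and i: "i \<le> k"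
  shows "gfB k i m = euler_quotient * andrews_sum k i m"
proof -
  let ?r = "norm q" and ?D = "\<lambda>i m. gfB k i m - euler_quotient * andrews_sum k i m"
  let ?L = "exp (2 * real k * (1 / (1 - ?r)))"
  define d where "d = (\<lambda>i m. norm (?D i m))"
  have D0: "?D 0 m = 0" for m using gfB_0[OF k] by (simp add: andrews_sum_0)
  have lim: "(\<lambda>p. d i (m + p)) \<longlonglongrightarrow> 0" if "i \<le> k" for i
  proof (cases "i = 0")
    case False
    have "(\<lambda>m. ?D i m) \<longlonglongrightarrow> 1 - 1"
      using False that by (intro tendsto_diff gfB_LIMSEQ andrews_sum_LIMSEQ) auto
    then have "(\<lambda>m. d i m) \<longlonglongrightarrow> 0" unfolding d_def using tendsto_norm by fastforce
    then show ?thesis using LIMSEQ_ignore_initial_segment[of "d i" 0 m] by (simp add: add.commute)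
  qed (use D0 in \<open>simp add: d_def\<close>)
  then have sum_lim: "(\<lambda>p. ?L * (\<Sum>i\<le>k. d i (m + p))) \<longlonglongrightarrow> ?L * (\<Sum>i\<le>k. 0)"
    by (intro tendsto_mult tendsto_const tendsto_sum) auto
  have "d i m \<le> ?L * (\<Sum>i\<le>k. d i (m + p))" for p
  proof (rule recurrence_growth_const[where p = p and d = d and k = k])
    show "d 0 m = 0" for m using D0 by (simp add: d_def)
    show "d (Suc i) m \<le> d i m + ?r ^ (Suc m * i) * (d (k - i) (Suc m) + ?r ^ Suc m * d (k - i - 1) (Suc m))"
      if "i < k" for i m
    proof -
      define X Y Z where "X = ?D i m" and "Y = ?D (k - i) (Suc m)" and "Z = ?D (k - i - 1) (Suc m)"
      have D: "?D (Suc i) m = X + q ^ (Suc m * i) * (Y + q ^ Suc m * Z)"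
        unfolding X_def Y_def Z_def gfB_Suc[OF that] andrews_sum_Suc[OF that] by (simp only: algebra_simps)
      have "norm (Y + q ^ Suc m * Z) \<le> norm Y + ?r ^ Suc m * norm Z"
        using norm_triangle_ineq[of Y "q ^ Suc m * Z"] by (simp only: norm_mult norm_power)
      then have "?r ^ (Suc m * i) * norm (Y + q ^ Suc m * Z) \<le> ?r ^ (Suc m * i) * (norm Y + ?r ^ Suc m * norm Z)"
        by (rule mult_left_mono) simp
      moreover have "norm (X + q ^ (Suc m * i) * (Y + q ^ Suc m * Z)) \<le>
          norm X + ?r ^ (Suc m * i) * norm (Y + q ^ Suc m * Z)"
        using norm_triangle_ineq[of X "q ^ (Suc m * i) * (Y + q ^ Suc m * Z)"] by (simp only: norm_mult norm_power)
      ultimately show ?thesis unfolding d_def D unfolding X_def[symmetric] Y_def[symmetric] Z_def[symmetric]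
        by linarith
    qed
    show "0 \<le> (\<Sum>i\<le>k. d i (m + p))" by (simp add: d_def sum_nonneg)
    show "d i (m + p) \<le> (\<Sum>i\<le>k. d i (m + p))" if "i \<le> k" for i
      using that by (intro member_le_sum) (auto simp: d_def)
  qed (use q_lt i in auto)
  then have "d i m \<le> ?L * (\<Sum>i\<le>k. 0)"
    by (intro LIMSEQ_le_const[OF sum_lim]) auto
  then show ?thesis by (simp add: d_def)
qed

text \<open>The factor 1 - q^(i(2n+1)) of the n-th term pairs the theta terms with indices n and -1
  - n.\<close>

lemma andrews_sum_eq_thetas:
  assumes "0 < i" "i \<le> k"
  shows "andrews_sum k i 0 = thetas (int k) (int (k - i))"
proof -
  let ?t = "theta (int k) (int (k - i))"
  have t: "(?t has_sum thetas (int k) (int (k - i))) UNIV"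
    using sum_eps(2)[of "int (k - i)" k] assms by simp
  have "?t summable_on UNIV" using t by (rule has_sum_imp_summable)
  then have "(\<lambda>n. ?t (int n)) summable_on UNIV" "(\<lambda>n. ?t (- 1 - int n)) summable_on UNIV"
    using summable_on_reindex[of int UNIV ?t] summable_on_reindex[of "\<lambda>n. - 1 - int n" UNIV ?t]
    by (auto simp: o_def inj_def intro: summable_on_subset_banach)
  then obtain a b where ab: "((\<lambda>n. ?t (int n)) has_sum a) UNIV" "((\<lambda>n. ?t (- 1 - int n)) has_sum b) UNIV"
    by (auto simp: summable_on_def)
  have "thetas (int k) (int (k - i)) = a + b"
    using t has_sum_int_split[OF ab] by (rule has_sum_unique)
  moreover have "?t (int n) + ?t (- 1 - int n) = andrews_term k i 0 n" for n
  proof -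
    have 1: "?t (int n) = (- 1) ^ n * q ^ (k * n\<^sup>2 + (k - i) * n)"
    proof -
      have "int k * (int n)\<^sup>2 + int (k - i) * int n = int (k * n\<^sup>2 + (k - i) * n)" by simp
      then show ?thesis unfolding theta_def by (simp only: power_int_of_nat)
    qed
    have 2: "?t (- 1 - int n) = - ((- 1) ^ n * q ^ (k * n\<^sup>2 + (k - i) * n + i * (2 * n + 1)))"
    proof -
      have "int k * (- 1 - int n)\<^sup>2 + int (k - i) * (- 1 - int n) = int (k * n\<^sup>2 + (k - i) * n + i * (2 * n + 1))"
      proof -
        obtain j where "k = i + j" using assms le_Suc_ex by blast
        then show ?thesis by (simp add: algebra_simps power2_eq_square)
      qed
      moreover have "(- 1) powi (- 1 - int n) = - ((- 1) ^ n :: complex)"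
        using power_int_minus_one_minus[of "1 + int n", where 'a = complex] by (simp add: power_int_add)
      ultimately show ?thesis unfolding theta_def by (simp only: power_int_of_nat) simp
    qed
    show ?thesis unfolding 1 2 by (simp add: andrews_term_def rho_def power_add algebra_simps)
  qed
  ultimately have "(andrews_term k i 0 has_sum thetas (int k) (int (k - i))) UNIV"
    using has_sum_add[OF ab] by simp
  then show ?thesis
    unfolding andrews_sum_def using has_sum_imp_sums sums_unique by metis
qed

theorem gf_num_B:
  assumes "0 < i" "i \<le> k"
  shows "has_gf (num_B k i 0) q (euler_quotient * thetas (int k) (int (k - i)))"
  using gfB[of k i 0] gfB_eq_andrews_sum[of k i 0] andrews_sum_eq_thetas[OF assms] assms by simp

text \<open>For k = 1 the recurrence only says that the count does not depend on m, and at large m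
  nothing but the empty multiset is left.\<close>

lemma num_B_1: "num_B 1 1 m n = (if n = 0 then 1 else 0)"
proof -
  have "num_B 1 1 m n = num_B 1 1 (m + p) n" for p
  proof (induction p)
    case (Suc p)
    have "num_B 1 1 (m + p) n = num_B 1 1 (Suc (m + p)) n"
      using num_B_Suc[of 0 1 "m + p" n] by (simp add: num_B_0 shift_def)
    with Suc show ?case by simp
  qed simp
  from this[of n] show ?thesis by (simp add: num_B_top)
qed

text \<open>Both constants are determined by the trivial case \<open>k = 1\<close>.\<close>

lemma bailey_const_eq_euler_quotient: "bailey_const = euler_quotient"
proof -
  have "num_B 1 1 0 = (\<lambda>n. if n = 0 then 1 else 0)" by (rule ext) (rule num_B_1)
  then have "has_gf (num_B 1 1 0) q 1" using has_gf_one by simp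
  moreover have "has_gf (num_B 1 1 0) q (euler_quotient * thetas 1 0)" using gf_num_B[of 1 1] by simp
  ultimately have "euler_quotient * thetas 1 0 = 1" by (metis has_gf_unique)
  then have "euler_quotient * thetas 1 0 = bailey_const * thetas 1 0" using bailey_const_thetas by simp
  moreover have "thetas 1 0 \<noteq> 0" using bailey_const_thetas by auto
  ultimately show ?thesis by simp
qed

end

subsection \<open>Majorants and the final identities\<close>

text \<open>The values at q = 0 are not given. Once the lower coefficients agree, the n-th
  difference is the limit at 0 of a series that vanishes on the punctured disc.\<close>

lemma powser_coeffs_unique:
  assumes "\<And>q :: complex. q \<noteq> 0 \<Longrightarrow> norm q < 1 \<Longrightarrow> \<exists>s. has_gf c q s \<and> has_gf d q s"
  shows "c n = d n"
proof (induction n rule: less_induct)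
  case (less n)
  define a :: "nat \<Rightarrow> complex" where "a = (\<lambda>n. of_nat (c n) - of_nat (d n))"
  have "(\<lambda>i. a (i + n) * x ^ i) sums 0" if x: "x \<noteq> 0" "norm x < 1" for x :: complex
  proof -
    obtain s where "has_gf c x s" "has_gf d x s" using assms[OF x] by blast
    then have "(\<lambda>i. of_nat (c i) * x ^ i - of_nat (d i) * x ^ i) sums (s - s)"
      unfolding has_gf_def by (intro sums_diff has_sum_imp_sums)
    then have "(\<lambda>i. a i * x ^ i) sums 0" by (simp add: a_def left_diff_distrib)
    moreover have "a i * x ^ i = 0" if "i < n" for i using less.IH[OF that] by (simp add: a_def)
    ultimately have "(\<lambda>i. a (i + n) * x ^ (i + n)) sums 0"
      using sums_zero_iff_shift[of n "\<lambda>i. a i * x ^ i" 0] by simp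
    from sums_mult[OF this, of "inverse (x ^ n)"] x show ?thesis
      by (simp add: power_add field_simps)
  qed
  then have "((\<lambda>_. 0) \<longlongrightarrow> a (0 + n)) (at (0 :: complex))"
    by (intro powser_limit_0_strong[of 1 "\<lambda>i. a (i + n)" "\<lambda>_. 0"]) auto
  then have "a n = 0"
    using tendsto_unique[OF trivial_limit_at tendsto_const[of 0 "at (0 :: complex)"]] by force
  then show ?case by (simp add: a_def)
qed

lemma nonneg_Reals_norm: "z \<in> \<real>\<^sub>\<ge>\<^sub>0 \<Longrightarrow> z = of_real (norm z)" for z :: complex
  by (metis nonneg_Reals_cases norm_of_real abs_of_nonneg)

lemma norm_sum_nonneg_Reals:
  fixes f :: "'a \<Rightarrow> complex"
  assumes "\<And>x. x \<in> A \<Longrightarrow> f x \<in> \<real>\<^sub>\<ge>\<^sub>0"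
  shows "norm (\<Sum>x\<in>A. f x) = (\<Sum>x\<in>A. norm (f x))"
proof -
  have "(\<Sum>x\<in>A. f x) = of_real (\<Sum>x\<in>A. norm (f x))"
    unfolding of_real_sum using assms by (intro sum.cong refl nonneg_Reals_norm)
  then have "norm (\<Sum>x\<in>A. f x) = \<bar>\<Sum>x\<in>A. norm (f x)\<bar>" by (simp only: norm_of_real)
  then show ?thesis by (simp add: sum_nonneg)
qed

lemma prod_nonneg_Reals:
  fixes f :: "'a \<Rightarrow> complex"
  shows "(\<And>x. x \<in> A \<Longrightarrow> f x \<in> \<real>\<^sub>\<ge>\<^sub>0) \<Longrightarrow> (\<Prod>x\<in>A. f x) \<in> \<real>\<^sub>\<ge>\<^sub>0"
  by (induction A rule: infinite_finite_induct) (auto intro: nonneg_Reals_mult_I)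

context nome
begin

section \<open>Comparison with the nome |q|\<close>

abbreviation qr :: complex where "qr \<equiv> of_real (norm q)"

lemma nome_qr: "nome qr"
  using q_nz q_lt by unfold_locales auto

interpretation R: nome qr by (rule nome_qr)

lemma R_one_plus: "1 + qr ^ n = of_real (1 + norm q ^ n)"
  by simp

lemma R_pochm: "R.pochm n = of_real (\<Prod>i<n. 1 + norm q ^ (i + 1))"
  by (simp add: R.pochm_def)

lemma R_pochq: "R.pochq n = of_real (\<Prod>i<n. 1 - norm q ^ (i + 1))"
  by (simp add: R.pochq_def)

lemma norm_one_plus_le: "norm (1 + q ^ n) \<le> norm (1 + qr ^ n)"
proof -
  have "norm (1 + q ^ n) \<le> 1 + norm q ^ n"
    using norm_triangle_ineq[of 1 "q ^ n"] by (simp add: norm_power)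
  also have "\<dots> = norm (1 + qr ^ n)" unfolding R_one_plus norm_of_real by simp
  finally show ?thesis .
qed

lemma norm_pochm_le: "norm (pochm n) \<le> norm (R.pochm n)"
  unfolding pochm_def R.pochm_def prod_norm[symmetric] by (intro prod_mono conjI norm_one_plus_le norm_ge_zero)

lemma norm_mhalf_le: "norm (mhalf N) \<le> norm (R.mhalf N)"
  using norm_pochm_le by (cases N) (simp_all add: mhalf_0 mhalf_Suc R.mhalf_0 R.mhalf_Suc)

text \<open>Factor by factor, 1 - |q|^i <= |1 - q^i|, so the denominators are smallest at
  |q|.\<close>

lemma norm_invq_le: "norm (invq j) \<le> norm (R.invq j)"
proof -
  have "norm (R.pochq n) \<le> norm (pochq n)" for n
    unfolding pochq_def R.pochq_def prod_norm[symmetric]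
  proof (intro prod_mono conjI norm_ge_zero)
    fix i
    have "norm q ^ (i + 1) \<le> 1" using q_lt by (intro power_le_one) auto
    moreover have "1 - qr ^ (i + 1) = of_real (1 - norm q ^ (i + 1))" by simp
    ultimately have "norm (1 - qr ^ (i + 1)) = 1 - norm q ^ (i + 1)"
      by (simp only: norm_of_real)
    also have "\<dots> \<le> norm (1 - q ^ (i + 1))"
      using norm_triangle_ineq2[of 1 "q ^ (i + 1)"] by (simp only: norm_power norm_one)
    finally show "norm (1 - qr ^ (i + 1)) \<le> norm (1 - q ^ (i + 1))" .
  qed
  then show ?thesis
    unfolding invq_def R.invq_def by (simp add: norm_divide frac_le)
qed

lemma R_nonneg_Reals:
  "qr ^ n \<in> \<real>\<^sub>\<ge>\<^sub>0" "1 + qr ^ n \<in> \<real>\<^sub>\<ge>\<^sub>0" "R.mhalf N \<in> \<real>\<^sub>\<ge>\<^sub>0" "R.invq j \<in> \<real>\<^sub>\<ge>\<^sub>0"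
proof -
  show "qr ^ n \<in> \<real>\<^sub>\<ge>\<^sub>0" by (simp flip: of_real_power)
  show "1 + qr ^ n \<in> \<real>\<^sub>\<ge>\<^sub>0" unfolding R_one_plus by simp
  have m: "R.pochm n \<in> \<real>\<^sub>\<ge>\<^sub>0" for n unfolding R_pochm nonneg_Reals_of_real_iff by (simp add: prod_nonneg)
  have "R.mhalf 0 = of_real (1 / 2)" by (simp add: R.mhalf_0)
  then have "R.mhalf 0 \<in> \<real>\<^sub>\<ge>\<^sub>0" by (simp only: nonneg_Reals_of_real_iff)
  then show "R.mhalf N \<in> \<real>\<^sub>\<ge>\<^sub>0" using m by (cases N) (auto simp: R.mhalf_Suc)
  have "R.pochq n \<in> \<real>\<^sub>\<ge>\<^sub>0" for n
    unfolding R_pochq nonneg_Reals_of_real_iff using q_lt by (auto intro!: prod_nonneg mult_le_one power_le_one)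
  then show "R.invq j \<in> \<real>\<^sub>\<ge>\<^sub>0"
    unfolding R.invq_def by (auto intro: nonneg_Reals_divide_I)
qed

lemma norm_core_le: "norm (core k a t) \<le> norm (R.core k a t)"
  unfolding core_def R.core_def tuple_denom_def R.tuple_denom_def norm_mult prod_norm[symmetric]
  by (intro mult_mono prod_mono norm_one_plus_le norm_invq_le conjI prod_nonneg mult_nonneg_nonneg)
     (simp_all add: norm_power)

lemma norm_series_term_le:
  assumes "t \<in> tuples_at k N"
  shows "norm (series_term k a q t) \<le> norm (series_term k a qr t)"
  unfolding series_term_eq[OF assms] R.series_term_eq[OF assms] norm_mult
  by (intro mult_mono norm_mhalf_le norm_core_le mult_nonneg_nonneg) (simp_all add: norm_power)

lemma series_term_nonneg_Reals:
  assumes "t \<in> tuples_at k N"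
  shows "series_term k a qr t \<in> \<real>\<^sub>\<ge>\<^sub>0"
  unfolding R.series_term_eq[OF assms] R.core_def R.tuple_denom_def
  by (intro nonneg_Reals_mult_I prod_nonneg_Reals R_nonneg_Reals)

text \<open>At |q| the terms are nonnegative, so \<open>R.eps\<close> equals the sum of their norms;
  the evaluation over N at this nome is the common majorant for both regroupings.\<close>

lemma summable_norm_R_eps:
  assumes "0 \<le> h" "h < int k"
  shows "(\<lambda>N. norm (R.eps k h N)) summable_on UNIV"
  using R.sum_eps(1)[OF assms] by (metis has_sum_imp_summable summable_on_iff_abs_summable_on_complex)

section \<open>The generating functions of the series, the paths and the overpartitions\<close>

theorem product_side_eq:
  assumes "1 \<le> a" "a \<le> k"
  shows "product_side k a q = euler_quotient * thetas (int k) (int (k - a))"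
proof -
  have "k - (k - a) = a" "k + (k - a) = 2 * k - a" using assms by auto
  then show ?thesis
    using thetas_product[of "k - a" k] assms by (simp add: product_side_def euler_quotient_def)
qed

theorem series_has_sum:
  assumes a: "1 \<le> a" "a \<le> k"
  shows "(series_term k a q has_sum product_side k a q) (index_tuples k)"
proof -
  have k: "1 \<le> k" using a by simp
  have h: "0 \<le> int k - int a" "int k - int a < int k" using a by auto
  have "((\<lambda>(N, t). series_term k a q t) has_sum product_side k a q) (Sigma UNIV (tuples_at k))"
  proof (rule has_sum_Sigma_majorant)
    fix N :: nat
    show "((\<lambda>t. (\<lambda>(N, t). series_term k a q t) (N, t)) has_sum eps k (int k - int a) N) (tuples_at k N)"
      unfolding sum_series_term[OF a, symmetric] by (simp add: finite_tuples_at[OF k])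
    have "norm (R.eps k (int k - int a) N) = (\<Sum>t\<in>tuples_at k N. norm (series_term k a qr t))"
      unfolding R.sum_series_term[OF a, symmetric]
      by (rule norm_sum_nonneg_Reals) (rule series_term_nonneg_Reals)
    then show "((\<lambda>t. (\<lambda>(N, t). norm (series_term k a qr t)) (N, t)) has_sum norm (R.eps k (int k - int a) N)) (tuples_at k N)"
      by (simp add: finite_tuples_at[OF k])
  next
    show "(eps k (int k - int a) has_sum product_side k a q) UNIV"
      using sum_eps(1)[OF h] a unfolding product_side_eq[OF a] bailey_const_eq_euler_quotient by (simp add: of_nat_diff)
    show "(\<lambda>N. norm (R.eps k (int k - int a) N)) summable_on UNIV"
      by (rule summable_norm_R_eps[OF h])
  qed (use norm_series_term_le in auto)
  also have "?this \<longleftrightarrow> ?thesis"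
    by (rule has_sum_reindex_bij_witness[of _ "\<lambda>t. (t 1, t)" snd]) (auto simp: tuples_at_def)
  finally show ?thesis .
qed

theorem paths_has_gf:
  assumes a: "1 \<le> a" "a \<le> k"
  shows "has_gf (E_bar k a) q (product_side k a q)"
proof -
  define h where "h = k - a"
  have h: "h < k" "0 \<le> int h" "int h < int k" using a by (auto simp: h_def)
  let ?f = "\<lambda>(N, n). of_nat (num_E k h N n) * q ^ n"
  have "(?f has_sum product_side k a q) (UNIV \<times> UNIV)"
  proof (rule has_sum_Sigma_majorant)
    fix N :: nat
    show "((\<lambda>n. ?f (N, n)) has_sum eps k (int h) N) UNIV"
      using gf_num_E[OF h(1), of N] by (simp add: has_gf_def)
    obtain t where t: "has_gf (num_E k h N) qr (of_real t)" "0 \<le> t"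
      "((\<lambda>n. real (num_E k h N n) * norm q ^ n) has_sum t) UNIV"
      using has_gf_norm[OF gf_num_E[OF h(1), of N]] by metis
    have "R.eps k (int h) N = of_real t"
      using R.gf_num_E[OF h(1), of N] t(1) by (rule has_gf_unique)
    then have "norm (R.eps k (int h) N) = t" using t(2) by simp
    then show "((\<lambda>n. (\<lambda>(N, n). real (num_E k h N n) * norm q ^ n) (N, n)) has_sum norm (R.eps k (int h) N)) UNIV"
      using t(3) by simp
  next
    show "(eps k (int h) has_sum product_side k a q) UNIV"
      using sum_eps(1)[OF h(2,3)] unfolding product_side_eq[OF a] bailey_const_eq_euler_quotient h_def .
    show "(\<lambda>N. norm (R.eps k (int h) N)) summable_on UNIV"
      by (rule summable_norm_R_eps[OF h(2,3)])
  qed (auto simp: norm_mult norm_power)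
  then have "((\<lambda>(n, N). ?f (N, n)) has_sum product_side k a q) (UNIV \<times> UNIV)"
    by (rule has_sum_swap[THEN iffD1])
  then have "((\<lambda>n. of_nat (E_bar k a n) * q ^ n) has_sum product_side k a q) UNIV"
  proof (rule has_sum_Sigma')
    fix n :: nat
    show "((\<lambda>N. (\<lambda>(n, N). ?f (N, n)) (n, N)) has_sum of_nat (E_bar k a n) * q ^ n) UNIV"
    proof (rule has_sum_finite_neutralI)
      show "finite {..n}" by simp
      show "(case (n, N) of (n, N) \<Rightarrow> case (N, n) of (N, n) \<Rightarrow> of_nat (num_E k h N n) * q ^ n) = 0"
        if "N \<in> UNIV - {..n}" for N
        using that num_E_eq_0[of n N k h] by simp
      show "of_nat (E_bar k a n) * q ^ n = (\<Sum>N\<le>n. case (n, N) of (n, N) \<Rightarrow> case (N, n) of (N, n) \<Rightarrow> of_nat (num_E k h N n) * q ^ n)"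
        unfolding E_bar_eq_sum[OF a] h_def by (simp add: sum_distrib_right)
    qed auto
  qed
  then show ?thesis by (simp add: has_gf_def)
qed

theorem overpartitions_has_gf:
  assumes a: "1 \<le> a" "a \<le> k"
  shows "has_gf (B_bar k a) q (product_side k a q)"
proof -
  have "B_bar k a = num_B k a 0" using B_bar_eq_num_B[OF a] by auto
  then show ?thesis using gf_num_B[of a k] a unfolding product_side_eq[OF a] by simp
qed

end

theorem theorem1p3:
  fixes k a :: nat
  assumes "1 \<le> a" and "a \<le> k"
  shows "(\<forall>n. E_bar k a n = B_bar k a n) \<and>
    (\<forall>q::complex. q \<noteq> 0 \<and> norm q < 1 \<longrightarrow>
       ((\<lambda>n. of_nat (E_bar k a n) * q ^ n) has_sum product_side k a q) UNIV \<and>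
       (series_term k a q has_sum product_side k a q) (index_tuples k))"
proof (intro conjI allI impI)
  fix n
  show "E_bar k a n = B_bar k a n"
  proof (rule powser_coeffs_unique[where c = "E_bar k a" and d = "B_bar k a"])
    fix q :: complex assume "q \<noteq> 0" "norm q < 1"
    then interpret nome q by unfold_locales
    show "\<exists>s. has_gf (E_bar k a) q s \<and> has_gf (B_bar k a) q s"
      using paths_has_gf[OF assms] overpartitions_has_gf[OF assms] by blast
  qed
next
  fix q :: complex assume "q \<noteq> 0 \<and> norm q < 1"
  then interpret nome q by unfold_locales auto
  show "((\<lambda>n. of_nat (E_bar k a n) * q ^ n) has_sum product_side k a q) UNIV"
    using paths_has_gf[OF assms] by (simp add: has_gf_def)
  show "(series_term k a q has_sum product_side k a q) (index_tuples k)"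
    by (rule series_has_sum[OF assms])
qed

end
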